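(* For every $n\in\mathbb{N}$, the functions $[\![-]\!]^?:\mathbb{O}_n\to\mathbb{P}_n^{\checkmark}$ and $[\![-]\!]^{\mathrm{poly}}:\mathbb{P}_n^{\checkmark}\to\mathbb{O}_n$ are mutually inverse. Moreover, for $n\ge2$ and $\omega\in\mathbb{O}_n$: (1) $\omega^\bullet=([\![\omega]\!]^?)^\bullet$, and if $\omega$ is non degenerate, $\omega^|=([\![\omega]\!]^?)^|$; (2) for $[p]\in\omega^\bullet$, $[\![\mathsf{s}_{[p]}\omega]\!]^?=\mathsf{s}_{[p]}[\![\omega]\!]^?$, and $[\![\mathsf{t}\omega]\!]^?=\mathsf{t}[\![\omega]\!]^?$; (3) $\wp_\omega=\wp_{[\![\omega]\!]^?}$.
   Context: **Higher addresses.** $\mathbb{A}_0=\{*\}$ (also $*=[]$, with $*\cdot*=*$), $\mathbb{A}_{n+1}$ = finite lists of elements of $\mathbb{A}_n$, written in brackets; $[p]\cdot[q]=[pq]$ is concatenation; $[p[q]]=[p]\cdot[[q]]$. **Opetopes.** Sets $\mathbb{O}_n$ are defined by induction with, for $\omega\in\mathbb{O}_n$, $n\ge1$, a set $\omega^\bullet\subset\mathbb{A}_{n-1}$ of node addresses, sources $\mathsf{s}_{[p]}\omega\in\mathbb{O}_{n-1}$ ($[p]\in\omega^\bullet$) and target $\mathsf{t}\omega\in\mathbb{O}_{n-1}$. $\mathbb{O}_0=\{\mathrm{pt}\}$, $\mathbb{O}_1=\{\blacksquare\}$, $\blacksquare^\bullet=\{*\}$, $\mathsf{s}_*\blacksquare=\mathsf{t}\blacksquare=\mathrm{pt}$.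 For $n\ge2$ an $n$-opetope is (an isomorphism class of) a finite rooted tree $\omega$ with nodes labelled in $\mathbb{O}_{n-1}$ and edges labelled in $\mathbb{O}_{n-2}$, such that the input edges of a node labelled $\psi$ are indexed by $\psi^\bullet$, the input edge $[q]$ is labelled $\mathsf{s}_{[q]}\psi$, and its output edge is labelled $\mathsf{t}\psi$ (i.e. $\mathbb{O}_n$ is the set of trees over the polynomial monad $\mathfrak{Z}^{n-2}$, where $\mathfrak{Z}^0$ is the identity and $\mathfrak{Z}^{k+1}=(\mathfrak{Z}^k)^+$ is the Baez–Dolan construction). The root edge has address $[]$; the $[q]$-input edge of a node of address $[p]$ has address $[p[q]]$; a node has the address of its output edge. $\omega^\bullet$, $\omega^|$ are the sets of node and leaf addresses; $\mathsf{s}_{[p]}\omega$ is the label of the node at $[p]$. $\mathsf{I}_\phi$ ($\phi\in\mathbb{O}_{n-2}$) is the tree with one edge labelled $\phi$ and no node (degenerate); $\mathsf{Y}_\psi$ ($\psi\in\mathbb{O}_{n-1}$) is the corolla with one node labelled $\psi$. $\omega\circ_{[l]}\omega'$ is the grafting of the root of $\omega'$ on the leaf $[l]$ of $\omega$ (edge labels must agree). Targets and readdressing bijections $\wp_\omega:\omega^|\to(\mathsf{t}\omega)^\bullet$: if $n=2$, $\mathsf{t}\omega=\blacksquare$ and $\wp_\omega$ sends the unique leaf to $*$. If $n\ge3$: $\mathsf{t}\mathsf{I}_\phi=\mathsf{Y}_\phi$, $\wp[]=[]$; $\mathsf{t}\mathsf{Y}_\psi=\psi$, $\wp[[q]]=[q]$;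 and, with $[r]=\wp_\nu[l]$, $\mathsf{t}(\nu\circ_{[l]}\mathsf{Y}_\psi)$ is obtained from the tree $\mathsf{t}\nu$ by replacing its node at $[r]$ by the tree $\psi$, gluing each leaf $[k]$ of $\psi$ to the input $\wp_\psi[k]$ of that node; $\wp[l[q]]=[r]\cdot[q]$ for $[q]\in\psi^\bullet$, and for a leaf $[l']\neq[l]$ of $\nu$, $\wp[l']=[r]\cdot\wp_\psi^{-1}[e]\cdot[r']$ if $\wp_\nu[l']=[r[e]r']$, and $\wp[l']=\wp_\nu[l']$ otherwise. **Preopetopes.** $\mathbb{P}_{-1}=\{\varnothing\}$, $\mathbb{P}_0=\{\mathrm{pt}\}$; for $n\ge1$, an $n$-preopetope is either a nonempty finite set of assignments $\mathbf{p}=\{[p_1]\leftarrow\mathbf{q}_1,\dots,[p_k]\leftarrow\mathbf{q}_k\}$ with pairwise distinct $[p_i]\in\mathbb{A}_{n-1}$ and $\mathbf{q}_i\in\mathbb{P}_{n-1}$, or (for $n\ge2$) a degenerate preopetope $\{\!\{\mathbf{q}$ with $\mathbf{q}\in\mathbb{P}_{n-2}$. For a nondegenerate $n$-preopetope $\mathbf{p}=\{[p_1]\leftarrow\mathbf{q}_1,\dots,[p_k]\leftarrow\mathbf{q}_k\}$, $\mathbf{p}^\bullet=\{[p_1],\dots,[p_k]\}$, $\mathsf{s}_{[p_i]}\mathbf{p}=\mathbf{q}_i$, and (for $n\ge2$) $\mathbf{p}^|$ is the set of $[p[q]]$ with $[p]\in\mathbf{p}^\bullet$, $[q]\in(\mathsf{s}_{[p]}\mathbf{p})^\bullet$,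 $[p[q]]\notin\mathbf{p}^\bullet$. If $\mathbf{p}$ is degenerate, $\mathbf{p}^\bullet=\varnothing$, $\mathbf{p}^|=\{[]\}$; $\mathrm{pt}^\bullet=\mathrm{pt}^|=\varnothing$. The unique 1-preopetope is $\blacksquare=\{*\leftarrow\mathrm{pt}\}$. Improper grafting: for $[r]\in\mathbf{p}^|$, $\mathbf{p}\,\tilde\circ_{[r]}\mathbf{q}$ is $\mathbf{p}$ with the assignment $[r]\leftarrow\mathbf{q}$ added. A sequent is $\Gamma\vdash\mathbf{p}\to\mathbf{t}$ with $\mathbf{p}\in\mathbb{P}_n$, $\mathbf{t}\in\mathbb{P}_{n-1}$, and $\Gamma$ a finite set of pairs $\frac{[l]}{[q]}$, $[l]\in\mathbf{p}^|$, $[q]\in\mathbf{t}^\bullet$. Substitution: let $\mathbf{t}=\{[t_1]\leftarrow\mathbf{w}_1,\dots,[t_l]\leftarrow\mathbf{w}_l\}$ and let $\Upsilon\vdash\mathbf{q}\to\mathbf{u}$ be a sequent with $\mathbf{q}$ of the same dimension as $\mathbf{t}$. If $l=1$ and $\mathbf{q}$ is degenerate, $\mathbf{t}\,\square_{[t_i]}\mathbf{q}=\mathbf{q}$. If $l\ge2$ and $\mathbf{q}$ is degenerate, it is $\{\chi[t_j]\leftarrow\mathbf{w}_j\}_{j\ne i}$ with $\chi[t_j]=[t_ix]$ if $[t_j]=[t_i[]x]$, else $[t_j]$. If $\mathbf{q}=\{[q_1]\leftarrow\mathbf{v}_1,\dots,[q_k]\leftarrow\mathbf{v}_k\}$, it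 consists of $[t_iq_m]\leftarrow\mathbf{v}_m$ ($1\le m\le k$) and $\chi[t_j]\leftarrow\mathbf{w}_j$ ($j\ne i$) with $\chi[t_j]=[t_iax]$ if $[t_j]=[t_i[b]x]$ for some $\frac{[a]}{[b]}\in\Upsilon$, else $[t_j]$. **Rules of $\mathrm{OPT}^?$.** `point`: $\vdash\mathrm{pt}\to\varnothing$. `degen`: from $\Gamma\vdash\mathbf{p}\to\mathbf{t}$ derive $\frac{[]}{[]}\vdash\{\!\{\mathbf{p}\to\{[]\leftarrow\mathbf{p}\}$. `shift`: from $\Gamma\vdash\mathbf{p}\to\mathbf{t}$ with $\mathbf{p}^\bullet=\{[p_1],\dots,[p_k]\}$ derive $\frac{[[p_1]]}{[p_1]},\dots,\frac{[[p_k]]}{[p_k]}\vdash\{[]\leftarrow\mathbf{p}\}\to\mathbf{p}$. `graft`-$[p[q]]$: from $\Gamma,\frac{[p[q]]}{[r]}\vdash\mathbf{p}\to\mathbf{t}$ and $\Upsilon\vdash\mathbf{q}\to\mathbf{u}$, where $\dim\mathbf{p}=n\ge2$, $\dim\mathbf{q}=n-1$, $\mathbf{q}^\bullet=\{[s_1],\dots,[s_l]\}$ and $\mathsf{s}_{[q]}\mathsf{s}_{[p]}\mathbf{p}=\mathbf{u}$, derive $\Gamma',\frac{[p[q][s_1]]}{[rs_1]},\dots,\frac{[p[q][s_l]]}{[rs_l]}\vdash\mathbf{p}\,\tilde\circ_{[p[q]]}\mathbf{q}\to\mathbf{t}\,\square_{[r]}\mathbf{q}$, where $\Gamma'$ consists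 of $\frac{[a]}{[rxr']}$ for $\frac{[a]}{[r[y]r']}\in\Gamma$ with $\frac{[x]}{[y]}\in\Upsilon$, and of the other pairs $\frac{[a]}{[b]}\in\Gamma$ unchanged. $\mathbb{P}_n^{\checkmark}$ is the set of $\mathbf{p}\in\mathbb{P}_n$ for which some sequent $\Gamma\vdash\mathbf{p}\to\mathbf{t}$ is derivable; $\Gamma$ and $\mathbf{t}$ are then uniquely determined by $\mathbf{p}$; put $\mathsf{t}\mathbf{p}=\mathbf{t}$, and let $\wp_{\mathbf{p}}:\mathbf{p}^|\to\mathbf{t}^\bullet$ be the bijection with graph $\Gamma$. **The two maps.** For $n=0,1$ both sets are singletons. For $n\ge2$: $[\![\mathsf{I}_\phi]\!]^?=\{\!\{[\![\phi]\!]^?$; $[\![\mathsf{Y}_\psi]\!]^?=\{[]\leftarrow[\![\psi]\!]^?\}$; $[\![\nu\circ_{[l]}\mathsf{Y}_\psi]\!]^?=[\![\nu]\!]^?\,\tilde\circ_{[l]}[\![\psi]\!]^?$ for $\nu\in\mathbb{O}_n$ with at least one node. Conversely $[\![\{\!\{\mathbf{q}]\!]^{\mathrm{poly}}=\mathsf{I}_{[\![\mathbf{q}]\!]^{\mathrm{poly}}}$; $[\![\{[]\leftarrow\mathbf{q}\}]\!]^{\mathrm{poly}}=\mathsf{Y}_{[\![\mathbf{q}]\!]^{\mathrm{poly}}}$; $[\![\mathbf{p}\,\tilde\circ_{[l]}\mathbf{q}]\!]^{\mathrm{poly}}=[\![\mathbf{p}]\!]^{\mathrm{poly}}\circ_{[l]}\mathsf{Y}_{[\![\mathbf{q}]\!]^{\mathrm{poly}}}$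 for $\mathbf{p}\in\mathbb{P}_n^{\checkmark}$, $\mathbf{q}\in\mathbb{P}_{n-1}^{\checkmark}$, $[l]\in\mathbf{p}^|$. *)

theory Defs
  imports "HOL-Library.FSet"
begin

text \<open>One type holds the addresses of every dimension: \<open>Addr [a, b, \<dots>]\<close> is the bracketed list
  of \<open>a, b, \<dots>\<close>, and \<open>Addr []\<close> is both the address \<open>*\<close> of dimension 0 and the empty list of any
  positive dimension, so that \<open>* = []\<close> and \<open>* \<cdot> * = *\<close> hold literally.\<close>

datatype addr = Addr (entries: "addr list")

abbreviation eaddr :: addr  (\<open>\<epsilon>\<close>)
  where "\<epsilon> \<equiv> Addr []"

definition acat :: "addr \<Rightarrow> addr \<Rightarrow> addr"  (infixl \<open>\<odot>\<close> 70)
  where "a \<odot> b = Addr (entries a @ entries b)"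

definition sing :: "addr \<Rightarrow> addr"
  where "sing b = Addr [b]"

primrec Adr :: "nat \<Rightarrow> addr set"
  where
    "Adr 0 = {\<epsilon>}"
  | "Adr (Suc n) = {Addr xs | xs. set xs \<subseteq> Adr n}"

text \<open>The address change caused by replacing the node at \<open>r\<close> by a tree: if \<open>U\<close> is the graph of a
  bijection from the leaves of that tree to the inputs of the node, then \<open>[r[y]z]\<close> becomes \<open>[rxz]\<close>
  whenever \<open>(x, y) \<in> U\<close>, and every other address is kept.\<close>

definition readdr :: "(addr \<times> addr) set \<Rightarrow> addr \<Rightarrow> addr \<Rightarrow> addr"
  where "readdr U r a =
    (if \<exists>x y z. (x, y) \<in> U \<and> a = r \<odot> sing y \<odot> z
     then (THE b. \<exists>x y z. (x, y) \<in> U \<and> a = r \<odot> sing y \<odot> z \<and> b = r \<odot> x \<odot> z)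
     else a)"

text \<open>A decorated tree, up to isomorphism, is either a single edge (\<open>OEdge \<phi>\<close>, labelled \<open>\<phi>\<close>) or
  a root node (\<open>ONode \<psi> ts\<close>, labelled \<open>\<psi>\<close>) whose input edge of index \<open>q\<close> carries the subtree
  \<open>ts q\<close>; since inputs are indexed by addresses, decorated trees have no nontrivial automorphism
  and each isomorphism class is a single term. Labels are stored on leaves only: an edge that is
  the output of a node is labelled by the target of the label of that node.\<close>

datatype opt =
    OPt
  | OArr
  | OEdge opt
  | ONode opt "addr \<Rightarrow> opt option"

fun subtree_list :: "opt \<Rightarrow> addr list \<Rightarrow> opt option"
  where
    "subtree_list \<omega> [] = Some \<omega>"
  | "subtree_list (ONode \<psi> ts) (q # p) = Option.bind (ts q) (\<lambda>\<omega>'. subtree_list \<omega>' p)"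
  | "subtree_list _ (q # p) = None"

definition subtree :: "opt \<Rightarrow> addr \<Rightarrow> opt option"
  where "subtree \<omega> p = subtree_list \<omega> (entries p)"

definition node_label :: "opt \<Rightarrow> addr \<Rightarrow> opt option"
  where "node_label \<omega> p =
    (if \<omega> = OArr then (if p = \<epsilon> then Some OPt else None)
     else (case subtree \<omega> p of Some (ONode \<psi> ts) \<Rightarrow> Some \<psi> | _ \<Rightarrow> None))"

definition nodes :: "opt \<Rightarrow> addr set"
  where "nodes \<omega> = {p. \<exists>\<psi>. node_label \<omega> p = Some \<psi>}"

definition src :: "opt \<Rightarrow> addr \<Rightarrow> opt"
  where "src \<omega> p = the (node_label \<omega> p)"

definition leaves :: "opt \<Rightarrow> addr set"
  where "leaves \<omega> = {l. \<exists>\<phi>. subtree \<omega> l = Some (OEdge \<phi>)}"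

definition degenerate :: "opt \<Rightarrow> bool"
  where "degenerate \<omega> \<longleftrightarrow> (\<exists>\<phi>. \<omega> = OEdge \<phi>)"

definition corolla :: "opt \<Rightarrow> opt"
  where "corolla \<psi> = ONode \<psi> (\<lambda>q. if q \<in> nodes \<psi> then Some (OEdge (src \<psi> q)) else None)"

fun put_list :: "opt \<Rightarrow> addr list \<Rightarrow> opt \<Rightarrow> opt"
  where
    "put_list \<omega> [] \<omega>' = \<omega>'"
  | "put_list (ONode \<psi> ts) (q # p) \<omega>' = ONode \<psi> (ts(q := map_option (\<lambda>\<omega>. put_list \<omega> p \<omega>') (ts q)))"
  | "put_list \<omega> (q # p) \<omega>' = \<omega>"

definition put :: "opt \<Rightarrow> addr \<Rightarrow> opt \<Rightarrow> opt"
  where "put \<omega> p \<omega>' = put_list \<omega> (entries p) \<omega>'"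

text \<open>\<open>graft \<omega> l \<omega>'\<close> is only used when \<open>l\<close> is a leaf of \<open>\<omega>\<close> whose label is that of the root edge
  of \<open>\<omega>'\<close>.\<close>

definition graft :: "opt \<Rightarrow> addr \<Rightarrow> opt \<Rightarrow> opt"
  where "graft \<omega> l \<omega>' = put \<omega> l \<omega>'"

primrec glue :: "opt \<Rightarrow> (addr \<Rightarrow> opt) \<Rightarrow> opt"
  where
    "glue OPt f = OPt"
  | "glue OArr f = OArr"
  | "glue (OEdge \<phi>) f = f \<epsilon>"
  | "glue (ONode \<psi> ts) f =
       ONode \<psi> (\<lambda>q. map_option (\<lambda>\<omega>. glue \<omega> (\<lambda>k. f (sing q \<odot> k))) (ts q))"

definition replace_node :: "opt \<Rightarrow> addr \<Rightarrow> opt \<Rightarrow> (addr \<times> addr) set \<Rightarrow> opt"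
  where "replace_node \<tau> r \<psi> w =
    put \<tau> r (glue \<psi> (\<lambda>k. the (subtree \<tau> (r \<odot> sing (THE e. (k, e) \<in> w)))))"

text \<open>Opetopes of dimension \<open>n\<close>, the label of the root edge, and the target together with the
  graph of the readdressing bijection, defined simultaneously. An opetope with at least one node
  can be written as \<open>\<nu> \<circ>\<^sub>l Y\<psi>\<close> in several ways, hence the target is introduced as a relation.\<close>

inductive opetope :: "nat \<Rightarrow> opt \<Rightarrow> bool"
  and root_label :: "nat \<Rightarrow> opt \<Rightarrow> opt \<Rightarrow> bool"
  and has_target :: "nat \<Rightarrow> opt \<Rightarrow> opt \<Rightarrow> (addr \<times> addr) set \<Rightarrow> bool"
  where
    opetope_pt: "opetope 0 OPt"
  | opetope_arr: "opetope 1 OArr"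
  | opetope_edge: "opetope n \<phi> \<Longrightarrow> opetope (n + 2) (OEdge \<phi>)"
  | opetope_node:
      "\<lbrakk> opetope (n + 1) \<psi>; dom ts = nodes \<psi>;
         \<And>q \<omega>. ts q = Some \<omega> \<Longrightarrow> opetope (n + 2) \<omega>;
         \<And>q \<omega>. ts q = Some \<omega> \<Longrightarrow> root_label (n + 2) \<omega> (src \<psi> q) \<rbrakk>
       \<Longrightarrow> opetope (n + 2) (ONode \<psi> ts)"
  | root_label_edge: "root_label (n + 2) (OEdge \<phi>) \<phi>"
  | root_label_node: "has_target (n + 1) \<psi> \<phi> w \<Longrightarrow> root_label (n + 2) (ONode \<psi> ts) \<phi>"
  | target_arr: "has_target 1 OArr OPt {}"
  | target_two:
      "\<lbrakk> opetope 2 \<omega>; leaves \<omega> = {l} \<rbrakk> \<Longrightarrow> has_target 2 \<omega> OArr {(l, \<epsilon>)}"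
  | target_edge:
      "opetope (n + 1) \<phi> \<Longrightarrow> has_target (n + 3) (OEdge \<phi>) (corolla \<phi>) {(\<epsilon>, \<epsilon>)}"
  | target_corolla:
      "opetope (n + 2) \<psi> \<Longrightarrow>
       has_target (n + 3) (corolla \<psi>) \<psi> {(sing q, q) | q. q \<in> nodes \<psi>}"
  | target_graft:
      "\<lbrakk> opetope (n + 3) \<nu>; has_target (n + 3) \<nu> \<tau> w;
         opetope (n + 2) \<psi>; has_target (n + 2) \<psi> \<phi> v;
         subtree \<nu> l = Some (OEdge \<phi>); (l, r) \<in> w \<rbrakk>
       \<Longrightarrow> has_target (n + 3) (graft \<nu> l (corolla \<psi>)) (replace_node \<tau> r \<psi> v)
            ({(l \<odot> sing q, r \<odot> q) | q. q \<in> nodes \<psi>} \<union>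
             {(l', readdr v r e) | l' e. (l', e) \<in> w \<and> l' \<noteq> l})"

definition Opetopes :: "nat \<Rightarrow> opt set"
  where "Opetopes n = {\<omega>. opetope n \<omega>}"

definition tgt :: "opt \<Rightarrow> opt"
  where "tgt \<omega> = (THE \<tau>. \<exists>n w. has_target n \<omega> \<tau> w)"

definition readdressing :: "opt \<Rightarrow> (addr \<times> addr) set"
  where "readdressing \<omega> = (THE w. \<exists>n \<tau>. has_target n \<omega> \<tau> w)"

text \<open>\<open>PEmpty\<close> is the unique element of dimension \<open>-1\<close>; it only occurs as the target of \<open>PPt\<close>.\<close>

datatype preopt =
    PEmpty
  | PPt
  | PSet "(addr \<times> preopt) fset"
  | PDegen preopt

inductive preopetope :: "nat \<Rightarrow> preopt \<Rightarrow> bool"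
  where
    pre_pt: "preopetope 0 PPt"
  | pre_set:
      "\<lbrakk> A \<noteq> {||}; inj_on fst (fset A);
         \<And>a q. (a, q) |\<in>| A \<Longrightarrow> a \<in> Adr n;
         \<And>a q. (a, q) |\<in>| A \<Longrightarrow> preopetope n q \<rbrakk>
       \<Longrightarrow> preopetope (n + 1) (PSet A)"
  | pre_degen: "preopetope n q \<Longrightarrow> preopetope (n + 2) (PDegen q)"

definition Preopetopes :: "nat \<Rightarrow> preopt set"
  where "Preopetopes n = {p. preopetope n p}"

fun assignments :: "preopt \<Rightarrow> (addr \<times> preopt) set"
  where
    "assignments (PSet A) = fset A"
  | "assignments _ = {}"

definition pnodes :: "preopt \<Rightarrow> addr set"
  where "pnodes p = fst ` assignments p"

definition psrc :: "preopt \<Rightarrow> addr \<Rightarrow> preopt"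
  where "psrc p a = (THE q. (a, q) \<in> assignments p)"

fun pleaves :: "preopt \<Rightarrow> addr set"
  where
    "pleaves (PSet A) =
      {a \<odot> sing b | a b. a \<in> pnodes (PSet A) \<and> b \<in> pnodes (psrc (PSet A) a) \<and>
                        a \<odot> sing b \<notin> pnodes (PSet A)}"
  | "pleaves (PDegen q) = {\<epsilon>}"
  | "pleaves _ = {}"

text \<open>Improper grafting is defined on nondegenerate preopetopes only, and is therefore an operation
  on sets of assignments.\<close>

definition pgraft :: "(addr \<times> preopt) fset \<Rightarrow> addr \<Rightarrow> preopt \<Rightarrow> preopt"
  where "pgraft A r q = PSet (finsert (r, q) A)"

definition sequent :: "nat \<Rightarrow> (addr \<times> addr) set \<Rightarrow> preopt \<Rightarrow> preopt \<Rightarrow> bool"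
  where "sequent n \<Gamma> p t \<longleftrightarrow>
    p \<in> Preopetopes n \<and>
    (case n of 0 \<Rightarrow> t = PEmpty | Suc m \<Rightarrow> t \<in> Preopetopes m) \<and>
    finite \<Gamma> \<and> \<Gamma> \<subseteq> pleaves p \<times> pnodes t"

text \<open>Substitution in a set \<open>T\<close> of assignments, where \<open>U\<close> is the context of a sequent with subject
  the substituted preopetope.\<close>

fun psubst :: "(addr \<times> addr) set \<Rightarrow> (addr \<times> preopt) fset \<Rightarrow> addr \<Rightarrow> preopt \<Rightarrow> preopt"
  where
    "psubst U T r (PDegen q) =
      (if fcard T = 1 then PDegen q
       else PSet ((\<lambda>(a, w). (readdr {(\<epsilon>, \<epsilon>)} r a, w)) |`| ffilter (\<lambda>(a, w). a \<noteq> r) T))"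
  | "psubst U T r (PSet Q) =
      PSet ((\<lambda>(b, v). (r \<odot> b, v)) |`| Q |\<union>|
            (\<lambda>(a, w). (readdr U r a, w)) |`| ffilter (\<lambda>(a, w). a \<noteq> r) T)"
  | "psubst U T r _ = undefined"

text \<open>A pair \<open>(l, q)\<close> of a context stands for the fraction with numerator \<open>l\<close> and denominator \<open>q\<close>.
  In the rule \<open>graft\<close> the active pair does not occur in the remaining context \<open>\<Gamma>\<close>.\<close>

inductive derivable :: "(addr \<times> addr) set \<Rightarrow> preopt \<Rightarrow> preopt \<Rightarrow> bool"
  where
    point: "derivable {} PPt PEmpty"
  | degen: "derivable \<Gamma> p t \<Longrightarrow> derivable {(\<epsilon>, \<epsilon>)} (PDegen p) (PSet {|(\<epsilon>, p)|})"
  | shift: "derivable \<Gamma> p t \<Longrightarrow> derivable {(sing a, a) | a. a \<in> pnodes p} (PSet {|(\<epsilon>, p)|}) p"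
  | graft:
      "\<lbrakk> derivable (insert (a \<odot> sing b, r) \<Gamma>) (PSet A) (PSet T); (a \<odot> sing b, r) \<notin> \<Gamma>;
         derivable \<Upsilon> q u;
         sequent (n + 2) (insert (a \<odot> sing b, r) \<Gamma>) (PSet A) (PSet T); sequent (n + 1) \<Upsilon> q u;
         a \<in> pnodes (PSet A); b \<in> pnodes (psrc (PSet A) a);
         psrc (psrc (PSet A) a) b = u \<rbrakk>
       \<Longrightarrow> derivable
            ((\<lambda>(l, e). (l, readdr \<Upsilon> r e)) ` \<Gamma> \<union>
             {(a \<odot> sing b \<odot> sing s, r \<odot> s) | s. s \<in> pnodes q})
            (pgraft A (a \<odot> sing b) q)
            (psubst \<Upsilon> T r q)"

definition ValidPreopetopes :: "nat \<Rightarrow> preopt set"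
  where "ValidPreopetopes n = {p \<in> Preopetopes n. \<exists>\<Gamma> t. sequent n \<Gamma> p t \<and> derivable \<Gamma> p t}"

definition ptgt :: "preopt \<Rightarrow> preopt"
  where "ptgt p = (THE t. \<exists>\<Gamma>. derivable \<Gamma> p t)"

definition preaddressing :: "preopt \<Rightarrow> (addr \<times> addr) set"
  where "preaddressing p = (THE \<Gamma>. \<exists>t. derivable \<Gamma> p t)"

text \<open>Like the target, both maps are given by clauses for \<open>\<nu> \<circ>\<^sub>l Y\<psi>\<close> that apply in several ways to
  the same argument, so they are introduced through their graphs.\<close>

inductive to_pre_rel :: "opt \<Rightarrow> preopt \<Rightarrow> bool"
  where
    "to_pre_rel OPt PPt"
  | "to_pre_rel OArr (PSet {|(\<epsilon>, PPt)|})"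
  | "\<lbrakk> opetope n \<phi>; to_pre_rel \<phi> q \<rbrakk> \<Longrightarrow> to_pre_rel (OEdge \<phi>) (PDegen q)"
  | "\<lbrakk> opetope (n + 1) \<psi>; to_pre_rel \<psi> q \<rbrakk> \<Longrightarrow> to_pre_rel (corolla \<psi>) (PSet {|(\<epsilon>, q)|})"
  | "\<lbrakk> opetope (n + 2) \<nu>; nodes \<nu> \<noteq> {}; opetope (n + 1) \<psi>;
       has_target (n + 1) \<psi> \<phi> w; subtree \<nu> l = Some (OEdge \<phi>);
       to_pre_rel \<nu> (PSet A); to_pre_rel \<psi> q \<rbrakk>
     \<Longrightarrow> to_pre_rel (graft \<nu> l (corolla \<psi>)) (pgraft A l q)"

definition to_pre :: "opt \<Rightarrow> preopt"
  where "to_pre \<omega> = (THE p. to_pre_rel \<omega> p)"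

inductive to_poly_rel :: "preopt \<Rightarrow> opt \<Rightarrow> bool"
  where
    "to_poly_rel PPt OPt"
  | "to_poly_rel (PSet {|(\<epsilon>, PPt)|}) OArr"
  | "\<lbrakk> q \<in> ValidPreopetopes n; to_poly_rel q \<phi> \<rbrakk> \<Longrightarrow> to_poly_rel (PDegen q) (OEdge \<phi>)"
  | "\<lbrakk> q \<in> ValidPreopetopes (n + 1); to_poly_rel q \<psi> \<rbrakk>
     \<Longrightarrow> to_poly_rel (PSet {|(\<epsilon>, q)|}) (corolla \<psi>)"
  | "\<lbrakk> PSet A \<in> ValidPreopetopes (n + 2); q \<in> ValidPreopetopes (n + 1); l \<in> pleaves (PSet A);
       pgraft A l q \<in> ValidPreopetopes (n + 2);
       to_poly_rel (PSet A) \<nu>; to_poly_rel q \<psi> \<rbrakk>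
     \<Longrightarrow> to_poly_rel (pgraft A l q) (graft \<nu> l (corolla \<psi>))"

definition to_poly :: "preopt \<Rightarrow> opt"
  where "to_poly p = (THE \<omega>. to_poly_rel p \<omega>)"

end

theory Submission imports Defs begin

text \<open>A tree of dimension at least 2 is determined by the partial function sending an address to the
  label of the node there, together with the labels of its leaves. All identities between trees are
  proved on this level, where replacing the node \<open>r\<close> of \<open>\<tau>\<close> by \<open>\<psi>\<close> is literally the substitution of
  \<open>OPT\<^sup>?\<close>: the nodes of \<open>\<psi>\<close> are moved to \<open>r\<close> and the other nodes of \<open>\<tau>\<close> are readdressed.

  The laws of targets are proved by induction on the dimension. Besides existence, uniqueness and
  the bijectivity of readdressings, the induction carries the invariance \<open>t (\<tau>[\<psi>/r]) = t \<tau>\<close>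
  whenever \<open>t \<psi>\<close> is the label of \<open>r\<close>; it says that the target of an opetope in the next
  dimension has the right target, and follows from
  \<open>t (\<nu> \<circ> \<psi>) = (t \<nu>)[t \<psi>/s]\<close>, which reduces to the associativity of nested replacements.
  Uniqueness reduces to two nodes that are maximal in the tree order, hence to the fact that
  replacements at distinct nodes commute.

  The map \<open>pre\<close> sends a tree to the set of its labelled node addresses. It is injective, and
  by induction on both sides the derivable sequents are exactly those of the form
  \<open>w \<turnstile> pre \<omega> \<rightarrow> pre (t \<omega>)\<close> with \<open>w\<close> the readdressing of \<open>\<omega>\<close>. Everything else is transported
  along this correspondence.\<close>

subsection \<open>Addresses and subtrees\<close>

text \<open>The obstacle is that root labels are themselves given by the target relation. Until
  targets in one dimension are known to be functional, a tree of the next dimension might have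
  several root labels, and the edge left behind by a removed node several possible labels. Results
  that precede the laws of targets therefore speak of all possible root labels, and the laws of one
  dimension are needed before trees of the next can be taken apart. The invariance law is what
  yields the globular identity at the root: a graft keeps the root label of \<nu>, while its target
  is a replacement in the target of \<nu>. Its proof in turn needs grafts of whole trees, since
  replacing the node grafted last by \<psi> grafts \<psi> itself. Dimensions 1 and 2 are treated
  apart because targets there are prescribed and not computed from edges and grafts. On the side of
  sequents, the delicate point is the substitution of a degenerate preopetope into a single
  assignment: no node survives, and the label of the remaining edge has to be identified by other
  means.\<close>

lemma acat_assoc [simp]: "(a \<odot> b) \<odot> c = a \<odot> (b \<odot> c)"
  by (simp add: acat_def)

lemma acat_eps [simp]: "\<epsilon> \<odot> a = a" "a \<odot> \<epsilon> = a"
  by (simp_all add: acat_def)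

lemma entries_simps [simp]: "entries (a \<odot> b) = entries a @ entries b" "entries (sing q) = [q]"
  by (simp_all add: acat_def sing_def)

lemma addr_eq_iff: "a = b \<longleftrightarrow> entries a = entries b"
  by (metis addr.expand)

lemma acat_cancel [simp]: "p \<odot> a = p \<odot> b \<longleftrightarrow> a = b"
  by (simp add: addr_eq_iff)

lemma acat_self [simp]: "p = p \<odot> a \<longleftrightarrow> a = \<epsilon>" "p \<odot> a = p \<longleftrightarrow> a = \<epsilon>"
  by (simp_all add: addr_eq_iff)

lemma sing_inject [simp]: "sing q = sing q' \<longleftrightarrow> q = q'"
  by (simp add: sing_def)

lemma sing_acat_inject [simp]: "sing q \<odot> p = sing q' \<odot> p' \<longleftrightarrow> q = q' \<and> p = p'"
  by (simp add: addr_eq_iff)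

lemma acat_sing_inject [simp]: "p \<odot> sing q = p' \<odot> sing q' \<longleftrightarrow> q = q' \<and> p = p'"
  by (auto simp add: addr_eq_iff)

lemma sing_acat_sing [simp]: "sing q \<odot> p = sing q' \<longleftrightarrow> q = q' \<and> p = \<epsilon>"
  "sing q' = sing q \<odot> p \<longleftrightarrow> q = q' \<and> p = \<epsilon>"
  by (auto simp add: addr_eq_iff)

lemma acat_eq_eps [simp]: "a \<odot> b = \<epsilon> \<longleftrightarrow> a = \<epsilon> \<and> b = \<epsilon>" "\<epsilon> = a \<odot> b \<longleftrightarrow> a = \<epsilon> \<and> b = \<epsilon>"
  by (auto simp add: addr_eq_iff)

lemma sing_neq_eps [simp]: "sing q \<noteq> \<epsilon>" "\<epsilon> \<noteq> sing q"
  by (auto simp add: addr_eq_iff)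

lemma addr_induct [case_names eps cons]:
  assumes "Q \<epsilon>" "\<And>q p. Q p \<Longrightarrow> Q (sing q \<odot> p)"
  shows "Q p"
proof -
  have "Q (Addr xs)" for xs
  proof (induction xs)
    case (Cons q xs)
    then show ?case using assms(2)[of "Addr xs" q] by (simp add: acat_def sing_def)
  qed (fact assms(1))
  then show ?thesis by (cases p) simp
qed

lemma addr_cases [case_names eps cons]:
  obtains "p = \<epsilon>" | q p' where "p = sing q \<odot> p'"
proof (cases "entries p")
  case Nil
  then show ?thesis using that(1) by (simp add: addr_eq_iff)
next
  case (Cons y ys)
  then show ?thesis using that(2)[of y "Addr ys"] by (simp add: addr_eq_iff)
qed

lemma addr_rev_cases [case_names eps snoc]:
  obtains "p = \<epsilon>" | q p' where "p = p' \<odot> sing q"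
proof (cases "entries p" rule: rev_cases)
  case Nil
  then show ?thesis using that(1) by (simp add: addr_eq_iff)
next
  case (snoc ys y)
  then show ?thesis using that(2)[of "Addr ys" y] by (simp add: addr_eq_iff)
qed

lemma acat_eq_cases:
  assumes "p \<odot> a = q \<odot> b"
  obtains c where "p = q \<odot> c" "b = c \<odot> a" | c where "q = p \<odot> c" "a = c \<odot> b"
proof -
  from assms have "entries p @ entries a = entries q @ entries b"
    by (simp add: addr_eq_iff)
  then obtain us where "entries p = entries q @ us \<and> us @ entries a = entries b \<or>
      entries p @ us = entries q \<and> entries a = us @ entries b"
    by (auto simp: append_eq_append_conv2)
  then show ?thesis
    using that(1)[of "Addr us"] that(2)[of "Addr us"] by (auto simp: addr_eq_iff)
qed

section \<open>Subtrees, labels of nodes and leaves, and putting a tree at an address\<close>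

lemma subtree_eps [simp]: "subtree \<omega> \<epsilon> = Some \<omega>"
  by (simp add: subtree_def)

lemma subtree_cons [simp]:
  "subtree (ONode \<psi> ts) (sing q \<odot> p) = Option.bind (ts q) (\<lambda>\<sigma>. subtree \<sigma> p)"
  "subtree (OEdge \<phi>) (sing q \<odot> p) = None"
  "subtree OPt (sing q \<odot> p) = None"
  "subtree OArr (sing q \<odot> p) = None"
  by (simp_all add: subtree_def)

lemma subtree_sing [simp]:
  "subtree (ONode \<psi> ts) (sing q) = ts q"
  "subtree (OEdge \<phi>) (sing q) = None"
  using subtree_cons(1)[of \<psi> ts q \<epsilon>] subtree_cons(2)[of \<phi> q \<epsilon>]
  by (simp_all del: subtree_cons)

lemma subtree_acat: "subtree \<omega> (p \<odot> q) = Option.bind (subtree \<omega> p) (\<lambda>\<sigma>. subtree \<sigma> q)"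
proof (induction p arbitrary: \<omega> rule: addr_induct)
  case (cons c p)
  then show ?case by (cases \<omega>) (auto split: bind_split)
qed simp

lemma subtree_OEdge: "subtree (OEdge \<phi>) p = (if p = \<epsilon> then Some (OEdge \<phi>) else None)"
  by (cases p rule: addr_cases) auto

lemma put_eps [simp]: "put \<omega> \<epsilon> \<omega>' = \<omega>'"
  by (simp add: put_def)

lemma put_cons [simp]:
  "put (ONode \<psi> ts) (sing q \<odot> p) \<omega>' = ONode \<psi> (ts(q := map_option (\<lambda>\<omega>. put \<omega> p \<omega>') (ts q)))"
  by (simp add: put_def)

text \<open>Unlike \<open>node_label\<close>, this gives \<open>OArr\<close> no node, so that the
  label at \<open>p \<odot> q\<close> is always computed from the subtree at \<open>p\<close>. On
  trees of dimension at least 2 the two notions agree.\<close>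

definition inner_label :: "opt \<Rightarrow> addr \<Rightarrow> opt option"
  where "inner_label \<omega> p = (case subtree \<omega> p of Some (ONode \<psi> ts) \<Rightarrow> Some \<psi> | _ \<Rightarrow> None)"

definition leaf_label :: "opt \<Rightarrow> addr \<Rightarrow> opt option"
  where "leaf_label \<omega> p = (case subtree \<omega> p of Some (OEdge \<phi>) \<Rightarrow> Some \<phi> | _ \<Rightarrow> None)"

lemma inner_label_eq_Some:
  "inner_label \<omega> p = Some \<psi> \<longleftrightarrow> (\<exists>ts. subtree \<omega> p = Some (ONode \<psi> ts))"
  by (auto simp: inner_label_def split: option.splits opt.splits)

lemma leaf_label_eq_Some:
  "leaf_label \<omega> p = Some \<phi> \<longleftrightarrow> subtree \<omega> p = Some (OEdge \<phi>)"
  by (auto simp: leaf_label_def split: option.splits opt.splits)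

lemma leaves_eq: "leaves \<omega> = dom (leaf_label \<omega>)"
  by (auto simp: leaves_def leaf_label_eq_Some)

lemma node_label_eq: "\<omega> \<noteq> OArr \<Longrightarrow> node_label \<omega> = inner_label \<omega>"
  by (auto simp: node_label_def inner_label_def fun_eq_iff)

lemma inner_label_acat: "inner_label \<omega> (p \<odot> q) = Option.bind (subtree \<omega> p) (\<lambda>\<sigma>. inner_label \<sigma> q)"
  by (cases "subtree \<omega> p") (auto simp: inner_label_def subtree_acat)

lemma leaf_label_acat: "leaf_label \<omega> (p \<odot> q) = Option.bind (subtree \<omega> p) (\<lambda>\<sigma>. leaf_label \<sigma> q)"
  by (cases "subtree \<omega> p") (auto simp: leaf_label_def subtree_acat)

lemma inner_label_simps [simp]:
  "inner_label (ONode \<psi> ts) \<epsilon> = Some \<psi>"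
  "inner_label (ONode \<psi> ts) (sing q \<odot> p) = Option.bind (ts q) (\<lambda>\<sigma>. inner_label \<sigma> p)"
  "inner_label (ONode \<psi> ts) (sing q) = Option.bind (ts q) (\<lambda>\<sigma>. inner_label \<sigma> \<epsilon>)"
  "inner_label (OEdge \<phi>) p = None"
  by (auto simp: inner_label_def subtree_OEdge bind_eq_None_conv split: option.splits opt.splits bind_split)

lemma leaf_label_simps [simp]:
  "leaf_label (ONode \<psi> ts) \<epsilon> = None"
  "leaf_label (ONode \<psi> ts) (sing q \<odot> p) = Option.bind (ts q) (\<lambda>\<sigma>. leaf_label \<sigma> p)"
  "leaf_label (ONode \<psi> ts) (sing q) = Option.bind (ts q) (\<lambda>\<sigma>. leaf_label \<sigma> \<epsilon>)"
  "leaf_label (OEdge \<phi>) p = (if p = \<epsilon> then Some \<phi> else None)"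
  by (auto simp: leaf_label_def subtree_OEdge bind_eq_None_conv split: option.splits opt.splits bind_split)

lemma atom_labels [simp]:
  "inner_label OPt p = None" "inner_label OArr p = None"
  "leaf_label OPt p = None" "leaf_label OArr p = None"
  by (cases p rule: addr_cases; simp add: inner_label_def leaf_label_def)+

lemma leaf_no_extension:
  assumes "leaf_label \<omega> k = Some \<phi>"
  shows "subtree \<omega> (k \<odot> z) = (if z = \<epsilon> then Some (OEdge \<phi>) else None)"
  using assms by (simp add: subtree_acat leaf_label_eq_Some subtree_OEdge)

text \<open>Nothing lies strictly beyond a leaf, so distinct leaves are incomparable as addresses.
  Hence an address has at most one leaf as a prefix, which makes gluing along leaves
  unambiguous.\<close>

lemma leaf_antichain:
  assumes "leaf_label \<omega> k = Some \<phi>" "subtree \<omega> k' \<noteq> None" "k \<odot> z = k' \<odot> z'" "leaf_label \<omega> k' = Some \<phi>'"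
  shows "k = k' \<and> z = z'"
  using assms(3)
proof (cases rule: acat_eq_cases)
  case (1 c)
  then show ?thesis
    using leaf_no_extension[OF assms(4), of c] assms(1,4) by (auto simp: leaf_label_eq_Some split: if_splits)
next
  case (2 c)
  then show ?thesis
    using leaf_no_extension[OF assms(1), of c] assms(2) by (auto split: if_splits)
qed

lemma leaf_not_below:
  assumes "leaf_label \<omega> k = Some \<phi>" "inner_label \<omega> a = Some \<psi>"
  shows "a \<noteq> k \<odot> z"
  using leaf_no_extension[OF assms(1), of z] assms(2) by (auto simp: inner_label_eq_Some split: if_splits)

lemma subtree_put_above:
  assumes "subtree \<omega> l \<noteq> None"
  shows "subtree (put \<omega> l \<omega>') (l \<odot> z) = subtree \<omega>' z"
  using assms
proof (induction l arbitrary: \<omega> rule: addr_induct)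
  case (cons q l)
  then show ?case by (cases \<omega>) (auto simp: bind_eq_None_conv split: bind_split)
qed simp

lemma put_labels_elsewhere:
  assumes "subtree \<omega> l \<noteq> None" "\<nexists>z. p = l \<odot> z"
  shows "inner_label (put \<omega> l \<omega>') p = inner_label \<omega> p \<and> leaf_label (put \<omega> l \<omega>') p = leaf_label \<omega> p"
  using assms
proof (induction l arbitrary: \<omega> p rule: addr_induct)
  case (cons q l)
  then obtain \<psi> ts \<sigma> where \<omega>: "\<omega> = ONode \<psi> ts" and \<sigma>: "ts q = Some \<sigma>" "subtree \<sigma> l \<noteq> None"
    by (cases \<omega>) (auto simp: bind_eq_None_conv)
  show ?case
  proof (cases p rule: addr_cases)
    case eps
    then show ?thesis by (simp add: \<omega>)
  next
    case (cons q' p')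
    then show ?thesis
      using cons.IH[OF \<sigma>(2), of p'] cons.prems(2) \<sigma> by (auto simp: \<omega>)
  qed
qed simp

lemma inner_label_put:
  assumes "subtree \<omega> l \<noteq> None"
  shows "inner_label (put \<omega> l \<omega>') (l \<odot> z) = inner_label \<omega>' z"
    "\<nexists>z. p = l \<odot> z \<Longrightarrow> inner_label (put \<omega> l \<omega>') p = inner_label \<omega> p"
  using subtree_put_above[OF assms] put_labels_elsewhere[OF assms]
  by (auto simp: inner_label_def)

lemma leaf_label_put:
  assumes "subtree \<omega> l \<noteq> None"
  shows "leaf_label (put \<omega> l \<omega>') (l \<odot> z) = leaf_label \<omega>' z"
    "\<nexists>z. p = l \<odot> z \<Longrightarrow> leaf_label (put \<omega> l \<omega>') p = leaf_label \<omega> p"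
  using subtree_put_above[OF assms] put_labels_elsewhere[OF assms]
  by (auto simp: leaf_label_def)

lemma put_put: "put (put \<omega> l \<sigma>) l \<sigma>' = put \<omega> l \<sigma>'"
proof (induction l arbitrary: \<omega> rule: addr_induct)
  case (cons q l)
  then show ?case
    by (cases \<omega>) (auto simp: option.map_comp comp_def, simp_all add: put_def)
qed simp

lemma put_subtree: "subtree \<omega> l = Some \<sigma> \<Longrightarrow> put \<omega> l \<sigma> = \<omega>"
proof (induction l arbitrary: \<omega> rule: addr_induct)
  case (cons q l)
  then show ?case
    by (cases \<omega>) (auto simp: bind_eq_Some_conv)
qed simp

lemma put_acat: "subtree \<omega> l = Some \<sigma> \<Longrightarrow> put \<omega> (l \<odot> k) \<sigma>' = put \<omega> l (put \<sigma> k \<sigma>')"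
proof (induction l arbitrary: \<omega> rule: addr_induct)
  case (cons q l)
  then show ?case
    by (cases \<omega>) (auto simp: bind_eq_Some_conv)
qed simp

lemma glue_labels:
  "inner_label (glue \<psi> f) b = Some \<chi> \<longleftrightarrow>
    inner_label \<psi> b = Some \<chi> \<or>
    (\<exists>k z. leaf_label \<psi> k \<noteq> None \<and> b = k \<odot> z \<and> inner_label (f k) z = Some \<chi>)"
  "leaf_label (glue \<psi> f) b = Some \<chi> \<longleftrightarrow>
    (\<exists>k z. leaf_label \<psi> k \<noteq> None \<and> b = k \<odot> z \<and> leaf_label (f k) z = Some \<chi>)"
proof (induction b arbitrary: \<psi> f rule: addr_induct)
  {
    case eps
    {
      case 1
      show ?case by (cases \<psi>) auto
    next
      case 2
      show ?case by (cases \<psi>) auto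
    }
  next
    case (cons q b)
    \<comment> \<open>\<open>N\<close> strips the first index from a leaf address: the root of an
      \<open>ONode\<close> is not a leaf, so a leaf that is a prefix of
      \<open>sing q \<odot> b\<close> begins with \<open>q\<close>. The relation \<open>R\<close>
      stands for either kind of label.\<close>
    have N: "(\<exists>k. leaf_label (ONode \<alpha> ts) k \<noteq> None \<and> (\<exists>z. sing q \<odot> b = k \<odot> z \<and> R k z)) \<longleftrightarrow>
        (\<exists>\<sigma>. ts q = Some \<sigma> \<and> (\<exists>k. leaf_label \<sigma> k \<noteq> None \<and> (\<exists>z. b = k \<odot> z \<and> R (sing q \<odot> k) z)))" (is "?L \<longleftrightarrow> ?R")
      for \<alpha> ts R
    proof
      assume ?L
      then obtain k z where k: "leaf_label (ONode \<alpha> ts) k \<noteq> None" "sing q \<odot> b = k \<odot> z" "R k z" by auto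
      then show ?R
      proof (cases k rule: addr_cases)
        case (cons q' k')
        with k show ?thesis by (cases "ts q") (auto intro: exI[of _ k'])
      qed (use k in simp)
    next
      assume ?R
      then obtain \<sigma> k z where "ts q = Some \<sigma>" "leaf_label \<sigma> k \<noteq> None" "b = k \<odot> z" "R (sing q \<odot> k) z" by auto
      then show ?L by (intro exI[of _ "sing q \<odot> k"]) auto
    qed
    {
      case 1
      show ?case
      proof (cases \<psi>)
        case (ONode \<alpha> ts)
        show ?thesis unfolding ONode glue.simps inner_label_simps
          using cons(1) N[of \<alpha> ts "\<lambda>k z. inner_label (f k) z = Some \<chi>"]
          by (cases "ts q") auto
      qed auto
    next
      case 2
      show ?case
      proof (cases \<psi>)
        case (ONode \<alpha> ts)
        show ?thesis unfolding ONode glue.simps leaf_label_simps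
          using cons(2) N[of \<alpha> ts "\<lambda>k z. leaf_label (f k) z = Some \<chi>"]
          by (cases "ts q") auto
      qed auto
    }
  }
qed

section \<open>Readdressing, and the labels of a tree after a replacement\<close>

lemma readdr_hit:
  assumes "(k, e) \<in> v" "\<And>k'. (k', e) \<in> v \<Longrightarrow> k' = k"
  shows "readdr v r (r \<odot> sing e \<odot> z) = r \<odot> k \<odot> z"
proof -
  \<comment> \<open>The address \<open>r \<odot> sing e \<odot> z\<close> determines
    \<open>e\<close> and \<open>z\<close>, so the description has one solution as soon as
    \<open>e\<close> has a single preimage.\<close>
  have "(THE b. \<exists>x y z'. (x, y) \<in> v \<and> r \<odot> sing e \<odot> z = r \<odot> sing y \<odot> z' \<and> b = r \<odot> x \<odot> z') = r \<odot> k \<odot> z"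
  proof (rule the_equality)
    show "\<exists>x y z'. (x, y) \<in> v \<and> r \<odot> sing e \<odot> z = r \<odot> sing y \<odot> z' \<and> r \<odot> k \<odot> z = r \<odot> x \<odot> z'"
      using assms(1) by blast
  next
    fix b assume "\<exists>x y z'. (x, y) \<in> v \<and> r \<odot> sing e \<odot> z = r \<odot> sing y \<odot> z' \<and> b = r \<odot> x \<odot> z'"
    then obtain x where "(x, e) \<in> v" "b = r \<odot> x \<odot> z" by auto
    then show "b = r \<odot> k \<odot> z" using assms(2) by blast
  qed
  then show ?thesis
    using assms(1) unfolding readdr_def by auto
qed

lemma readdr_miss:
  assumes "\<And>k e z. (k, e) \<in> v \<Longrightarrow> a \<noteq> r \<odot> sing e \<odot> z"
  shows "readdr v r a = a"
  using assms unfolding readdr_def by auto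

text \<open>Contexts of sequents are sets of pairs. Keeping readdressings as graphs, instead of
  functions with arbitrary values off the leaves, lets both sides be compared by equality of
  sets.\<close>

definition bij_graph :: "('a \<times> 'b) set \<Rightarrow> 'a set \<Rightarrow> 'b set \<Rightarrow> bool"
  where "bij_graph w L N \<longleftrightarrow>
    (\<forall>l e. (l, e) \<in> w \<longrightarrow> l \<in> L \<and> e \<in> N) \<and>
    (\<forall>l e e'. (l, e) \<in> w \<longrightarrow> (l, e') \<in> w \<longrightarrow> e = e') \<and>
    (\<forall>l l' e. (l, e) \<in> w \<longrightarrow> (l', e) \<in> w \<longrightarrow> l = l') \<and>
    (\<forall>l\<in>L. \<exists>e. (l, e) \<in> w) \<and> (\<forall>e\<in>N. \<exists>l. (l, e) \<in> w)"

lemma bij_graphD: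
  assumes "bij_graph w L N"
  shows "(l, e) \<in> w \<Longrightarrow> l \<in> L" "(l, e) \<in> w \<Longrightarrow> e \<in> N"
    "(l, e) \<in> w \<Longrightarrow> (l, e') \<in> w \<Longrightarrow> e = e'" "(l, e) \<in> w \<Longrightarrow> (l', e) \<in> w \<Longrightarrow> l = l'"
    "l \<in> L \<Longrightarrow> \<exists>e. (l, e) \<in> w" "e \<in> N \<Longrightarrow> \<exists>l. (l, e) \<in> w"
  using assms unfolding bij_graph_def by (elim conjE, simp; metis)+

lemma bij_graphI:
  assumes "\<And>l e. (l, e) \<in> w \<Longrightarrow> l \<in> L \<and> e \<in> N"
    "\<And>l e e'. (l, e) \<in> w \<Longrightarrow> (l, e') \<in> w \<Longrightarrow> e = e'"
    "\<And>l l' e. (l, e) \<in> w \<Longrightarrow> (l', e) \<in> w \<Longrightarrow> l = l'"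
    "\<And>l. l \<in> L \<Longrightarrow> \<exists>e. (l, e) \<in> w" "\<And>e. e \<in> N \<Longrightarrow> \<exists>l. (l, e) \<in> w"
  shows "bij_graph w L N"
  unfolding bij_graph_def
  by (intro conjI allI impI ballI;
      (rule assms(1)[THEN conjunct1] assms(1)[THEN conjunct2] assms(2-5)); assumption)

text \<open>Beyond \<open>r\<close>, an address of the new tree either lies in \<psi> or continues a
  leaf \<open>k\<close> of \<psi>, and then it comes from the input \<open>e\<close> matched with
  \<open>k\<close>; away from \<open>r\<close> nothing moves. Everything is phrased through
  \<open>readdr\<close> so as to match the assignments produced by \<open>psubst\<close>.\<close>

lemma replace_node_labels:
  assumes sub: "subtree \<tau> r = Some (ONode \<phi> ts)" and bij: "bij_graph v (leaves \<psi>) (dom ts)"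
  shows "inner_label (replace_node \<tau> r \<psi> v) p = Some \<chi> \<longleftrightarrow>
      (\<exists>b. p = r \<odot> b \<and> inner_label \<psi> b = Some \<chi>) \<or>
      (\<exists>a. a \<noteq> r \<and> inner_label \<tau> a = Some \<chi> \<and> p = readdr v r a)" (is ?I)
    and "leaf_label (replace_node \<tau> r \<psi> v) p = Some \<chi> \<longleftrightarrow>
      (\<exists>a. leaf_label \<tau> a = Some \<chi> \<and> p = readdr v r a)" (is ?L)
proof -
  define f where "f k = the (subtree \<tau> (r \<odot> sing (THE e. (k, e) \<in> v)))" for k
  \<comment> \<open>The subtree that \<open>replace_node\<close> glues on the leaf \<open>k\<close>
    is the one on the input \<open>e\<close> matched with \<open>k\<close> by
    \<open>v\<close>.\<close>
  have f: "ts e = Some (f k)" if "(k, e) \<in> v" for k e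
  proof -
    have "(THE e. (k, e) \<in> v) = e"
      using that bij_graphD(3)[OF bij] by blast
    moreover have "e \<in> dom ts" using that bij_graphD(2)[OF bij] by blast
    ultimately show ?thesis by (auto simp: f_def subtree_acat sub)
  qed
  have L: "leaf_label \<psi> k \<noteq> None \<longleftrightarrow> (\<exists>e. (k, e) \<in> v)" for k
    using bij_graphD(1,5)[OF bij] by (fastforce simp: leaves_eq)
  have hit: "readdr v r (r \<odot> sing e \<odot> z) = r \<odot> k \<odot> z" if "(k, e) \<in> v" for k e z
    using readdr_hit[OF that] bij_graphD(4)[OF bij] that by blast
  have miss: "readdr v r a = a" if "\<And>b. a \<noteq> r \<odot> b" for a
    by (rule readdr_miss) (use that in auto)
  \<comment> \<open>The argument is the same for nodes and for leaves: all it uses of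
    \<open>lab\<close> is that labels beyond an address depend only on the subtree there.\<close>
  have key: "(\<exists>k z. leaf_label \<psi> k \<noteq> None \<and> b = k \<odot> z \<and> lab (f k) z = Some \<chi>) \<longleftrightarrow>
      (\<exists>a. a \<noteq> r \<and> lab \<tau> a = Some \<chi> \<and> r \<odot> b = readdr v r a)"
    if lab: "\<And>p q \<omega>. lab \<omega> (p \<odot> q) = Option.bind (subtree \<omega> p) (\<lambda>\<sigma>. lab \<sigma> q)"
    for lab :: "opt \<Rightarrow> addr \<Rightarrow> opt option" and b
  proof -
    have ext: "lab \<tau> (r \<odot> sing e \<odot> z) = Option.bind (ts e) (\<lambda>\<sigma>. lab \<sigma> z)" for e z
      using lab[of \<tau> "r \<odot> sing e" z] by (simp add: subtree_acat sub)
    show ?thesis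
    proof
      assume "\<exists>k z. leaf_label \<psi> k \<noteq> None \<and> b = k \<odot> z \<and> lab (f k) z = Some \<chi>"
      then obtain k z e where "(k, e) \<in> v" "b = k \<odot> z" "lab (f k) z = Some \<chi>"
        using L by metis
      then show "\<exists>a. a \<noteq> r \<and> lab \<tau> a = Some \<chi> \<and> r \<odot> b = readdr v r a"
        using f hit ext by (intro exI[of _ "r \<odot> sing e \<odot> z"]) auto
    next
      assume "\<exists>a. a \<noteq> r \<and> lab \<tau> a = Some \<chi> \<and> r \<odot> b = readdr v r a"
      then obtain a where a: "a \<noteq> r" "lab \<tau> a = Some \<chi>" "r \<odot> b = readdr v r a" by blast
      then obtain c where c: "a = r \<odot> c" using miss by metis
      show "\<exists>k z. leaf_label \<psi> k \<noteq> None \<and> b = k \<odot> z \<and> lab (f k) z = Some \<chi>"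
      proof (cases c rule: addr_cases)
        case eps
        then show ?thesis using a c by simp
      next
        case (cons e z)
        then have "ts e \<noteq> None" using a(2) c ext by (auto simp: bind_eq_Some_conv)
        then obtain k where k: "(k, e) \<in> v" using bij_graphD(6)[OF bij] by blast
        then show ?thesis
          using a c cons hit[OF k] f[OF k] ext L by auto
      qed
    qed
  qed
  \<comment> \<open>Readdressing keeps the addresses of \<tau> beyond \<open>r\<close> beyond
    \<open>r\<close>, so for a \<open>p\<close> that is not beyond \<open>r\<close> the only
    solution is \<open>a = p\<close>.\<close>
  have away: "(\<exists>a. a \<noteq> r \<and> lab \<tau> a = Some \<chi> \<and> p = readdr v r a) \<longleftrightarrow> lab \<tau> p = Some \<chi>"
    if p: "\<nexists>b. p = r \<odot> b" and lab: "\<And>p q \<omega>. lab \<omega> (p \<odot> q) = Option.bind (subtree \<omega> p) (\<lambda>\<sigma>. lab \<sigma> q)"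
    for lab :: "opt \<Rightarrow> addr \<Rightarrow> opt option"
  proof -
    have eq: "a \<noteq> r \<and> lab \<tau> a = Some \<chi> \<and> p = readdr v r a \<longleftrightarrow> p = a \<and> lab \<tau> a = Some \<chi>" for a
    proof (cases "\<exists>c. a = r \<odot> c")
      case True
      then obtain c where c: "a = r \<odot> c" ..
      have "p \<noteq> readdr v r a" if "lab \<tau> a = Some \<chi>" "a \<noteq> r"
      proof (cases c rule: addr_cases)
        case (cons e z)
        have "lab \<tau> ((r \<odot> sing e) \<odot> z) = Some \<chi>" using that c cons by simp
        then have "ts e \<noteq> None" unfolding lab subtree_acat sub by (auto simp: bind_eq_Some_conv)
        then obtain k where k: "(k, e) \<in> v" using bij_graphD(6)[OF bij] by blast
        then show ?thesis using p c cons hit[OF k] by auto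
      qed (use that c in simp)
      then show ?thesis using p c by auto
    next
      case False
      then have "a \<noteq> r" using acat_eps(2)[of r] by metis
      moreover have "readdr v r a = a" using False miss by blast
      ultimately show ?thesis by auto
    qed
    show ?thesis unfolding eq by simp
  qed
  have put: "subtree \<tau> r \<noteq> None" using sub by simp
  have r: "leaf_label \<tau> r = None" by (simp add: leaf_label_def sub)
  \<comment> \<open>The address \<open>r\<close> is a node and not a leaf, so the restriction
    \<open>a \<noteq> r\<close> in \<open>key\<close> and \<open>away\<close> loses no leaf.\<close>
  have leaf: "(\<exists>a. leaf_label \<tau> a = Some \<chi> \<and> p = readdr v r a) \<longleftrightarrow>
      (\<exists>a. a \<noteq> r \<and> leaf_label \<tau> a = Some \<chi> \<and> p = readdr v r a)" for p
    using r by (metis option.distinct(1))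
  show ?I and ?L
  proof (atomize (full), cases "\<exists>b. p = r \<odot> b")
    case True
    then obtain b where b: "p = r \<odot> b" ..
    show "?I \<and> ?L"
      unfolding replace_node_def f_def[symmetric] b inner_label_put(1)[OF put] leaf_label_put(1)[OF put]
        glue_labels leaf key[OF inner_label_acat] key[OF leaf_label_acat] by auto
  next
    case False
    then show "?I \<and> ?L"
      unfolding replace_node_def inner_label_put(2)[OF put False] leaf_label_put(2)[OF put False]
        leaf away[OF False inner_label_acat] away[OF False leaf_label_acat] by auto
  qed
qed

section \<open>Well-formed trees, extensionality and finiteness\<close>

inductive_cases opetope_OEdgeE: "opetope m (OEdge \<phi>)"
inductive_cases opetope_ONodeE: "opetope m (ONode \<psi> ts)"
inductive_cases opetope_OPtE: "opetope m OPt"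
inductive_cases opetope_OArrE: "opetope m OArr"
inductive_cases root_label_OEdgeE: "root_label m (OEdge \<phi>) \<rho>"
inductive_cases root_label_ONodeE: "root_label m (ONode \<psi> ts) \<rho>"

lemma opetope_OEdge_iff [simp]: "opetope (Suc (Suc n)) (OEdge \<phi>) \<longleftrightarrow> opetope n \<phi>"
  using opetope_edge[of n \<phi>] by (auto elim: opetope_OEdgeE)

lemma opetope_ONode_iff:
  "opetope (Suc (Suc n)) (ONode \<psi> ts) \<longleftrightarrow> opetope (Suc n) \<psi> \<and> (\<forall>q. q \<in> nodes \<psi> \<longleftrightarrow> (\<exists>\<sigma>. ts q = Some \<sigma>)) \<and>
    (\<forall>q \<sigma>. ts q = Some \<sigma> \<longrightarrow> opetope (Suc (Suc n)) \<sigma> \<and> root_label (Suc (Suc n)) \<sigma> (src \<psi> q))" (is "_ \<longleftrightarrow> ?R")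
proof
  assume "opetope (Suc (Suc n)) (ONode \<psi> ts)"
  then show "?R" by (cases rule: opetope_ONodeE) auto
next
  assume ?R
  then have "dom ts = nodes \<psi>" by auto
  with \<open>?R\<close> show "opetope (Suc (Suc n)) (ONode \<psi> ts)"
    using opetope_node[of n \<psi> ts] by simp
qed

lemma opetope_atom [simp]: "opetope m OPt \<longleftrightarrow> m = 0" "opetope m OArr \<longleftrightarrow> m = 1"
  using opetope_pt opetope_arr by (auto elim: opetope_OPtE opetope_OArrE)

lemma root_label_OEdge_iff [simp]: "root_label (Suc (Suc n)) (OEdge \<phi>) \<rho> \<longleftrightarrow> \<rho> = \<phi>"
  using root_label_edge[of n \<phi>] by (auto elim: root_label_OEdgeE)

lemma root_label_ONode_iff:
  "root_label (Suc (Suc n)) (ONode \<psi> ts) \<rho> \<longleftrightarrow> (\<exists>w. has_target (Suc n) \<psi> \<rho> w)"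
  using root_label_node[of n \<psi> \<rho>] by (auto elim!: root_label_ONodeE)

lemma opetope_tree_cases [consumes 1, case_names edge node]:
  assumes "opetope (Suc (Suc n)) \<omega>"
  obtains \<phi> where "\<omega> = OEdge \<phi>" | \<psi> ts where "\<omega> = ONode \<psi> ts"
  using assms by (cases \<omega>) auto

lemma opetope_low: "opetope 0 \<omega> \<longleftrightarrow> \<omega> = OPt" "opetope (Suc 0) \<omega> \<longleftrightarrow> \<omega> = OArr"
  by (cases \<omega>; auto elim: opetope_OEdgeE opetope_ONodeE)+

lemma opetope_subtree:
  assumes "opetope (Suc (Suc n)) \<omega>" "subtree \<omega> p = Some \<sigma>"
  shows "opetope (Suc (Suc n)) \<sigma>"
  using assms
proof (induction p arbitrary: \<omega> rule: addr_induct)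
  case (cons q p)
  from cons.prems show ?case
  proof (cases rule: opetope_tree_cases)
    case (node \<psi> ts)
    then show ?thesis using cons by (auto simp: opetope_ONode_iff bind_eq_Some_conv)
  qed (use cons.prems in simp)
qed simp

lemma nodes_tree: "opetope (Suc (Suc n)) \<omega> \<Longrightarrow> nodes \<omega> = dom (inner_label \<omega>)"
  by (cases rule: opetope_tree_cases) (auto simp: nodes_def node_label_eq)

lemma src_tree: "opetope (Suc (Suc n)) \<omega> \<Longrightarrow> src \<omega> p = the (inner_label \<omega> p)"
  by (cases rule: opetope_tree_cases) (auto simp: src_def node_label_eq)

lemma nodes_low [simp]: "nodes OPt = {}" "nodes OArr = {\<epsilon>}" "src OArr \<epsilon> = OPt" "nodes (OEdge \<phi>) = {}"
proof -
  show "nodes OArr = {\<epsilon>}" "src OArr \<epsilon> = OPt"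
    by (auto simp: nodes_def src_def node_label_def split: if_splits)
qed (auto simp: nodes_def node_label_eq)

lemma opetope_label:
  assumes "opetope (Suc (Suc n)) \<omega>"
  shows "inner_label \<omega> p = Some \<psi> \<Longrightarrow> opetope (Suc n) \<psi>"
    and "leaf_label \<omega> p = Some \<phi> \<Longrightarrow> opetope n \<phi>"
  using opetope_subtree[OF assms, of p]
  by (auto simp: inner_label_eq_Some leaf_label_eq_Some opetope_ONode_iff)

lemma opetope_children:
  assumes "opetope (Suc (Suc n)) \<omega>" "inner_label \<omega> a = Some \<psi>"
  shows "subtree \<omega> (a \<odot> sing b) \<noteq> None \<longleftrightarrow> b \<in> nodes \<psi>"
    and "subtree \<omega> (a \<odot> sing b) = Some \<sigma> \<Longrightarrow> root_label (Suc (Suc n)) \<sigma> (src \<psi> b)"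
  using opetope_subtree[OF assms(1), of a] assms(2)
  by (auto simp: inner_label_eq_Some opetope_ONode_iff subtree_acat)

lemma opetope_parent:
  assumes "subtree \<omega> (a \<odot> sing b) \<noteq> None"
  shows "inner_label \<omega> a \<noteq> None"
proof -
  obtain \<sigma> where \<sigma>: "subtree \<omega> a = Some \<sigma>" "subtree \<sigma> (sing b) \<noteq> None"
    using assms by (cases "subtree \<omega> a") (auto simp: subtree_acat)
  then obtain \<psi> ts where "\<sigma> = ONode \<psi> ts"
    using subtree_cons[where p = \<epsilon> and q = b] by (cases \<sigma>) auto
  with \<sigma> show ?thesis by (simp add: inner_label_def)
qed

lemma opetope_total:
  assumes "opetope (Suc (Suc n)) \<omega>"
  shows "subtree \<omega> p \<noteq> None \<longleftrightarrow> inner_label \<omega> p \<noteq> None \<or> leaf_label \<omega> p \<noteq> None"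
proof (cases "subtree \<omega> p")
  case (Some \<sigma>)
  with opetope_subtree[OF assms this] show ?thesis
    by (cases rule: opetope_tree_cases) (auto simp: inner_label_def leaf_label_def)
qed (simp add: inner_label_def leaf_label_def)

lemma opetope_nodes_src: "opetope (Suc m) \<psi> \<Longrightarrow> q \<in> nodes \<psi> \<Longrightarrow> opetope m (src \<psi> q)"
  by (cases m) (auto simp: opetope_low nodes_tree src_tree dest: opetope_label(1))

text \<open>In a tree with a node, the label of a leaf is prescribed by the node below it, as
  \<open>src \<psi> q\<close>. So the labels of the nodes determine such a tree, and a leaf label
  has to be compared only between two bare edges.\<close>

lemma tree_ext:
  assumes "opetope (Suc (Suc n)) \<omega>" "opetope (Suc (Suc n)) \<omega>'" "inner_label \<omega> = inner_label \<omega>'"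
    "\<And>\<phi> \<phi>'. \<omega> = OEdge \<phi> \<Longrightarrow> \<omega>' = OEdge \<phi>' \<Longrightarrow> \<phi> = \<phi>'"
  shows "\<omega> = \<omega>'"
  using assms
proof (induction \<omega> arbitrary: \<omega>' rule: opt.induct)
  case (OEdge \<phi>)
  from OEdge.prems(2) show ?case
  proof (cases rule: opetope_tree_cases)
    case (edge \<phi>')
    then show ?thesis using OEdge.prems(4) by blast
  next
    case node
    then show ?thesis using fun_cong[OF OEdge.prems(3), of \<epsilon>] by simp
  qed
next
  case (ONode \<psi> ts)
  from ONode.prems(2) show ?case
  proof (cases rule: opetope_tree_cases)
    case edge
    then show ?thesis using fun_cong[OF ONode.prems(3), of \<epsilon>] by auto
  next
    case (node \<psi>' ts')
    have \<psi>: "\<psi>' = \<psi>" using fun_cong[OF ONode.prems(3), of \<epsilon>] node by simp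
    have dom: "(\<exists>\<sigma>. ts q = Some \<sigma>) \<longleftrightarrow> (\<exists>\<sigma>. ts' q = Some \<sigma>)" for q
      using ONode.prems(1,2) node \<psi> by (simp add: opetope_ONode_iff)
    have "ts q = ts' q" for q
    proof (cases "ts q")
      case None
      then show ?thesis using dom[of q] by (cases "ts' q") auto
    next
      case (Some \<sigma>)
      then obtain \<sigma>' where \<sigma>': "ts' q = Some \<sigma>'" using dom[of q] by blast
      have op: "opetope (Suc (Suc n)) \<sigma>" "opetope (Suc (Suc n)) \<sigma>'"
        and rl: "root_label (Suc (Suc n)) \<sigma> (src \<psi> q)" "root_label (Suc (Suc n)) \<sigma>' (src \<psi> q)"
        using ONode.prems(1,2) node \<psi> Some \<sigma>' by (auto simp: opetope_ONode_iff)
      have "inner_label \<sigma> p = inner_label \<sigma>' p" for p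
        using fun_cong[OF ONode.prems(3), of "sing q \<odot> p"] Some \<sigma>' node by simp
      then have eq: "inner_label \<sigma> = inner_label \<sigma>'" ..
      have "\<sigma> = \<sigma>'"
      proof (rule ONode.IH(2))
        show "ts q \<in> range ts" by (rule rangeI)
        show "\<sigma> \<in> set_option (ts q)" using Some by simp
        show "\<phi> = \<phi>'" if "\<sigma> = OEdge \<phi>" "\<sigma>' = OEdge \<phi>'" for \<phi> \<phi>'
          using rl that by simp
      qed (fact op eq)+
      then show ?thesis using Some \<sigma>' by simp
    qed
    then show ?thesis using node \<psi> by auto
  qed
qed auto

lemma tree_extI:
  assumes "opetope (Suc (Suc n)) \<omega>" "opetope (Suc (Suc n)) \<omega>'"
    "\<And>p \<chi>. inner_label \<omega> p = Some \<chi> \<longleftrightarrow> inner_label \<omega>' p = Some \<chi>"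
    "\<And>p \<chi>. leaf_label \<omega> p = Some \<chi> \<longleftrightarrow> leaf_label \<omega>' p = Some \<chi>"
  shows "\<omega> = \<omega>'"
proof (rule tree_ext[OF assms(1,2)])
  show "inner_label \<omega> = inner_label \<omega>'"
  proof
    fix p
    show "inner_label \<omega> p = inner_label \<omega>' p"
      using assms(3)[of p] by (metis not_None_eq)
  qed
  show "\<phi> = \<phi>'" if "\<omega> = OEdge \<phi>" "\<omega>' = OEdge \<phi>'" for \<phi> \<phi>'
    using assms(4)[of \<epsilon> \<phi>] that by simp
qed

text \<open>Compatibility of root labels is an implication for all \<rho>, because the root label of
  an \<open>ONode\<close> is a target of its label and targets are not yet known to be
  unique.\<close>

lemma put_opetope:
  assumes "opetope (Suc (Suc n)) \<omega>" "subtree \<omega> p = Some \<sigma>" "opetope (Suc (Suc n)) \<sigma>'"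
    "\<And>\<rho>. root_label (Suc (Suc n)) \<sigma> \<rho> \<Longrightarrow> root_label (Suc (Suc n)) \<sigma>' \<rho>"
  shows "opetope (Suc (Suc n)) (put \<omega> p \<sigma>')"
    and "root_label (Suc (Suc n)) \<omega> \<rho> \<Longrightarrow> root_label (Suc (Suc n)) (put \<omega> p \<sigma>') \<rho>"
proof -
  have "opetope (Suc (Suc n)) (put \<omega> p \<sigma>') \<and>
    (\<forall>\<rho>. root_label (Suc (Suc n)) \<omega> \<rho> \<longrightarrow> root_label (Suc (Suc n)) (put \<omega> p \<sigma>') \<rho>)"
    using assms(1,2)
  proof (induction p arbitrary: \<omega> rule: addr_induct)
    case eps
    then show ?case using assms by auto
  next
    case (cons q p)
    from cons.prems show ?case
    proof (cases rule: opetope_tree_cases)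
      case (node \<psi> ts)
      then obtain \<omega>1 where \<omega>1: "ts q = Some \<omega>1" "subtree \<omega>1 p = Some \<sigma>"
        using cons.prems(2) by (auto simp: bind_eq_Some_conv)
      have "opetope (Suc (Suc n)) \<omega>1" using cons.prems(1) node \<omega>1 by (auto simp: opetope_ONode_iff)
      from cons.IH[OF this \<omega>1(2)] show ?thesis
        using cons.prems(1) node \<omega>1 by (auto simp: opetope_ONode_iff root_label_ONode_iff)
    qed (use cons.prems in simp)
  qed
  then show "opetope (Suc (Suc n)) (put \<omega> p \<sigma>')"
    and "root_label (Suc (Suc n)) \<omega> \<rho> \<Longrightarrow> root_label (Suc (Suc n)) (put \<omega> p \<sigma>') \<rho>"
    by auto
qed

lemma glue_opetope:
  assumes "opetope (Suc (Suc n)) \<psi>"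
    "\<And>k \<phi>. leaf_label \<psi> k = Some \<phi> \<Longrightarrow> opetope (Suc (Suc n)) (f k) \<and> root_label (Suc (Suc n)) (f k) \<phi>"
  shows "opetope (Suc (Suc n)) (glue \<psi> f)"
    and "root_label (Suc (Suc n)) \<psi> \<rho> \<Longrightarrow> root_label (Suc (Suc n)) (glue \<psi> f) \<rho>"
proof -
  have "opetope (Suc (Suc n)) (glue \<psi> f) \<and>
    (\<forall>\<rho>. root_label (Suc (Suc n)) \<psi> \<rho> \<longrightarrow> root_label (Suc (Suc n)) (glue \<psi> f) \<rho>)"
    using assms
  proof (induction \<psi> arbitrary: f rule: opt.induct)
    case (ONode \<psi> ts)
    have "opetope (Suc (Suc n)) (glue \<sigma> (\<lambda>k. f (sing q \<odot> k))) \<and>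
        (\<forall>\<rho>. root_label (Suc (Suc n)) \<sigma> \<rho> \<longrightarrow> root_label (Suc (Suc n)) (glue \<sigma> (\<lambda>k. f (sing q \<odot> k))) \<rho>)"
      if "ts q = Some \<sigma>" for q \<sigma>
    proof (rule ONode.IH(2))
      show "ts q \<in> range ts" by (rule rangeI)
      show "\<sigma> \<in> set_option (ts q)" using that by simp
      show "opetope (Suc (Suc n)) \<sigma>" using that ONode.prems(1) by (simp add: opetope_ONode_iff)
      show "opetope (Suc (Suc n)) (f (sing q \<odot> k)) \<and> root_label (Suc (Suc n)) (f (sing q \<odot> k)) \<phi>"
        if "leaf_label \<sigma> k = Some \<phi>" for k \<phi>
        using ONode.prems(2)[of "sing q \<odot> k" \<phi>] that \<open>ts q = Some \<sigma>\<close> by simp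
    qed
    then show ?case
      using ONode.prems(1) by (auto simp: opetope_ONode_iff root_label_ONode_iff)
  qed auto
  then show "opetope (Suc (Suc n)) (glue \<psi> f)"
    and "root_label (Suc (Suc n)) \<psi> \<rho> \<Longrightarrow> root_label (Suc (Suc n)) (glue \<psi> f) \<rho>"
    by auto
qed

lemma corolla_labels [simp]:
  "inner_label (corolla \<psi>) p = (if p = \<epsilon> then Some \<psi> else None)"
  "leaf_label (corolla \<psi>) p = Some \<phi> \<longleftrightarrow> (\<exists>q\<in>nodes \<psi>. p = sing q \<and> \<phi> = src \<psi> q)"
proof -
  show "inner_label (corolla \<psi>) p = (if p = \<epsilon> then Some \<psi> else None)"
    by (cases p rule: addr_cases) (auto simp: corolla_def)
  show "leaf_label (corolla \<psi>) p = Some \<phi> \<longleftrightarrow> (\<exists>q\<in>nodes \<psi>. p = sing q \<and> \<phi> = src \<psi> q)"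
    by (cases p rule: addr_cases) (auto simp: corolla_def)
qed

lemma leaves_corolla: "leaves (corolla \<psi>) = sing ` nodes \<psi>"
  unfolding leaves_eq dom_def by auto

lemma opetope_corolla: "opetope (Suc m) \<psi> \<Longrightarrow> opetope (Suc (Suc m)) (corolla \<psi>)"
  by (auto simp: corolla_def opetope_ONode_iff opetope_nodes_src split: if_splits)

text \<open>Finiteness is not built into \<open>opt\<close>, where the children form a function on
  all addresses. It comes from the labels: the children of a node are indexed by the nodes of its
  label, which is a smaller term.\<close>

lemma finite_nodes: "opetope m \<omega> \<Longrightarrow> finite (nodes \<omega>)"
proof (induction \<omega> arbitrary: m rule: opt.induct)
  case (ONode \<psi> ts)
  then obtain n where m: "m = Suc (Suc n)" by (auto elim: opetope_ONodeE)
  note op = ONode.prems[unfolded m]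
  have "dom ts = nodes \<psi>" using op by (auto simp: opetope_ONode_iff)
  then have fin: "finite (dom ts)" using op ONode.IH(1)[of "Suc n"] by (simp add: opetope_ONode_iff)
  have "nodes (ONode \<psi> ts) \<subseteq> insert \<epsilon> (\<Union>q\<in>dom ts. (\<lambda>p. sing q \<odot> p) ` nodes (the (ts q)))"
  proof
    fix p assume p: "p \<in> nodes (ONode \<psi> ts)"
    show "p \<in> insert \<epsilon> (\<Union>q\<in>dom ts. (\<lambda>p. sing q \<odot> p) ` nodes (the (ts q)))"
    proof (cases p rule: addr_cases)
      case (cons q p')
      then obtain \<sigma> where \<sigma>: "ts q = Some \<sigma>" "inner_label \<sigma> p' \<noteq> None"
        using p op by (auto simp: nodes_tree bind_eq_Some_conv)
      moreover have "opetope (Suc (Suc n)) \<sigma>" using op \<sigma> by (simp add: opetope_ONode_iff)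
      ultimately have "p' \<in> nodes \<sigma>" by (auto simp: nodes_tree)
      then show ?thesis using cons \<sigma> by (auto intro!: bexI[of _ q])
    qed simp
  qed
  moreover have "finite (nodes (the (ts q)))" if "q \<in> dom ts" for q
  proof (rule ONode.IH(2))
    show "ts q \<in> range ts" by (rule rangeI)
    show "the (ts q) \<in> set_option (ts q)" using that by auto
    show "opetope (Suc (Suc n)) (the (ts q))" using that op by (auto simp: opetope_ONode_iff)
  qed
  ultimately show ?case using fin by (auto intro: finite_subset)
qed auto

subsection \<open>Replacing a node\<close>

text \<open>The last two conditions are the globular identities of an opetope: a leaf carries the
  source of the target at the matching node, and the root edge carries the target of the
  target.\<close>

definition target_ok :: "nat \<Rightarrow> opt \<Rightarrow> opt \<Rightarrow> (addr \<times> addr) set \<Rightarrow> bool"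
  where "target_ok k \<omega> \<tau> w \<longleftrightarrow>
    opetope (Suc k) \<omega> \<and> opetope k \<tau> \<and> bij_graph w (leaves \<omega>) (nodes \<tau>) \<and>
    (\<forall>l e. (l, e) \<in> w \<longrightarrow> leaf_label \<omega> l = Some (src \<tau> e)) \<and>
    (\<forall>\<phi> v. has_target k \<tau> \<phi> v \<longrightarrow> root_label (Suc k) \<omega> \<phi>)"

lemma target_okD:
  assumes "target_ok k \<omega> \<tau> w"
  shows "opetope (Suc k) \<omega>" "opetope k \<tau>" "bij_graph w (leaves \<omega>) (nodes \<tau>)"
    "(l, e) \<in> w \<Longrightarrow> leaf_label \<omega> l = Some (src \<tau> e)"
    "has_target k \<tau> \<phi> v \<Longrightarrow> root_label (Suc k) \<omega> \<phi>"
  using assms by (auto simp: target_ok_def)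

lemma readdr_prefix:
  assumes "bij_graph v L N"
  shows "readdr v (s \<odot> r) (s \<odot> a) = s \<odot> readdr v r a"
proof (cases "\<exists>x y z. (x, y) \<in> v \<and> a = r \<odot> sing y \<odot> z")
  case True
  then obtain x y z where xyz: "(x, y) \<in> v" "a = r \<odot> sing y \<odot> z" by blast
  note hit = readdr_hit[OF xyz(1) bij_graphD(4)[OF assms _ xyz(1)], of _ z]
  show ?thesis using hit[of "s \<odot> r"] hit[of r] xyz(2) by simp
next
  case False
  have "readdr v r a = a" by (rule readdr_miss) (use False in blast)
  moreover have "readdr v (s \<odot> r) (s \<odot> a) = s \<odot> a" by (rule readdr_miss) (use False in auto)
  ultimately show ?thesis by simp
qed

text \<open>The label \<phi> of the node should be the target of \<psi>. Only the consequences of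
  this collected in \<open>target_ok\<close> are assumed, so that the locale can be used inside the
  induction that proves the laws of targets.\<close>

locale node_subst =
  fixes n \<tau> r \<phi> \<psi> v
  assumes tree: "opetope (Suc (Suc n)) \<tau>"
    and node: "inner_label \<tau> r = Some \<phi>"
    and ok: "target_ok (Suc n) \<psi> \<phi> v"
begin

lemma tree': "opetope (Suc (Suc n)) \<psi>" and bij: "bij_graph v (leaves \<psi>) (nodes \<phi>)"
  and leaf_src: "(k, e) \<in> v \<Longrightarrow> leaf_label \<psi> k = Some (src \<phi> e)"
  and root: "has_target (Suc n) \<phi> \<rho> x \<Longrightarrow> root_label (Suc (Suc n)) \<psi> \<rho>"
  using target_okD[OF ok] by blast+

lemma node_tree:
  obtains ts where "subtree \<tau> r = Some (ONode \<phi> ts)" "dom ts = nodes \<phi>"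
    "opetope (Suc (Suc n)) (ONode \<phi> ts)"
proof -
  obtain ts where ts: "subtree \<tau> r = Some (ONode \<phi> ts)"
    using node by (auto simp: inner_label_eq_Some)
  moreover have op: "opetope (Suc (Suc n)) (ONode \<phi> ts)"
    using opetope_subtree[OF tree ts] .
  moreover have "dom ts = nodes \<phi>" using op by (auto simp: opetope_ONode_iff)
  ultimately show ?thesis using that by blast
qed

lemma
  shows inner_label_replace: "inner_label (replace_node \<tau> r \<psi> v) p = Some \<chi> \<longleftrightarrow>
      (\<exists>b. p = r \<odot> b \<and> inner_label \<psi> b = Some \<chi>) \<or>
      (\<exists>a. a \<noteq> r \<and> inner_label \<tau> a = Some \<chi> \<and> p = readdr v r a)" (is ?I)
    and leaf_label_replace: "leaf_label (replace_node \<tau> r \<psi> v) p = Some \<chi> \<longleftrightarrow>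
      (\<exists>a. leaf_label \<tau> a = Some \<chi> \<and> p = readdr v r a)" (is ?L)
proof -
  obtain ts where ts: "subtree \<tau> r = Some (ONode \<phi> ts)" "dom ts = nodes \<phi>" by (rule node_tree)
  show ?I and ?L
    by (rule replace_node_labels[OF ts(1)], simp add: ts(2) bij)+
qed

lemma hit: "(k, e) \<in> v \<Longrightarrow> readdr v r (r \<odot> sing e \<odot> z) = r \<odot> k \<odot> z"
  by (rule readdr_hit) (use bij_graphD(4)[OF bij] in blast)+

lemma miss: "(\<And>c. a \<noteq> r \<odot> c) \<Longrightarrow> readdr v r a = a"
  by (rule readdr_miss) simp

text \<open>The trichotomy behind all computations with \<open>readdr\<close>. An address of \<tau>
  strictly beyond \<open>r\<close> passes through some input of \<open>r\<close>, and the bijection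
  \<open>v\<close> supplies the leaf of \<psi> that takes the place of this input.\<close>

lemma position [consumes 1, case_names self away above]:
  assumes "subtree \<tau> a \<noteq> None"
  obtains "a = r" | "\<And>c. a \<noteq> r \<odot> c" "readdr v r a = a"
  | k e z where "(k, e) \<in> v" "a = r \<odot> sing e \<odot> z" "readdr v r a = r \<odot> k \<odot> z"
proof (cases "\<exists>c. a = r \<odot> c")
  case True
  then obtain c where c: "a = r \<odot> c" ..
  show ?thesis
  proof (cases c rule: addr_cases)
    case eps
    then show ?thesis using that(1) c by simp
  next
    case (cons e z)
    obtain ts where ts: "subtree \<tau> r = Some (ONode \<phi> ts)" "dom ts = nodes \<phi>" by (rule node_tree)
    have "ts e \<noteq> None" using assms c cons ts by (auto simp: subtree_acat)
    then have "e \<in> nodes \<phi>" using ts(2) by blast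
    then obtain k where "(k, e) \<in> v" using bij_graphD(6)[OF bij] by blast
    then show ?thesis using that(3) c cons hit by simp
  qed
next
  case False
  then show ?thesis using that(2) miss by blast
qed

lemma leaf_of: "(k, e) \<in> v \<Longrightarrow> leaf_label \<psi> k \<noteq> None"
  using leaf_src by simp

lemma same_leaf:
  assumes "(k, e) \<in> v" "(k', e') \<in> v" "k \<odot> z = k' \<odot> z'"
  shows "k = k' \<and> e = e' \<and> z = z'"
proof -
  have "k = k' \<and> z = z'"
    using leaf_antichain[OF leaf_src[OF assms(1)] _ assms(3) leaf_src[OF assms(2)]]
      leaf_src[OF assms(2)] by (simp add: leaf_label_eq_Some)
  then show ?thesis using assms bij_graphD(3)[OF bij] by blast
qed

text \<open>A readdressed address either avoids \<open>r\<close> or runs through a leaf of \<psi>,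
  and no node of \<psi> lies beyond a leaf of \<psi>.\<close>

lemma not_in_replacement:
  assumes "subtree \<tau> a \<noteq> None" "a \<noteq> r" "inner_label \<psi> b \<noteq> None"
  shows "readdr v r a \<noteq> r \<odot> b"
  using assms(1)
proof (cases rule: position)
  case (above k e z)
  then show ?thesis using leaf_not_below[OF leaf_src[OF above(1)]] assms(3) by auto
qed (use assms in auto)

lemma readdr_inj:
  assumes "subtree \<tau> a \<noteq> None" "subtree \<tau> b \<noteq> None" "a \<noteq> r" "b \<noteq> r" "readdr v r a = readdr v r b"
  shows "a = b"
  using assms(1)
proof (cases rule: position)
  case away
  from assms(2) show ?thesis
    by (cases rule: position) (use assms away in auto)
next
  case (above k e z)
  note a = above
  from assms(2) show ?thesis
  proof (cases rule: position)
    case (above k' e' z')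
    then show ?thesis using a assms(5) same_leaf[of k e k' e' z z'] by auto
  qed (use assms a in auto)
qed (use assms in auto)

text \<open>The condition excludes the prefixes \<open>a\<close> of \<open>r\<close>: an extension
  of such an \<open>a\<close> may pass through an input of \<open>r\<close> and be moved, while
  \<open>a\<close> itself stays.\<close>

lemma readdr_acat:
  assumes "subtree \<tau> a \<noteq> None" "\<And>c. r \<noteq> a \<odot> c"
  shows "readdr v r (a \<odot> z) = readdr v r a \<odot> z"
  using assms(1)
proof (cases rule: position)
  case self
  then show ?thesis using assms(2)[of \<epsilon>] by simp
next
  case away
  have "a \<odot> z \<noteq> r \<odot> c" for c
  proof
    assume "a \<odot> z = r \<odot> c"
    then show False by (cases rule: acat_eq_cases) (use away assms in blast)+
  qed
  then show ?thesis using miss away by metis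
next
  case (above k e y)
  then show ?thesis using hit[of k e "y \<odot> z"] by simp
qed

lemma leaf_not_prefix: "leaf_label \<tau> a \<noteq> None \<Longrightarrow> r \<noteq> a \<odot> c"
  using leaf_not_below node by blast

text \<open>Edge labels agree at both interfaces by the two globular identities: the leaves of
  \<psi> carry the sources of \<phi>, and the root of \<psi> carries the target of \<phi>.\<close>

lemma opetope_replace: "opetope (Suc (Suc n)) (replace_node \<tau> r \<psi> v)"
proof -
  obtain ts where ts: "subtree \<tau> r = Some (ONode \<phi> ts)" "dom ts = nodes \<phi>"
    "opetope (Suc (Suc n)) (ONode \<phi> ts)" by (rule node_tree)
  define f where "f k = the (subtree \<tau> (r \<odot> sing (THE e. (k, e) \<in> v)))" for k
  have f: "opetope (Suc (Suc n)) (f k) \<and> root_label (Suc (Suc n)) (f k) \<chi>"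
    if "leaf_label \<psi> k = Some \<chi>" for k \<chi>
  proof -
    have "k \<in> leaves \<psi>" using that by (auto simp: leaves_eq)
    then obtain e where e: "(k, e) \<in> v" using bij_graphD(5)[OF bij] by blast
    have the_e: "(THE e. (k, e) \<in> v) = e"
      using e bij_graphD(3)[OF bij] by blast
    have "e \<in> dom ts" using e ts bij_graphD(2)[OF bij] by blast
    then obtain \<sigma> where \<sigma>: "ts e = Some \<sigma>" by blast
    have "f k = \<sigma>" using the_e \<sigma> ts by (simp add: f_def subtree_acat)
    moreover have "\<chi> = src \<phi> e" using that leaf_src[OF e] by simp
    ultimately show ?thesis using ts(3) \<sigma> by (auto simp: opetope_ONode_iff)
  qed
  have g: "root_label (Suc (Suc n)) (glue \<psi> f) \<rho>"
    if "root_label (Suc (Suc n)) (ONode \<phi> ts) \<rho>" for \<rho>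
  proof -
    have "root_label (Suc (Suc n)) \<psi> \<rho>"
      using that root by (auto simp: root_label_ONode_iff)
    then show ?thesis by (rule glue_opetope(2)[OF tree', rotated]) (fact f)
  qed
  show "opetope (Suc (Suc n)) (replace_node \<tau> r \<psi> v)"
    unfolding replace_node_def f_def[symmetric]
    by (rule put_opetope(1)[OF tree ts(1) glue_opetope(1)[OF tree' f] g])
qed

end

section \<open>Replacements at two distinct nodes\<close>

locale node_pair = A: node_subst n \<tau> r \<phi> \<psi> v + B: node_subst n \<tau> r' \<phi>' \<psi>' v'
  for n \<tau> r \<phi> \<psi> v r' \<phi>' \<psi>' v' +
  assumes distinct: "r \<noteq> r'"
begin

lemma in_tree: "subtree \<tau> r \<noteq> None" "subtree \<tau> r' \<noteq> None"
  using A.node B.node by (auto simp: inner_label_def split: option.splits)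

lemma position_pair [case_names above below apart]:
  obtains k e z where "(k, e) \<in> v" "r' = r \<odot> sing e \<odot> z" "readdr v r r' = r \<odot> k \<odot> z"
      "\<And>c. r \<noteq> r' \<odot> c" "readdr v' r' r = r"
  | k e z where "(k, e) \<in> v'" "r = r' \<odot> sing e \<odot> z" "readdr v' r' r = r' \<odot> k \<odot> z"
      "\<And>c. r' \<noteq> r \<odot> c" "readdr v r r' = r'"
  | "\<And>c. r \<noteq> r' \<odot> c" "\<And>c. r' \<noteq> r \<odot> c" "readdr v r r' = r'" "readdr v' r' r = r"
proof -
  from in_tree(2) show ?thesis
  proof (cases rule: A.position)
    case self
    then show ?thesis using distinct by simp
  next
    case away
    from in_tree(1) show ?thesis
    proof (cases rule: B.position)
      case self
      then show ?thesis using distinct by simp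
    qed (use that(2,3) away in blast)+
  next
    case (above k e z)
    have "r \<noteq> r' \<odot> c" for c using above(2) by (auto simp: addr_eq_iff)
    then show ?thesis using that(1) above B.miss by blast
  qed
qed

text \<open>The case where \<open>r'\<close> lies beyond \<open>r\<close>, through the input
  \<open>e\<close>: then \<open>r'\<close> moves to \<open>r \<odot> k \<odot> z\<close>, whereas
  \<open>r\<close> is fixed by the other replacement. The opposite nesting follows by exchanging the
  roles.\<close>

lemma commute_above:
  assumes "(k, e) \<in> v" "r' = r \<odot> sing e \<odot> z" "readdr v r r' = r \<odot> k \<odot> z"
    "\<And>c. r \<noteq> r' \<odot> c" "readdr v' r' r = r"
    and a: "subtree \<tau> a \<noteq> None" "a \<noteq> r" "a \<noteq> r'"
  shows "readdr v' (readdr v r r') (readdr v r a) = readdr v (readdr v' r' r) (readdr v' r' a)"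
  using a(1)
proof (cases rule: A.position)
  case self
  then show ?thesis using a by simp
next
  case away
  have "readdr v' r' a = a"
    by (rule B.miss) (use away(1) assms(2) in simp)
  moreover have "readdr v' (r \<odot> k \<odot> z) a = a"
    by (rule readdr_miss) (use away(1) in simp)
  ultimately show ?thesis using away assms by simp
next
  case (above k2 e2 z2)
  note 2 = above
  from a(1) show ?thesis
  proof (cases rule: B.position)
    case self
    then show ?thesis using a by simp
  next
    case away
    \<comment> \<open>Were the moved address beyond the new position of \<open>r'\<close>, then
      \<open>same_leaf\<close> would force it through the same leaf, and \<open>a\<close> would
      already lie beyond \<open>r'\<close>.\<close>
    have "readdr v' (r \<odot> k \<odot> z) (r \<odot> k2 \<odot> z2) = r \<odot> k2 \<odot> z2"
    proof (rule readdr_miss)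
      fix k3 e3 z3
      show "r \<odot> k2 \<odot> z2 \<noteq> (r \<odot> k \<odot> z) \<odot> sing e3 \<odot> z3"
      proof
        assume "r \<odot> k2 \<odot> z2 = (r \<odot> k \<odot> z) \<odot> sing e3 \<odot> z3"
        then have "k2 \<odot> z2 = k \<odot> (z \<odot> sing e3 \<odot> z3)" by simp
        from A.same_leaf[OF 2(1) assms(1) this] have "a = r' \<odot> (sing e3 \<odot> z3)"
          using 2 assms(2) by simp
        then show False using away(1) by blast
      qed
    qed
    then show ?thesis using 2 away assms by simp
  next
    case (above k3 e3 z3)
    then have "e2 = e \<and> z2 = z \<odot> sing e3 \<odot> z3" using 2 assms(2) by simp
    then have eq: "e2 = e" "z2 = z \<odot> sing e3 \<odot> z3" "k2 = k"
      using bij_graphD(4)[OF A.bij 2(1)] assms(1) by auto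
    have "readdr v' (r \<odot> k \<odot> z) ((r \<odot> k \<odot> z) \<odot> sing e3 \<odot> z3) = (r \<odot> k \<odot> z) \<odot> k3 \<odot> z3"
      by (rule readdr_hit[OF above(1)]) (use bij_graphD(4)[OF B.bij] above(1) in blast)
    moreover have "readdr v r (r \<odot> sing e \<odot> (z \<odot> k3 \<odot> z3)) = r \<odot> k \<odot> (z \<odot> k3 \<odot> z3)"
      by (rule A.hit[OF assms(1)])
    ultimately show ?thesis using above 2 eq assms by simp
  qed
qed

text \<open>The copy of \<psi> moves rigidly with its root. If \<open>r'\<close> lies beyond
  \<open>r\<close>, it ends up beyond a leaf of the copy, where no node of \<psi> can follow
  it.\<close>

lemma new_position:
  assumes b: "inner_label \<psi> b \<noteq> None"
  shows "readdr v' (readdr v r r') (r \<odot> b) = readdr v' r' r \<odot> b"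
  using position_pair
proof cases
  case (above k e z)
  have "readdr v' (r \<odot> k \<odot> z) (r \<odot> b) = r \<odot> b"
  proof (rule readdr_miss)
    fix k3 e3 z3
    show "r \<odot> b \<noteq> (r \<odot> k \<odot> z) \<odot> sing e3 \<odot> z3"
      using leaf_not_below[OF A.leaf_src[OF above(1)], of b] b by auto
  qed
  then show ?thesis using above by simp
next
  case (below k e z)
  then show ?thesis using B.hit[OF below(1), of "z \<odot> b"] by simp
next
  case apart
  have "r \<odot> b \<noteq> r' \<odot> c" for c
  proof
    assume "r \<odot> b = r' \<odot> c"
    then show False by (cases rule: acat_eq_cases) (use apart in blast)+
  qed
  then have "readdr v' r' (r \<odot> b) = r \<odot> b" by (rule B.miss)
  then show ?thesis using apart by simp
qed

end

lemma node_pair_swap: "node_pair n \<tau> r \<phi> \<psi> v r' \<phi>' \<psi>' v' \<Longrightarrow> node_pair n \<tau> r' \<phi>' \<psi>' v' r \<phi> \<psi> v"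
  unfolding node_pair_def node_pair_axioms_def by blast

context node_pair
begin

lemma commute:
  assumes a: "subtree \<tau> a \<noteq> None" "a \<noteq> r" "a \<noteq> r'"
  shows "readdr v' (readdr v r r') (readdr v r a) = readdr v (readdr v' r' r) (readdr v' r' a)"
  using position_pair
proof cases
  case above
  then show ?thesis by (rule commute_above[OF _ _ _ _ _ a])
next
  case below
  interpret S: node_pair n \<tau> r' \<phi>' \<psi>' v' r \<phi> \<psi> v
    using node_pair_axioms by (rule node_pair_swap)
  show ?thesis
    by (rule S.commute_above[OF below a(1,3,2), symmetric])
next
  case apart
  have *: "r \<odot> c \<noteq> r' \<odot> d" for c d
  proof
    assume "r \<odot> c = r' \<odot> d"
    then show False by (cases rule: acat_eq_cases) (use apart in blast)+
  qed
  from a(1) show ?thesis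
  proof (cases rule: A.position)
    case self
    then show ?thesis using a by simp
  next
    case away
    note A = away
    from a(1) show ?thesis
    proof (cases rule: B.position)
      case self
      then show ?thesis using a by simp
    next
      case away
      then show ?thesis using A apart by simp
    next
      case (above k e z)
      have "readdr v r (r' \<odot> k \<odot> z) = r' \<odot> k \<odot> z"
        by (rule A.miss) (use *[symmetric] in simp)
      then show ?thesis using A above apart by simp
    qed
  next
    case (above k e z)
    have "readdr v' r' (r \<odot> k \<odot> z) = r \<odot> k \<odot> z"
      by (rule B.miss) (use * in simp)
    moreover have "readdr v' r' a = a"
      by (rule B.miss) (use * above in simp)
    ultimately show ?thesis using above apart by simp
  qed
qed

lemma second: "node_subst n (replace_node \<tau> r \<psi> v) (readdr v r r') \<phi>' \<psi>' v'"
proof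
  show "opetope (Suc (Suc n)) (replace_node \<tau> r \<psi> v)" by (rule A.opetope_replace)
  show "inner_label (replace_node \<tau> r \<psi> v) (readdr v r r') = Some \<phi>'"
    using B.node distinct by (auto simp: A.inner_label_replace)
  show "target_ok (Suc n) \<psi>' \<phi>' v'" by (rule B.ok)
qed

text \<open>Apart from the nested \<open>readdr\<close>, which is a matter for
  \<open>commute\<close>, this description is symmetric in the two replacements. Applying the label
  lemma twice produces inequations; they disappear because the position \<open>readdr v r r'\<close>
  is neither a node of the copy of \<psi> nor the image of a remaining node other than
  \<open>r'\<close>.\<close>

lemma double_labels:
  shows "inner_label (replace_node (replace_node \<tau> r \<psi> v) (readdr v r r') \<psi>' v') p = Some \<chi> \<longleftrightarrow>
      (\<exists>b. p = readdr v r r' \<odot> b \<and> inner_label \<psi>' b = Some \<chi>) \<or>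
      (\<exists>b. p = readdr v' r' r \<odot> b \<and> inner_label \<psi> b = Some \<chi>) \<or>
      (\<exists>a. a \<noteq> r \<and> a \<noteq> r' \<and> inner_label \<tau> a = Some \<chi> \<and>
        p = readdr v' (readdr v r r') (readdr v r a))" (is ?I)
    and "leaf_label (replace_node (replace_node \<tau> r \<psi> v) (readdr v r r') \<psi>' v') p = Some \<chi> \<longleftrightarrow>
      (\<exists>a. leaf_label \<tau> a = Some \<chi> \<and> p = readdr v' (readdr v r r') (readdr v r a))" (is ?L)
proof -
  let ?\<tau> = "replace_node (replace_node \<tau> r \<psi> v) (readdr v r r') \<psi>' v'"
  interpret S: node_subst n "replace_node \<tau> r \<psi> v" "readdr v r r'" \<phi>' \<psi>' v'
    by (rule second)
  have in_tree_label: "subtree \<tau> a \<noteq> None" if "inner_label \<tau> a = Some \<chi>" for a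
    using that by (auto simp: inner_label_eq_Some)
  have 1: "r \<odot> b \<noteq> readdr v r r'" if "inner_label \<psi> b = Some \<chi>" for b
    using A.not_in_replacement[OF in_tree(2), of b] distinct that by fastforce
  have 2: "readdr v r a \<noteq> readdr v r r' \<longleftrightarrow> a \<noteq> r'" if "inner_label \<tau> a = Some \<chi>" "a \<noteq> r" for a
    using A.readdr_inj[OF in_tree_label[OF that(1)] in_tree(2)] that distinct by metis
  have 3: "readdr v' (readdr v r r') (r \<odot> b) = readdr v' r' r \<odot> b" if "inner_label \<psi> b = Some \<chi>" for b
    using new_position that by simp
  show ?I
  proof -
    have e1: "r \<odot> b \<noteq> readdr v r r' \<and> inner_label \<psi> b = Some \<chi> \<and> p = readdr v' (readdr v r r') (r \<odot> b) \<longleftrightarrow>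
        p = readdr v' r' r \<odot> b \<and> inner_label \<psi> b = Some \<chi>" for b
      using 1[of b] 3[of b] by auto
    have e2: "readdr v r a \<noteq> readdr v r r' \<and> a \<noteq> r \<and> inner_label \<tau> a = Some \<chi> \<and>
          p = readdr v' (readdr v r r') (readdr v r a) \<longleftrightarrow>
        a \<noteq> r \<and> a \<noteq> r' \<and> inner_label \<tau> a = Some \<chi> \<and> p = readdr v' (readdr v r r') (readdr v r a)" for a
      using 2[of a] by blast
    have "inner_label ?\<tau> p = Some \<chi> \<longleftrightarrow>
      (\<exists>b. p = readdr v r r' \<odot> b \<and> inner_label \<psi>' b = Some \<chi>) \<or>
      (\<exists>b. r \<odot> b \<noteq> readdr v r r' \<and> inner_label \<psi> b = Some \<chi> \<and> p = readdr v' (readdr v r r') (r \<odot> b)) \<or>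
      (\<exists>a. readdr v r a \<noteq> readdr v r r' \<and> a \<noteq> r \<and> inner_label \<tau> a = Some \<chi> \<and>
          p = readdr v' (readdr v r r') (readdr v r a))"
      unfolding S.inner_label_replace A.inner_label_replace by blast
    then show ?thesis unfolding e1 e2 .
  qed
  show ?L
    unfolding S.leaf_label_replace A.leaf_label_replace by blast
qed

lemma replace_commute:
  "replace_node (replace_node \<tau> r \<psi> v) (readdr v r r') \<psi>' v' =
   replace_node (replace_node \<tau> r' \<psi>' v') (readdr v' r' r) \<psi> v" (is "?L = ?R")
proof -
  interpret S: node_pair n \<tau> r' \<phi>' \<psi>' v' r \<phi> \<psi> v
    using node_pair_axioms by (rule node_pair_swap)
  have inner: "subtree \<tau> a \<noteq> None" if "inner_label \<tau> a = Some \<chi>" for a \<chi>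
    using that by (auto simp: inner_label_eq_Some)
  have leaf: "subtree \<tau> a \<noteq> None \<and> a \<noteq> r \<and> a \<noteq> r'" if "leaf_label \<tau> a = Some \<chi>" for a \<chi>
    using that A.leaf_not_prefix[of a \<epsilon>] B.leaf_not_prefix[of a \<epsilon>] by (auto simp: leaf_label_eq_Some)
  show ?thesis
  proof (rule tree_extI)
    show "opetope (Suc (Suc n)) ?L"
      by (rule node_subst.opetope_replace[OF second])
    show "opetope (Suc (Suc n)) ?R"
      by (rule node_subst.opetope_replace[OF S.second])
  next
    fix p \<chi>
    have "a \<noteq> r \<and> a \<noteq> r' \<and> inner_label \<tau> a = Some \<chi> \<and> p = readdr v' (readdr v r r') (readdr v r a) \<longleftrightarrow>
        a \<noteq> r' \<and> a \<noteq> r \<and> inner_label \<tau> a = Some \<chi> \<and> p = readdr v (readdr v' r' r) (readdr v' r' a)" for a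
      using commute[OF inner[of a \<chi>]] by auto
    note eq = this
    show "inner_label ?L p = Some \<chi> \<longleftrightarrow>
      inner_label ?R p = Some \<chi>"
      unfolding double_labels S.double_labels eq by blast
    show "leaf_label ?L p = Some \<chi> \<longleftrightarrow>
      leaf_label ?R p = Some \<chi>"
      unfolding double_labels S.double_labels using commute leaf by metis
  qed
qed

end

text \<open>The readdressing of \<open>\<tau>[\<chi>/e]\<close> when that of \<open>\<tau>\<close> is \<open>u\<close>.\<close>

abbreviation readdr_leaves :: "(addr \<times> addr) set \<Rightarrow> addr \<Rightarrow> (addr \<times> addr) set \<Rightarrow> (addr \<times> addr) set"
  where "readdr_leaves v r u \<equiv> (\<lambda>(l, d). (readdr v r l, d)) ` u"

text \<open>Associativity of replacement: \<chi> goes into \<tau>, which goes into \<sigma>. That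
  \<open>replace_node \<tau> e \<chi> y\<close> still fits at \<open>s\<close> is assumed here; in
  the induction it is supplied by the invariance of targets.\<close>

locale nested_subst = A: node_subst n \<sigma> s \<phi> \<tau> u + B: node_subst n \<tau> e \<beta> \<chi> y
  for n \<sigma> s \<phi> \<tau> u e \<beta> \<chi> y +
  assumes ok': "target_ok (Suc n) (replace_node \<tau> e \<chi> y) \<phi> (readdr_leaves y e u)"
begin

lemma outer: "node_subst n \<sigma> s \<phi> (replace_node \<tau> e \<chi> y) (readdr_leaves y e u)"
  by standard (fact A.tree A.node ok')+

lemma inside: "node_subst n (replace_node \<sigma> s \<tau> u) (s \<odot> e) \<beta> \<chi> y"
  by standard (use A.opetope_replace B.node B.ok in \<open>auto simp: A.inner_label_replace\<close>)

text \<open>An address through the input \<open>d\<close> of \<open>s\<close> is sent through a leaf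
  \<open>k\<close> of \<tau>, and the inner replacement moves \<open>k\<close> regardless of what
  follows it. So both moves together amount to one move along the readdressed leaves.\<close>

lemma readdr_nested:
  assumes "subtree \<sigma> a \<noteq> None" "a \<noteq> s"
  shows "readdr y (s \<odot> e) (readdr u s a) = readdr (readdr_leaves y e u) s a"
proof -
  interpret O: node_subst n \<sigma> s \<phi> "replace_node \<tau> e \<chi> y" "readdr_leaves y e u" by (rule outer)
  from assms(1) show ?thesis
  proof (cases rule: A.position)
    case self
    then show ?thesis using assms by simp
  next
    case away
    have "readdr y (s \<odot> e) a = a"
      by (rule readdr_miss) (use away in simp)
    then show ?thesis using away O.miss by metis
  next
    case (above k d z)
    have k: "leaf_label \<tau> k \<noteq> None" using A.leaf_of above(1) .
    have "readdr y (s \<odot> e) (s \<odot> (k \<odot> z)) = s \<odot> readdr y e (k \<odot> z)"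
      by (rule readdr_prefix[OF B.bij])
    moreover have "readdr y e (k \<odot> z) = readdr y e k \<odot> z"
      by (rule B.readdr_acat) (use k B.leaf_not_prefix in \<open>auto simp: leaf_label_def split: option.splits\<close>)
    moreover have "readdr (readdr_leaves y e u) s (s \<odot> sing d \<odot> z) = s \<odot> readdr y e k \<odot> z"
      by (rule O.hit) (use above(1) in force)
    ultimately show ?thesis using above by simp
  qed
qed

lemma replace_nested:
  "replace_node (replace_node \<sigma> s \<tau> u) (s \<odot> e) \<chi> y =
   replace_node \<sigma> s (replace_node \<tau> e \<chi> y) (readdr_leaves y e u)" (is "?L = ?R")
proof -
  interpret O: node_subst n \<sigma> s \<phi> "replace_node \<tau> e \<chi> y" "readdr_leaves y e u" by (rule outer)
  interpret I: node_subst n "replace_node \<sigma> s \<tau> u" "s \<odot> e" \<beta> \<chi> y by (rule inside)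
  have inner: "subtree \<sigma> a \<noteq> None" if "inner_label \<sigma> a = Some \<alpha>" for a \<alpha>
    using that by (auto simp: inner_label_eq_Some)
  have leaf: "subtree \<sigma> a \<noteq> None \<and> a \<noteq> s" if "leaf_label \<sigma> a = Some \<alpha>" for a \<alpha>
    using that A.leaf_not_prefix[of a \<epsilon>] by (auto simp: leaf_label_eq_Some)
  have 1: "readdr u s a \<noteq> s \<odot> e" if "inner_label \<sigma> a = Some \<alpha>" "a \<noteq> s" for a \<alpha>
    using A.not_in_replacement[OF inner[OF that(1)] that(2), of e] B.node by simp
  show ?thesis
  proof (rule tree_extI)
    show "opetope (Suc (Suc n)) ?L"
      by (rule I.opetope_replace)
    show "opetope (Suc (Suc n)) ?R"
      by (rule O.opetope_replace)
  next
    fix p \<alpha>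
    have "a \<noteq> s \<and> inner_label \<sigma> a = Some \<alpha> \<and> p = readdr y (s \<odot> e) (readdr u s a) \<longleftrightarrow>
        a \<noteq> s \<and> inner_label \<sigma> a = Some \<alpha> \<and> p = readdr (readdr_leaves y e u) s a" for a
      using readdr_nested[OF inner[of a \<alpha>]] by auto
    note eq = this
    have R: "readdr y (s \<odot> e) (s \<odot> b) = s \<odot> readdr y e b" for b
      by (rule readdr_prefix[OF B.bij])
    have "inner_label ?L p = Some \<alpha> \<longleftrightarrow>
        (\<exists>b. p = s \<odot> e \<odot> b \<and> inner_label \<chi> b = Some \<alpha>) \<or>
        (\<exists>b. s \<odot> b \<noteq> s \<odot> e \<and> inner_label \<tau> b = Some \<alpha> \<and> p = readdr y (s \<odot> e) (s \<odot> b)) \<or>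
        (\<exists>a. readdr u s a \<noteq> s \<odot> e \<and> a \<noteq> s \<and> inner_label \<sigma> a = Some \<alpha> \<and>
          p = readdr y (s \<odot> e) (readdr u s a))"
      unfolding I.inner_label_replace A.inner_label_replace by blast
    also have "\<dots> \<longleftrightarrow>
        (\<exists>b. p = s \<odot> e \<odot> b \<and> inner_label \<chi> b = Some \<alpha>) \<or>
        (\<exists>b. b \<noteq> e \<and> inner_label \<tau> b = Some \<alpha> \<and> p = s \<odot> readdr y e b) \<or>
        (\<exists>a. a \<noteq> s \<and> inner_label \<sigma> a = Some \<alpha> \<and> p = readdr y (s \<odot> e) (readdr u s a))"
      unfolding R acat_cancel using 1[of _ \<alpha>] by blast
    also have "\<dots> \<longleftrightarrow> inner_label ?R p = Some \<alpha>"
      unfolding O.inner_label_replace B.inner_label_replace acat_assoc eq by blast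
    finally show "inner_label ?L p = Some \<alpha> \<longleftrightarrow>
      inner_label ?R p = Some \<alpha>" .
    show "leaf_label ?L p = Some \<alpha> \<longleftrightarrow>
      leaf_label ?R p = Some \<alpha>"
      unfolding I.leaf_label_replace A.leaf_label_replace O.leaf_label_replace
      using readdr_nested leaf by metis
  qed
qed

end

section \<open>Grafting on a leaf\<close>

lemma leaf_in_tree: "leaf_label \<nu> l = Some \<phi> \<Longrightarrow> subtree \<nu> l = Some (OEdge \<phi>)"
  by (simp add: leaf_label_eq_Some)

lemma graft_labels:
  assumes l: "leaf_label \<nu> l = Some \<phi>"
  shows "inner_label (graft \<nu> l \<omega>) p = Some \<chi> \<longleftrightarrow>
      inner_label \<nu> p = Some \<chi> \<or> (\<exists>z. p = l \<odot> z \<and> inner_label \<omega> z = Some \<chi>)"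
    and "leaf_label (graft \<nu> l \<omega>) p = Some \<chi> \<longleftrightarrow>
      (p \<noteq> l \<and> leaf_label \<nu> p = Some \<chi>) \<or> (\<exists>z. p = l \<odot> z \<and> leaf_label \<omega> z = Some \<chi>)"
proof -
  have sub: "subtree \<nu> l \<noteq> None" using l by (simp add: leaf_in_tree)
  have no: "inner_label \<nu> (l \<odot> z) = None" "z \<noteq> \<epsilon> \<Longrightarrow> leaf_label \<nu> (l \<odot> z) = None" for z
    using leaf_no_extension[OF l, of z] by (auto simp: inner_label_def leaf_label_def)
  show "inner_label (graft \<nu> l \<omega>) p = Some \<chi> \<longleftrightarrow>
      inner_label \<nu> p = Some \<chi> \<or> (\<exists>z. p = l \<odot> z \<and> inner_label \<omega> z = Some \<chi>)"
    by (cases "\<exists>z. p = l \<odot> z") (auto simp: graft_def inner_label_put[OF sub] no)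
  show "leaf_label (graft \<nu> l \<omega>) p = Some \<chi> \<longleftrightarrow>
      (p \<noteq> l \<and> leaf_label \<nu> p = Some \<chi>) \<or> (\<exists>z. p = l \<odot> z \<and> leaf_label \<omega> z = Some \<chi>)"
  proof (cases "\<exists>z. p = l \<odot> z")
    case True
    then obtain z where "p = l \<odot> z" ..
    then show ?thesis using no(2)[of z] by (auto simp: graft_def leaf_label_put[OF sub])
  next
    case False
    then have "p \<noteq> l" using acat_eps(2)[of l] by metis
    with False show ?thesis by (auto simp: graft_def leaf_label_put[OF sub])
  qed
qed

lemma opetope_graft:
  assumes "opetope (Suc (Suc n)) \<nu>" "leaf_label \<nu> l = Some \<phi>" "opetope (Suc (Suc n)) \<omega>"
    "root_label (Suc (Suc n)) \<omega> \<phi>"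
  shows "opetope (Suc (Suc n)) (graft \<nu> l \<omega>)"
    and "root_label (Suc (Suc n)) \<nu> \<rho> \<Longrightarrow> root_label (Suc (Suc n)) (graft \<nu> l \<omega>) \<rho>"
  unfolding graft_def
  by (rule put_opetope[OF assms(1) leaf_in_tree[OF assms(2)] assms(3)]; use assms(4) in simp)+

lemma leaves_graft:
  assumes "leaf_label \<nu> l = Some \<phi>"
  shows "leaves (graft \<nu> l \<omega>) = leaves \<nu> - {l} \<union> (\<lambda>z. l \<odot> z) ` leaves \<omega>"
  unfolding leaves_eq dom_def using graft_labels(2)[OF assms] by auto

subsection \<open>Targets\<close>

lemma has_target_low:
  shows "\<not> has_target 0 \<omega> \<tau> w"
    and "has_target (Suc 0) \<omega> \<tau> w \<longleftrightarrow> \<omega> = OArr \<and> \<tau> = OPt \<and> w = {}"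
    and "has_target (Suc (Suc 0)) \<omega> \<tau> w \<longleftrightarrow>
      opetope (Suc (Suc 0)) \<omega> \<and> \<tau> = OArr \<and> (\<exists>l. leaves \<omega> = {l} \<and> w = {(l, \<epsilon>)})"
proof -
  show "\<not> has_target 0 \<omega> \<tau> w"
  proof
    assume "has_target 0 \<omega> \<tau> w"
    then show False by (cases rule: has_target.cases) simp_all
  qed
  show "has_target (Suc 0) \<omega> \<tau> w \<longleftrightarrow> \<omega> = OArr \<and> \<tau> = OPt \<and> w = {}"
  proof
    assume "has_target (Suc 0) \<omega> \<tau> w"
    then show "\<omega> = OArr \<and> \<tau> = OPt \<and> w = {}" by (cases rule: has_target.cases) simp_all
  qed (use target_arr in simp)
  show "has_target (Suc (Suc 0)) \<omega> \<tau> w \<longleftrightarrow>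
      opetope (Suc (Suc 0)) \<omega> \<and> \<tau> = OArr \<and> (\<exists>l. leaves \<omega> = {l} \<and> w = {(l, \<epsilon>)})"
  proof
    assume "has_target (Suc (Suc 0)) \<omega> \<tau> w"
    then show "opetope (Suc (Suc 0)) \<omega> \<and> \<tau> = OArr \<and> (\<exists>l. leaves \<omega> = {l} \<and> w = {(l, \<epsilon>)})"
      by (cases rule: has_target.cases) (simp_all add: numeral_2_eq_2)
  qed (use target_two in \<open>auto simp: numeral_2_eq_2\<close>)
qed

lemma leaves_ONode: "leaves (ONode \<psi> ts) = (\<Union>q\<in>dom ts. (\<lambda>p. sing q \<odot> p) ` leaves (the (ts q)))"
proof (rule set_eqI)
  fix p
  show "p \<in> leaves (ONode \<psi> ts) \<longleftrightarrow> p \<in> (\<Union>q\<in>dom ts. (\<lambda>p. sing q \<odot> p) ` leaves (the (ts q)))"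
  proof (cases p rule: addr_cases)
    case (cons q p')
    then show ?thesis by (cases "ts q") (auto simp: leaves_eq image_iff)
  qed (auto simp: leaves_eq)
qed

lemma leaves_OEdge [simp]: "leaves (OEdge \<phi>) = {\<epsilon>}"
  by (auto simp: leaves_eq dom_def)

text \<open>Every node of a 2-opetope is labelled \<open>OArr\<close>, which has one input, so the
  tree is linear.\<close>

lemma two_opetope_leaf: "opetope (Suc (Suc 0)) \<omega> \<Longrightarrow> \<exists>l. leaves \<omega> = {l}"
proof (induction \<omega> rule: opt.induct)
  case (ONode \<psi> ts)
  then have \<psi>: "\<psi> = OArr" by (simp add: opetope_ONode_iff opetope_low)
  with ONode.prems have dom: "dom ts = {\<epsilon>}" by (auto simp: opetope_ONode_iff)
  then obtain \<sigma> where \<sigma>: "ts \<epsilon> = Some \<sigma>" by blast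
  have "\<exists>l. leaves \<sigma> = {l}"
  proof (rule ONode.IH(2))
    show "ts \<epsilon> \<in> range ts" by (rule rangeI)
    show "\<sigma> \<in> set_option (ts \<epsilon>)" "opetope (Suc (Suc 0)) \<sigma>"
      using \<sigma> ONode.prems by (auto simp: opetope_ONode_iff)
  qed
  then show ?case by (auto simp: leaves_ONode dom \<sigma>)
qed auto

lemma has_target_corolla:
  assumes "opetope (Suc n) \<phi>"
  shows "has_target (Suc (Suc n)) (corolla \<phi>) \<phi> {(sing q, q) | q. q \<in> nodes \<phi>}"
proof (cases n)
  case 0
  with assms opetope_corolla[OF assms] show ?thesis
    by (auto simp: has_target_low opetope_low leaves_corolla)
next
  case (Suc m)
  with assms show ?thesis using target_corolla[of m \<phi>] by (simp add: numeral_3_eq_3)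
qed

text \<open>The expected readdressing when an arbitrary tree, with readdressing \<open>v\<close>, is
  grafted on \<open>l\<close>; here \<open>s\<close> is the node matched with \<open>l\<close>, and
  \<open>u\<close> the readdressing of the tree that replaces \<open>s\<close> in the target. The
  clause of \<open>has_target\<close> is the case where \<open>v\<close> belongs to a
  corolla.\<close>

abbreviation graft_graph ::
    "addr \<Rightarrow> addr \<Rightarrow> (addr \<times> addr) set \<Rightarrow> (addr \<times> addr) set \<Rightarrow> (addr \<times> addr) set \<Rightarrow> (addr \<times> addr) set"
  where "graft_graph l s v u x \<equiv>
    {(l \<odot> k, s \<odot> e) | k e. (k, e) \<in> v} \<union> {(l', readdr u s e) | l' e. (l', e) \<in> x \<and> l' \<noteq> l}"

abbreviation corolla_graph :: "opt \<Rightarrow> (addr \<times> addr) set"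
  where "corolla_graph \<psi> \<equiv> {(sing q, q) | q. q \<in> nodes \<psi>}"

lemma has_target_graft:
  assumes "opetope (Suc (Suc (Suc n))) \<nu>" "has_target (Suc (Suc (Suc n))) \<nu> \<tau> w"
    "opetope (Suc (Suc n)) \<psi>" "has_target (Suc (Suc n)) \<psi> \<phi> v"
    "leaf_label \<nu> l = Some \<phi>" "(l, r) \<in> w"
  shows "has_target (Suc (Suc (Suc n))) (graft \<nu> l (corolla \<psi>)) (replace_node \<tau> r \<psi> v)
    (graft_graph l r (corolla_graph \<psi>) v w)"
proof -
  have "has_target (n + 3) (graft \<nu> l (corolla \<psi>)) (replace_node \<tau> r \<psi> v)
        ({(l \<odot> sing q, r \<odot> q) | q. q \<in> nodes \<psi>} \<union>
         {(l', readdr v r e) | l' e. (l', e) \<in> w \<and> l' \<noteq> l})"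
    by (rule target_graft) (use assms in \<open>simp_all add: numeral_3_eq_3 leaf_label_eq_Some\<close>)
  moreover have "{(l \<odot> sing q, r \<odot> q) | q. q \<in> nodes \<psi>} = {(l \<odot> k, r \<odot> e) | k e. (k, e) \<in> corolla_graph \<psi>}"
    by auto
  ultimately show ?thesis by (simp only: numeral_3_eq_3 add_Suc_right add_0_right)
qed

text \<open>The mutual induction with trivial predicates for the other two relations. The
  implication on \<open>m\<close> keeps the dimension fixed and discards the clauses for dimensions
  1 and 2.\<close>

lemma has_target_induct_aux:
  assumes "has_target m \<omega> \<tau> w"
    "\<And>\<phi>. opetope (Suc n) \<phi> \<Longrightarrow> Q (OEdge \<phi>) (corolla \<phi>) {(\<epsilon>, \<epsilon>)}"
    "\<And>\<psi>. opetope (Suc (Suc n)) \<psi> \<Longrightarrow> Q (corolla \<psi>) \<psi> (corolla_graph \<psi>)"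
    "\<And>\<nu> \<tau> w \<psi> \<phi> v l r. opetope (Suc (Suc (Suc n))) \<nu> \<Longrightarrow> has_target (Suc (Suc (Suc n))) \<nu> \<tau> w \<Longrightarrow> Q \<nu> \<tau> w \<Longrightarrow>
      opetope (Suc (Suc n)) \<psi> \<Longrightarrow> has_target (Suc (Suc n)) \<psi> \<phi> v \<Longrightarrow> leaf_label \<nu> l = Some \<phi> \<Longrightarrow>
      (l, r) \<in> w \<Longrightarrow>
      Q (graft \<nu> l (corolla \<psi>)) (replace_node \<tau> r \<psi> v) (graft_graph l r (corolla_graph \<psi>) v w)"
  shows "m = Suc (Suc (Suc n)) \<longrightarrow> Q \<omega> \<tau> w"
proof (rule opetope_root_label_has_target.inducts(3)[where ?P1.0 = "\<lambda>_ _. True" and ?P2.0 = "\<lambda>_ _ _. True"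
      and ?P3.0 = "\<lambda>m \<omega> \<tau> w. m = Suc (Suc (Suc n)) \<longrightarrow> Q \<omega> \<tau> w", OF assms(1)])
  fix n' \<nu> \<tau> w \<psi> \<phi> v l r
  assume *: "opetope (n' + 3) \<nu>" "has_target (n' + 3) \<nu> \<tau> w" "n' + 3 = Suc (Suc (Suc n)) \<longrightarrow> Q \<nu> \<tau> w"
    "opetope (n' + 2) \<psi>" "has_target (n' + 2) \<psi> \<phi> v" "subtree \<nu> l = Some (OEdge \<phi>)" "(l, r) \<in> w"
  have eq: "{(l \<odot> sing q, r \<odot> q) | q. q \<in> nodes \<psi>} = {(l \<odot> k, r \<odot> e) | k e. (k, e) \<in> corolla_graph \<psi>}"
    by auto
  show "n' + 3 = Suc (Suc (Suc n)) \<longrightarrow> Q (graft \<nu> l (corolla \<psi>)) (replace_node \<tau> r \<psi> v)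
        ({(l \<odot> sing q, r \<odot> q) | q. q \<in> nodes \<psi>} \<union>
         {(l', readdr v r e) | l' e. (l', e) \<in> w \<and> l' \<noteq> l})"
    unfolding eq using assms(4)[of \<nu> \<tau> w \<psi> \<phi> v l r] *
    by (auto simp: numeral_3_eq_3 leaf_label_eq_Some)
next
  show "n' + 3 = Suc (Suc (Suc n)) \<longrightarrow> Q (OEdge \<phi>) (corolla \<phi>) {(\<epsilon>, \<epsilon>)}" if "opetope (n' + 1) \<phi>" for n' \<phi>
    using that assms(2) by (auto simp: numeral_3_eq_3)
  show "n' + 3 = Suc (Suc (Suc n)) \<longrightarrow> Q (corolla \<psi>) \<psi> (corolla_graph \<psi>)" if "opetope (n' + 2) \<psi>" for n' \<psi>
    using that assms(3) by (auto simp: numeral_3_eq_3)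
qed auto

text \<open>The index is one less than the dimension: \<open>target_laws_at k\<close> concerns
  opetopes of dimension \<open>k + 1\<close>, which are the node labels of trees of dimension
  \<open>k + 2\<close>.\<close>

definition target_laws_at :: "nat \<Rightarrow> bool"
  where "target_laws_at k \<longleftrightarrow>
    (\<forall>\<omega>. opetope (Suc k) \<omega> \<longrightarrow> (\<exists>\<tau> w. has_target (Suc k) \<omega> \<tau> w)) \<and>
    (\<forall>\<omega> \<tau> w \<tau>' w'. has_target (Suc k) \<omega> \<tau> w \<longrightarrow> has_target (Suc k) \<omega> \<tau>' w' \<longrightarrow> \<tau> = \<tau>' \<and> w = w') \<and>
    (\<forall>\<omega> \<tau> w. has_target (Suc k) \<omega> \<tau> w \<longrightarrow> target_ok k \<omega> \<tau> w) \<and>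
    (\<forall>\<tau> \<sigma> x r \<phi> \<psi> v. has_target (Suc k) \<tau> \<sigma> x \<longrightarrow> inner_label \<tau> r = Some \<phi> \<longrightarrow>
       has_target (Suc k) \<psi> \<phi> v \<longrightarrow>
       has_target (Suc k) (replace_node \<tau> r \<psi> v) \<sigma> (readdr_leaves v r x))"

section \<open>Unit laws of replacement, and removal of a top node\<close>

lemma replace_corolla:
  assumes "node_subst n (corolla \<phi>) \<epsilon> \<phi> \<psi> v"
  shows "replace_node (corolla \<phi>) \<epsilon> \<psi> v = \<psi>"
proof -
  interpret node_subst n "corolla \<phi>" \<epsilon> \<phi> \<psi> v by fact
  show ?thesis
  proof (rule tree_extI[OF opetope_replace tree'])
    show "inner_label (replace_node (corolla \<phi>) \<epsilon> \<psi> v) p = Some \<chi> \<longleftrightarrow> inner_label \<psi> p = Some \<chi>" for p \<chi>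
      unfolding inner_label_replace by simp
    have hit': "readdr v \<epsilon> (sing e) = k" if "(k, e) \<in> v" for k e
      using hit[OF that, of \<epsilon>] by simp
    show "leaf_label (replace_node (corolla \<phi>) \<epsilon> \<psi> v) p = Some \<chi> \<longleftrightarrow> leaf_label \<psi> p = Some \<chi>" for p \<chi>
    proof
      assume "leaf_label (replace_node (corolla \<phi>) \<epsilon> \<psi> v) p = Some \<chi>"
      then obtain e where e: "e \<in> nodes \<phi>" "p = readdr v \<epsilon> (sing e)" "\<chi> = src \<phi> e"
        by (auto simp: leaf_label_replace)
      obtain k where "(k, e) \<in> v" using bij_graphD(6)[OF bij e(1)] ..
      then show "leaf_label \<psi> p = Some \<chi>" using e hit' leaf_src by simp
    next
      assume p: "leaf_label \<psi> p = Some \<chi>"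
      then have "p \<in> leaves \<psi>" by (auto simp: leaves_eq)
      then obtain e where "(p, e) \<in> v" using bij_graphD(5)[OF bij] by blast
      then show "leaf_label (replace_node (corolla \<phi>) \<epsilon> \<psi> v) p = Some \<chi>"
        using p leaf_src[of p e] hit'[of p e] bij_graphD(2)[OF bij, of p e]
        by (auto simp: leaf_label_replace)
    qed
  qed
qed

text \<open>The leaf \<open>sing y\<close> of a corolla is matched with the input \<open>y\<close>,
  so exchanging one for the other changes no address.\<close>

lemma readdr_corolla: "readdr (corolla_graph \<psi>) r a = a"
proof (cases "\<exists>y z. y \<in> nodes \<psi> \<and> a = r \<odot> sing y \<odot> z")
  case True
  then obtain y z where "y \<in> nodes \<psi>" "a = r \<odot> sing y \<odot> z" by blast
  moreover from this have "readdr (corolla_graph \<psi>) r (r \<odot> sing y \<odot> z) = r \<odot> sing y \<odot> z"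
    by (intro readdr_hit) auto
  ultimately show ?thesis by simp
next
  case False
  show ?thesis by (rule readdr_miss) (use False in auto)
qed

lemma replace_by_corolla:
  assumes "node_subst n \<tau> r \<phi> (corolla \<phi>) (corolla_graph \<phi>)"
  shows "replace_node \<tau> r (corolla \<phi>) (corolla_graph \<phi>) = \<tau>"
proof -
  interpret node_subst n \<tau> r \<phi> "corolla \<phi>" "corolla_graph \<phi>" by fact
  show ?thesis
  proof (rule tree_extI[OF opetope_replace tree])
    show "inner_label (replace_node \<tau> r (corolla \<phi>) (corolla_graph \<phi>)) p = Some \<chi> \<longleftrightarrow> inner_label \<tau> p = Some \<chi>" for p \<chi>
      unfolding inner_label_replace readdr_corolla using node by auto
    show "leaf_label (replace_node \<tau> r (corolla \<phi>) (corolla_graph \<phi>)) p = Some \<chi> \<longleftrightarrow> leaf_label \<tau> p = Some \<chi>" for p \<chi>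
      unfolding leaf_label_replace readdr_corolla by auto
  qed
qed

lemma replace_node_put:
  assumes "subtree \<nu> l \<noteq> None"
  shows "replace_node (put \<nu> l \<omega>) l \<psi> v = put \<nu> l (replace_node \<omega> \<epsilon> \<psi> v)"
  unfolding replace_node_def put_put subtree_put_above[OF assms] by simp

text \<open>The inverse of grafting a corolla. As no node lies beyond \<open>l\<close>, its inputs
  are bare edges with labels prescribed by \<psi>, so the subtree at \<open>l\<close> is a corolla.
  The edge left behind can carry \<phi> because \<phi> is the only target of \<psi>.\<close>

lemma prune:
  assumes target_laws_at: "target_laws_at k" and tree: "opetope (Suc (Suc k)) \<omega>" and l: "inner_label \<omega> l = Some \<psi>"
    and top: "\<And>z. z \<noteq> \<epsilon> \<Longrightarrow> inner_label \<omega> (l \<odot> z) = None"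
    and \<phi>: "has_target (Suc k) \<psi> \<phi> v"
  shows "opetope (Suc (Suc k)) (put \<omega> l (OEdge \<phi>))" (is ?A)
    and "leaf_label (put \<omega> l (OEdge \<phi>)) l = Some \<phi>" (is ?B)
    and "graft (put \<omega> l (OEdge \<phi>)) l (corolla \<psi>) = \<omega>" (is ?C)
    and "inner_label (put \<omega> l (OEdge \<phi>)) p = Some \<chi> \<longleftrightarrow> inner_label \<omega> p = Some \<chi> \<and> p \<noteq> l" (is ?D)
proof -
  obtain ts where ts: "subtree \<omega> l = Some (ONode \<psi> ts)" using l by (auto simp: inner_label_eq_Some)
  then have sub: "subtree \<omega> l \<noteq> None" by simp
  have op: "opetope (Suc (Suc k)) (ONode \<psi> ts)" by (rule opetope_subtree[OF tree ts])
  have "opetope (Suc k) \<psi>" using op by (simp add: opetope_ONode_iff)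
  have un: "has_target (Suc k) \<psi> \<rho> w \<Longrightarrow> \<rho> = \<phi>" for \<rho> w
    using target_laws_at \<phi> unfolding target_laws_at_def by blast
  have "opetope k \<phi>" using target_laws_at \<phi> unfolding target_laws_at_def target_ok_def by blast
  then show ?A
    by (intro put_opetope(1)[OF tree ts]) (auto simp: root_label_ONode_iff dest: un)
  show ?B using leaf_label_put(1)[OF sub, of "OEdge \<phi>" \<epsilon>] by simp
  have "ONode \<psi> ts = corolla \<psi>"
    unfolding corolla_def
  proof (intro arg_cong2[where f = ONode] refl ext)
    fix q
    show "ts q = (if q \<in> nodes \<psi> then Some (OEdge (src \<psi> q)) else None)"
    proof (cases "ts q")
      case None
      then show ?thesis using op by (auto simp: opetope_ONode_iff)
    next
      case (Some \<sigma>)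
      then have \<sigma>: "opetope (Suc (Suc k)) \<sigma>" "root_label (Suc (Suc k)) \<sigma> (src \<psi> q)" "q \<in> nodes \<psi>"
        using op by (auto simp: opetope_ONode_iff)
      have "inner_label \<sigma> \<epsilon> = None"
        using top[of "sing q"] Some by (simp add: inner_label_acat ts)
      with \<sigma>(1) have "\<sigma> = OEdge (src \<psi> q)"
        using \<sigma>(2) by (cases rule: opetope_tree_cases) auto
      then show ?thesis using Some \<sigma> by simp
    qed
  qed
  with ts show ?C unfolding graft_def put_put by (simp add: put_subtree)
  show ?D
  proof (cases "\<exists>z. p = l \<odot> z")
    case True
    then obtain z where "p = l \<odot> z" ..
    then show ?thesis using top[of z] inner_label_put(1)[OF sub, of "OEdge \<phi>" z]
      by (cases "z = \<epsilon>") auto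
  next
    case False
    then have "p \<noteq> l" using acat_eps(2)[of l] by metis
    then show ?thesis using False by (simp add: inner_label_put(2)[OF sub])
  qed
qed

text \<open>A node address of maximal length has no node beyond it.\<close>

lemma top_node_exists:
  assumes "opetope (Suc (Suc k)) \<omega>" "nodes \<omega> \<noteq> {}"
  obtains l \<psi> where "inner_label \<omega> l = Some \<psi>" "\<And>z. z \<noteq> \<epsilon> \<Longrightarrow> inner_label \<omega> (l \<odot> z) = None"
proof -
  let ?h = "\<lambda>p. length (entries p)"
  have fin: "finite (?h ` nodes \<omega>)" "?h ` nodes \<omega> \<noteq> {}"
    using finite_nodes[OF assms(1)] assms(2) by auto
  obtain l where l: "l \<in> nodes \<omega>" "?h l = Max (?h ` nodes \<omega>)" using Max_in[OF fin] by force
  have "inner_label \<omega> (l \<odot> z) = None" if "z \<noteq> \<epsilon>" for z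
  proof (rule ccontr)
    assume "inner_label \<omega> (l \<odot> z) \<noteq> None"
    then have "l \<odot> z \<in> nodes \<omega>" using nodes_tree[OF assms(1)] by auto
    then have "?h (l \<odot> z) \<le> Max (?h ` nodes \<omega>)" by (intro Max_ge[OF fin(1)] imageI)
    then have "?h (l \<odot> z) \<le> ?h l" using l(2) by simp
    then show False using that by (simp add: addr_eq_iff)
  qed
  then show ?thesis using that l(1) nodes_tree[OF assms(1)] by blast
qed

text \<open>Induction on the number of nodes, removing a top node each time. The laws for dimension
  \<open>k + 1\<close> provide a target of its label, and this becomes the label of the leaf that
  remains.\<close>

lemma tree_graft_induct [consumes 2, case_names edge graft]:
  assumes target_laws_at: "target_laws_at k" and "opetope (Suc (Suc k)) \<omega>"
    and edge: "\<And>\<phi>. opetope k \<phi> \<Longrightarrow> Q (OEdge \<phi>)"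
    and graft: "\<And>\<nu> l \<psi> \<phi> v. opetope (Suc (Suc k)) \<nu> \<Longrightarrow> Q \<nu> \<Longrightarrow> opetope (Suc k) \<psi> \<Longrightarrow>
      has_target (Suc k) \<psi> \<phi> v \<Longrightarrow> leaf_label \<nu> l = Some \<phi> \<Longrightarrow> Q (graft \<nu> l (corolla \<psi>))"
  shows "Q \<omega>"
  using assms(2)
proof (induction "card (nodes \<omega>)" arbitrary: \<omega> rule: less_induct)
  case less
  show ?case
  proof (cases "nodes \<omega> = {}")
    case True
    from less.prems show ?thesis
    proof (cases rule: opetope_tree_cases)
      case (edge \<phi>)
      then show ?thesis using assms(3) less.prems by simp
    next
      case (node \<psi> ts)
      then have "inner_label \<omega> \<epsilon> \<noteq> None" by simp
      then show ?thesis using True nodes_tree[OF less.prems] by blast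
    qed
  next
    case False
    obtain l \<psi> where l: "inner_label \<omega> l = Some \<psi>" "\<And>z. z \<noteq> \<epsilon> \<Longrightarrow> inner_label \<omega> (l \<odot> z) = None"
      using top_node_exists[OF less.prems False] by blast
    have \<psi>: "opetope (Suc k) \<psi>" by (rule opetope_label(1)[OF less.prems l(1)])
    then obtain \<phi> v where \<phi>: "has_target (Suc k) \<psi> \<phi> v" using target_laws_at unfolding target_laws_at_def by blast
    note P = prune[OF target_laws_at less.prems l \<phi>]
    have "l \<in> nodes \<omega>" using nodes_tree[OF less.prems] l by auto
    moreover have "nodes (put \<omega> l (OEdge \<phi>)) = nodes \<omega> - {l}"
    proof (rule set_eqI)
      fix p
      have "p \<in> nodes (put \<omega> l (OEdge \<phi>)) \<longleftrightarrow> (\<exists>\<chi>. inner_label (put \<omega> l (OEdge \<phi>)) p = Some \<chi>)"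
        using nodes_tree[OF P(1)] by (simp add: dom_def)
      then show "p \<in> nodes (put \<omega> l (OEdge \<phi>)) \<longleftrightarrow> p \<in> nodes \<omega> - {l}"
        using nodes_tree[OF less.prems] by (auto simp: P(4))
    qed
    ultimately have "card (nodes (put \<omega> l (OEdge \<phi>))) < card (nodes \<omega>)"
      using card_Diff1_less[OF finite_nodes[OF less.prems], of l] by simp
    from less.hyps[OF this P(1)] show ?thesis
      using graft[OF P(1) _ \<psi> \<phi> P(2)] P(3) by simp
  qed
qed

lemma target_lawsD:
  assumes "target_laws_at k"
  shows "opetope (Suc k) \<omega> \<Longrightarrow> \<exists>\<tau> w. has_target (Suc k) \<omega> \<tau> w"
    and "has_target (Suc k) \<omega> \<tau> w \<Longrightarrow> has_target (Suc k) \<omega> \<tau>' w' \<Longrightarrow> \<tau> = \<tau>' \<and> w = w'"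
    and "has_target (Suc k) \<omega> \<tau> w \<Longrightarrow> target_ok k \<omega> \<tau> w"
    and "has_target (Suc k) \<tau> \<sigma> x \<Longrightarrow> inner_label \<tau> r = Some \<phi> \<Longrightarrow> has_target (Suc k) \<psi> \<phi> v \<Longrightarrow>
       has_target (Suc k) (replace_node \<tau> r \<psi> v) \<sigma> (readdr_leaves v r x)"
  using assms unfolding target_laws_at_def by blast+

lemma graft_graph_graft_graph:
  "graft_graph l r v0 v (graft_graph l' s' v1 v' x) =
    {(l \<odot> k, r \<odot> e) | k e. (k, e) \<in> v0} \<union>
    {(l' \<odot> k, readdr v r (s' \<odot> e)) | k e. (k, e) \<in> v1 \<and> l' \<odot> k \<noteq> l} \<union>
    {(m, readdr v r (readdr v' s' d)) | m d. (m, d) \<in> x \<and> m \<noteq> l' \<and> m \<noteq> l}"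
proof -
  have "{(m, readdr v r e) | m e. (m, e) \<in> Q \<union> R \<and> m \<noteq> l} =
      {(m, readdr v r e) | m e. (m, e) \<in> Q \<and> m \<noteq> l} \<union> {(m, readdr v r e) | m e. (m, e) \<in> R \<and> m \<noteq> l}" for Q R
    by blast
  moreover have "{(m, readdr v r e) | m e. (m, e) \<in> {(l' \<odot> k, s' \<odot> e) | k e. (k, e) \<in> v1} \<and> m \<noteq> l} =
      {(l' \<odot> k, readdr v r (s' \<odot> e)) | k e. (k, e) \<in> v1 \<and> l' \<odot> k \<noteq> l}"
    by auto
  moreover have "{(m, readdr v r e) | m e. (m, e) \<in> {(m, readdr v' s' d) | m d. (m, d) \<in> x \<and> m \<noteq> l'} \<and> m \<noteq> l} =
      {(m, readdr v r (readdr v' s' d)) | m d. (m, d) \<in> x \<and> m \<noteq> l' \<and> m \<noteq> l}"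
    by auto
  ultimately show ?thesis by (simp only: Un_assoc)
qed

section \<open>The laws of targets in dimension n + 3, given those in dimension n + 2\<close>

locale dim_step =
  fixes n
  assumes target_laws_n: "target_laws_at (Suc n)"
begin

text \<open>Three is the least dimension in which targets are computed by the clauses for edges and
  grafts.\<close>

abbreviation dim :: nat
  where "dim \<equiv> Suc (Suc (Suc n))"

lemmas ex = target_lawsD(1)[OF target_laws_n]
lemmas un = target_lawsD(2)[OF target_laws_n]
lemmas ok = target_lawsD(3)[OF target_laws_n]
lemmas su = target_lawsD(4)[OF target_laws_n]

lemma ok_opetope: "has_target (Suc (Suc n)) \<psi> \<phi> v \<Longrightarrow> opetope (Suc (Suc n)) \<psi>"
  "has_target (Suc (Suc n)) \<psi> \<phi> v \<Longrightarrow> opetope (Suc n) \<phi>"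
  using target_okD[OF ok] by blast+

lemma subst_ok:
  assumes "opetope (Suc (Suc n)) \<tau>" "inner_label \<tau> r = Some \<phi>" "has_target (Suc (Suc n)) \<psi> \<phi> v"
  shows "node_subst n \<tau> r \<phi> \<psi> v"
  by standard (use assms ok in blast)+

lemma corolla_subst:
  assumes "has_target (Suc (Suc n)) \<psi> \<phi> v"
  shows "node_subst n (corolla \<phi>) \<epsilon> \<phi> \<psi> v"
  using assms by (intro subst_ok opetope_corolla ok_opetope) auto

text \<open>A corolla is its own graft on a bare edge, and by the left unit law the graft clause
  then gives the same target and readdressing as the clause for corollas. This lets inductions treat
  corollas as grafts.\<close>

lemma has_target_graft_edge:
  assumes "has_target (Suc (Suc n)) \<psi> \<phi> v"
  shows "graft (OEdge \<phi>) \<epsilon> (corolla \<psi>) = corolla \<psi>"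
    and "replace_node (corolla \<phi>) \<epsilon> \<psi> v = \<psi>"
    and "graft_graph \<epsilon> \<epsilon> (corolla_graph \<psi>) v {(\<epsilon>, \<epsilon>)} = corolla_graph \<psi>"
  using replace_corolla[OF corolla_subst[OF assms]] by (auto simp: graft_def)

lemma target_induct [consumes 1, case_names edge graft]:
  assumes "has_target dim \<omega> \<tau> w"
    and edge: "\<And>\<phi>. opetope (Suc n) \<phi> \<Longrightarrow> Q (OEdge \<phi>) (corolla \<phi>) {(\<epsilon>, \<epsilon>)}"
    and graft: "\<And>\<nu> \<tau> w \<psi> \<phi> v l r. opetope dim \<nu> \<Longrightarrow>
      has_target dim \<nu> \<tau> w \<Longrightarrow> Q \<nu> \<tau> w \<Longrightarrow>
      opetope (Suc (Suc n)) \<psi> \<Longrightarrow> has_target (Suc (Suc n)) \<psi> \<phi> v \<Longrightarrow> leaf_label \<nu> l = Some \<phi> \<Longrightarrow>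
      (l, r) \<in> w \<Longrightarrow>
      Q (graft \<nu> l (corolla \<psi>)) (replace_node \<tau> r \<psi> v) (graft_graph l r (corolla_graph \<psi>) v w)"
  shows "Q \<omega> \<tau> w"
proof -
  have "Q (corolla \<psi>) \<psi> (corolla_graph \<psi>)" if \<psi>: "opetope (Suc (Suc n)) \<psi>" for \<psi>
  proof -
    obtain \<phi> v where \<phi>: "has_target (Suc (Suc n)) \<psi> \<phi> v" using ex[OF \<psi>] by blast
    have \<phi>': "opetope (Suc n) \<phi>" using ok_opetope(2)[OF \<phi>] .
    have "has_target dim (OEdge \<phi>) (corolla \<phi>) {(\<epsilon>, \<epsilon>)}"
      using target_edge[of n \<phi>] \<phi>' by (simp add: numeral_3_eq_3)
    from graft[OF _ this edge[OF \<phi>'] \<psi> \<phi>, of \<epsilon> \<epsilon>] \<phi>'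
    show ?thesis unfolding has_target_graft_edge[OF \<phi>] by simp
  qed
  note corolla = this
  have "dim = dim \<longrightarrow> Q \<omega> \<tau> w"
    by (rule has_target_induct_aux[where n = n and Q = Q, OF assms(1)]) (fact edge corolla graft)+
  then show ?thesis by simp
qed

lemma graft_subst_ok:
  assumes "target_ok (Suc (Suc n)) \<nu> \<tau> w" "leaf_label \<nu> l = Some \<phi>" "(l, r) \<in> w"
    "has_target (Suc (Suc n)) \<psi> \<phi> v"
  shows "node_subst n \<tau> r \<phi> \<psi> v"
proof -
  note * = target_okD(2)[OF assms(1)] target_okD(4)[OF assms(1,3)]
    bij_graphD(2)[OF target_okD(3)[OF assms(1)] assms(3)]
  then have "inner_label \<tau> r = Some \<phi>" using assms(2) by (auto simp: nodes_tree src_tree)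
  then show ?thesis using subst_ok * assms(4) by blast
qed

text \<open>In a graft, new leaves match nodes of the copy of \<psi>, and old leaves match
  readdressed nodes of \<tau>. The two kinds of nodes are disjoint by
  \<open>not_in_replacement\<close>, and each matching is injective.\<close>

lemma target_ok_step:
  assumes "has_target dim \<omega> \<tau> w"
  shows "target_ok (Suc (Suc n)) \<omega> \<tau> w"
  using assms
proof (induction rule: target_induct)
  case (edge \<phi>)
  have c: "opetope (Suc (Suc n)) (corolla \<phi>)" by (rule opetope_corolla[OF edge])
  show ?case
    unfolding target_ok_def
  proof (intro conjI allI impI)
    show "bij_graph {(\<epsilon>, \<epsilon>)} (leaves (OEdge \<phi>)) (nodes (corolla \<phi>))"
      by (rule bij_graphI) (auto simp: nodes_tree[OF c] split: if_splits)
    show "root_label dim (OEdge \<phi>) \<rho>"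
      if "has_target (Suc (Suc n)) (corolla \<phi>) \<rho> v" for \<rho> v
      using un[OF that has_target_corolla[OF edge]] by simp
  qed (use c edge in \<open>auto simp: src_tree[OF c]\<close>)
next
  case (graft \<nu> \<tau> w \<psi> \<phi> v l r)
  interpret node_subst n \<tau> r \<phi> \<psi> v
    by (rule graft_subst_ok[OF graft.IH graft.hyps(5,6) graft.hyps(4)])
  have \<nu>: "opetope dim \<nu>" "bij_graph w (leaves \<nu>) (nodes \<tau>)"
    and lab: "\<And>l e. (l, e) \<in> w \<Longrightarrow> leaf_label \<nu> l = Some (src \<tau> e)"
    and rt: "\<And>\<phi> v. has_target (Suc (Suc n)) \<tau> \<phi> v \<Longrightarrow> root_label dim \<nu> \<phi>"
    using target_okD[OF graft.IH] by blast+
  let ?\<tau> = "replace_node \<tau> r \<psi> v"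
  let ?\<omega> = "graft \<nu> l (corolla \<psi>)"
  let ?w = "graft_graph l r (corolla_graph \<psi>) v w"
  have cor: "opetope dim (corolla \<psi>)" by (rule opetope_corolla[OF graft.hyps(3)])
  have rcor: "root_label dim (corolla \<psi>) \<phi>"
    unfolding corolla_def root_label_ONode_iff using graft.hyps(4) by blast
  note op = opetope_graft[OF \<nu>(1) graft.hyps(5) cor rcor]
  have innerE: "subtree \<tau> a \<noteq> None" if "a \<in> nodes \<tau>" for a
    using that nodes_tree[OF tree] by (auto simp: inner_label_eq_Some)
  have nodes': "nodes ?\<tau> = (\<lambda>q. r \<odot> q) ` nodes \<psi> \<union> readdr v r ` (nodes \<tau> - {r})"
    unfolding nodes_tree[OF opetope_replace] nodes_tree[OF tree] nodes_tree[OF tree'] dom_def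
    by (auto simp: inner_label_replace)
  have leaves': "leaves ?\<omega> = leaves \<nu> - {l} \<union> (\<lambda>q. l \<odot> sing q) ` nodes \<psi>"
    unfolding leaves_graft[OF graft.hyps(5)] leaves_corolla by auto
  have wr: "e \<noteq> r" if "(l', e) \<in> w" "l' \<noteq> l" for l' e
    using bij_graphD(4)[OF \<nu>(2)] that graft.hyps(6) by blast
  have wn: "e \<in> nodes \<tau>" "l' \<in> leaves \<nu>" if "(l', e) \<in> w" for l' e
    using bij_graphD(2,1)[OF \<nu>(2) that] .
  have lz: "l' \<noteq> l \<odot> sing z" if "l' \<in> leaves \<nu>" for l' z
    using leaf_no_extension[OF graft.hyps(5), of "sing z"] that by (auto simp: leaves_eq leaf_label_eq_Some)
  have lz': "(l \<odot> sing z, d) \<notin> w" for z d using lz wn(2) by blast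
  have nr: "readdr v r e \<noteq> r \<odot> q" if "e \<in> nodes \<tau>" "e \<noteq> r" "q \<in> nodes \<psi>" for e q
    using not_in_replacement[OF innerE[OF that(1)] that(2), of q] that(3) nodes_tree[OF tree'] by auto
  have bij': "bij_graph ?w (leaves ?\<omega>) (nodes ?\<tau>)"
  proof (rule bij_graphI)
    show "l' \<in> leaves ?\<omega> \<and> e \<in> nodes ?\<tau>" if "(l', e) \<in> ?w" for l' e
      using that wn wr unfolding leaves' nodes' by blast
  next
    fix l' e e' assume *: "(l', e) \<in> ?w" "(l', e') \<in> ?w"
    then show "e = e'" by (auto simp: lz' dest: bij_graphD(3)[OF \<nu>(2)])
  next
    fix l1 l2 e assume *: "(l1, e) \<in> ?w" "(l2, e) \<in> ?w"
    then consider q q' where "q \<in> nodes \<psi>" "q' \<in> nodes \<psi>" "l1 = l \<odot> sing q" "e = r \<odot> q"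
        "l2 = l \<odot> sing q'" "e = r \<odot> q'"
      | q d where "q \<in> nodes \<psi>" "e = r \<odot> q" "(l2, d) \<in> w" "l2 \<noteq> l" "e = readdr v r d"
      | q d where "q \<in> nodes \<psi>" "e = r \<odot> q" "(l1, d) \<in> w" "l1 \<noteq> l" "e = readdr v r d"
      | d d' where "(l1, d) \<in> w" "l1 \<noteq> l" "e = readdr v r d" "(l2, d') \<in> w" "l2 \<noteq> l" "e = readdr v r d'"
      by blast
    then show "l1 = l2"
    proof cases
      case (2 q d)
      then show ?thesis using nr[OF wn(1)[OF 2(3)] wr[OF 2(3,4)] 2(1)] by simp
    next
      case (3 q d)
      then show ?thesis using nr[OF wn(1)[OF 3(3)] wr[OF 3(3,4)] 3(1)] by simp
    next
      case (4 d d')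
      have "d = d'"
        using readdr_inj[OF innerE[OF wn(1)[OF 4(1)]] innerE[OF wn(1)[OF 4(4)]] wr[OF 4(1,2)] wr[OF 4(4,5)]]
          4(3,6) by simp
      then show ?thesis using bij_graphD(4)[OF \<nu>(2) 4(1)] 4(4) by blast
    qed auto
  next
    fix l' assume "l' \<in> leaves ?\<omega>"
    then show "\<exists>e. (l', e) \<in> ?w"
      using bij_graphD(5)[OF \<nu>(2), of l'] unfolding leaves' by auto
  next
    fix e assume "e \<in> nodes ?\<tau>"
    then consider q where "q \<in> nodes \<psi>" "e = r \<odot> q" | d where "d \<in> nodes \<tau>" "d \<noteq> r" "e = readdr v r d"
      unfolding nodes' by blast
    then show "\<exists>l'. (l', e) \<in> ?w"
    proof cases
      case 1
      then show ?thesis by blast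
    next
      case (2 d)
      obtain l' where "(l', d) \<in> w" using bij_graphD(6)[OF \<nu>(2) 2(1)] ..
      moreover have "l' \<noteq> l" using calculation bij_graphD(3)[OF \<nu>(2)] graft.hyps(6) 2(2) by blast
      ultimately show ?thesis using 2(3) by blast
    qed
  qed
  have lab': "leaf_label ?\<omega> l' = Some (src ?\<tau> e)" if "(l', e) \<in> ?w" for l' e
  proof -
    from that consider q where "q \<in> nodes \<psi>" "l' = l \<odot> sing q" "e = r \<odot> q"
      | d where "(l', d) \<in> w" "l' \<noteq> l" "e = readdr v r d" by blast
    then show ?thesis
    proof cases
      case (1 q)
      then obtain \<chi> where \<chi>: "inner_label \<psi> q = Some \<chi>" using nodes_tree[OF tree'] by blast
      then have "inner_label ?\<tau> e = Some \<chi>" using 1 by (auto simp: inner_label_replace)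
      then show ?thesis using 1 \<chi>
        by (auto simp: graft_labels[OF graft.hyps(5)] src_tree[OF opetope_replace] src_tree[OF tree'])
    next
      case (2 d)
      obtain \<chi> where \<chi>: "inner_label \<tau> d = Some \<chi>" using wn(1)[OF 2(1)] nodes_tree[OF tree] by blast
      then have "inner_label ?\<tau> e = Some \<chi>" using 2 wr[OF 2(1,2)] by (auto simp: inner_label_replace)
      then show ?thesis using 2 \<chi> lab[OF 2(1)]
        by (auto simp: graft_labels[OF graft.hyps(5)] src_tree[OF opetope_replace] src_tree[OF tree])
    qed
  qed
  \<comment> \<open>Invariance in the dimension below: \<tau> and its replacement have the same
    target, which is a root label of \<nu> and hence of the graft.\<close>
  have rt': "root_label dim ?\<omega> \<rho>" if \<rho>: "has_target (Suc (Suc n)) ?\<tau> \<rho> x" for \<rho> x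
  proof -
    obtain \<sigma> y where \<sigma>: "has_target (Suc (Suc n)) \<tau> \<sigma> y" using ex[OF tree] by blast
    have "\<rho> = \<sigma>" using un[OF \<rho> su[OF \<sigma> node graft.hyps(4)]] by simp
    then show ?thesis using op(2) rt[OF \<sigma>] by simp
  qed
  show ?case
    unfolding target_ok_def
    by (intro conjI allI impI) (fact op(1) opetope_replace bij' | erule lab' rt')+
qed

lemma node_of:
  assumes "target_ok (Suc (Suc n)) \<nu> \<tau> w" "(l, d) \<in> w"
  shows "subtree \<tau> d \<noteq> None" "inner_label \<tau> d = leaf_label \<nu> l"
proof -
  note * = target_okD(2)[OF assms(1)] target_okD(4)[OF assms(1,2)]
    bij_graphD(2)[OF target_okD(3)[OF assms(1)] assms(2)]
  then show eq: "inner_label \<tau> d = leaf_label \<nu> l"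
    by (auto simp: nodes_tree src_tree)
  with * show "subtree \<tau> d \<noteq> None"
    by (auto simp: inner_label_def split: option.splits)
qed

lemma node_subst_corolla:
  assumes "opetope (Suc (Suc n)) \<tau>" "inner_label \<tau> r = Some \<phi>"
  shows "node_subst n \<tau> r \<phi> (corolla \<phi>) (corolla_graph \<phi>)"
  by (rule subst_ok[OF assms has_target_corolla[OF opetope_label(1)[OF assms]]])

text \<open>The tree \<psi> is built one corolla at a time. A bare edge is the right unit law; each
  further corolla replaces a node inside the tree already put at \<open>s\<close>, which is the
  situation of \<open>replace_nested\<close>.\<close>

lemma target_graft_tree:
  assumes "has_target dim \<psi> \<phi> v"
    "has_target dim \<nu> \<sigma> x" "(l, s) \<in> x" "leaf_label \<nu> l = Some \<phi>'"
    "has_target (Suc (Suc n)) \<phi> \<phi>' u"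
  shows "has_target dim (graft \<nu> l \<psi>) (replace_node \<sigma> s \<phi> u) (graft_graph l s v u x)"
  using assms(1,5)
proof (induction arbitrary: u rule: target_induct)
  case (edge \<phi>0)
  have eq: "\<phi>0 = \<phi>'" "u = corolla_graph \<phi>0"
    using un[OF edge.prems has_target_corolla[OF edge.hyps]] by auto
  have ok\<nu>: "target_ok (Suc (Suc n)) \<nu> \<sigma> x" by (rule target_ok_step[OF assms(2)])
  have "opetope (Suc (Suc n)) \<sigma>" using target_okD[OF ok\<nu>] by blast
  then have 1: "replace_node \<sigma> s (corolla \<phi>0) u = \<sigma>"
    unfolding eq using node_of(2)[OF ok\<nu> assms(3)] assms(4)
    by (intro replace_by_corolla[OF node_subst_corolla]) auto
  have 2: "graft \<nu> l (OEdge \<phi>0) = \<nu>"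
    unfolding graft_def eq by (rule put_subtree[OF leaf_in_tree[OF assms(4)]])
  have 3: "graft_graph l s {(\<epsilon>, \<epsilon>)} u x = x"
  proof -
    have "bij_graph x (leaves \<nu>) (nodes \<sigma>)" using target_okD[OF ok\<nu>] by blast
    from bij_graphD(3)[OF this _ assms(3)] have "e = s" if "(l, e) \<in> x" for e using that .
    then have "x = {(l, s)} \<union> {(l', e) | l' e. (l', e) \<in> x \<and> l' \<noteq> l}" using assms(3) by fast
    moreover have "{(l \<odot> k, s \<odot> e) | k e. (k, e) \<in> {(\<epsilon>, \<epsilon>)}} = {(l, s)}" by auto
    ultimately show ?thesis unfolding eq readdr_corolla by simp
  qed
  show ?case unfolding 1 2 3 by (rule assms(2))
next
  case (graft \<nu>' \<tau>' v' \<chi> \<beta> y k e)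
  have ok\<nu>: "target_ok (Suc (Suc n)) \<nu> \<sigma> x" by (rule target_ok_step[OF assms(2)])
  have ok\<nu>': "target_ok (Suc (Suc n)) \<nu>' \<tau>' v'" by (rule target_ok_step[OF graft.hyps(2)])
  interpret B: node_subst n \<tau>' e \<beta> \<chi> y
    by (rule graft_subst_ok[OF ok\<nu>' graft.hyps(5,6) graft.hyps(4)])
  \<comment> \<open>By invariance one dimension below, \<tau>' has the same target \<phi>' as its
    replacement, and \<open>u\<close> is the readdressing of \<tau>' with the leaves moved. This
    makes the induction hypothesis applicable.\<close>
  obtain \<phi>'' u' where u'': "has_target (Suc (Suc n)) \<tau>' \<phi>'' u'" using ex[OF B.tree] by blast
  have eq: "\<phi>' = \<phi>''" "u = readdr_leaves y e u'"
    using un[OF graft.prems su[OF u'' B.node graft.hyps(4)]] by auto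
  have u': "has_target (Suc (Suc n)) \<tau>' \<phi>' u'" using u'' eq by simp
  interpret A: node_subst n \<sigma> s \<phi>' \<tau>' u'
    by (rule graft_subst_ok[OF ok\<nu> assms(4,3) u'])
  interpret N: nested_subst n \<sigma> s \<phi>' \<tau>' u' e \<beta> \<chi> y
    by standard (use ok[OF graft.prems] eq in simp)
  note IH = graft.IH[OF u']
  have okI: "target_ok (Suc (Suc n)) (graft \<nu> l \<nu>') (replace_node \<sigma> s \<tau>' u') (graft_graph l s v' u' x)"
    by (rule target_ok_step[OF IH])
  have op: "opetope dim (graft \<nu> l \<nu>')" using target_okD[OF okI] by blast
  have lk: "leaf_label (graft \<nu> l \<nu>') (l \<odot> k) = Some \<beta>"
    using graft.hyps(5) by (auto simp: graft_labels[OF assms(4)])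
  have mem: "(l \<odot> k, s \<odot> e) \<in> graft_graph l s v' u' x" using graft.hyps(6) by blast
  note T = has_target_graft[OF op IH graft.hyps(3,4) lk mem]
  have 1: "graft (graft \<nu> l \<nu>') (l \<odot> k) (corolla \<chi>) = graft \<nu> l (graft \<nu>' k (corolla \<chi>))"
  proof -
    have "subtree (put \<nu> l \<nu>') l = Some \<nu>'"
      using subtree_put_above[of \<nu> l \<nu>' \<epsilon>] leaf_in_tree[OF assms(4)] by simp
    then show ?thesis unfolding graft_def by (simp add: put_acat put_put)
  qed
  have 2: "graft_graph (l \<odot> k) (s \<odot> e) (corolla_graph \<chi>) y (graft_graph l s v' u' x) =
    graft_graph l s (graft_graph k e (corolla_graph \<chi>) y v') u x"
  proof -
    have xs: "d \<noteq> s" if "(l', d) \<in> x" "l' \<noteq> l" for l' d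
    proof -
      show ?thesis using bij_graphD(4)[OF target_okD(3)[OF ok\<nu>] that(1)] that(2) assms(3) by blast
    qed
    have nest: "readdr y (s \<odot> e) (readdr u' s d) = readdr u s d" if "(l', d) \<in> x" "l' \<noteq> l" for l' d
      unfolding eq by (rule N.readdr_nested[OF node_of(1)[OF ok\<nu> that(1)] xs[OF that]])
    have pre: "readdr y (s \<odot> e) (s \<odot> b) = s \<odot> readdr y e b" for b
      by (rule readdr_prefix[OF B.bij])
    have lx: "l' \<noteq> l \<odot> k" if "(l', d) \<in> x" "l' \<noteq> l" for l' d
    proof -
      have "leaf_label \<nu> l' \<noteq> None" using target_okD(4)[OF ok\<nu> that(1)] by simp
      then show ?thesis
        using leaf_no_extension[OF assms(4), of k] that(2) by (auto simp: leaf_label_eq_Some split: if_splits)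
    qed
    have "{(l \<odot> k', s \<odot> e') | k' e'. (k', e') \<in> graft_graph k e (corolla_graph \<chi>) y v'} =
        {(l \<odot> k \<odot> k', s \<odot> e \<odot> e') | k' e'. (k', e') \<in> corolla_graph \<chi>} \<union>
        {(l \<odot> k', s \<odot> readdr y e e') | k' e'. (k', e') \<in> v' \<and> k' \<noteq> k}" by force
    moreover have "z = (l', readdr y (s \<odot> e) (readdr u' s d)) \<and> (l', d) \<in> x \<and> l' \<noteq> l \<and> l' \<noteq> l \<odot> k \<longleftrightarrow>
        z = (l', readdr u s d) \<and> (l', d) \<in> x \<and> l' \<noteq> l" for z l' d
      using nest[of l' d] lx[of l' d] by auto
    ultimately show ?thesis
      unfolding graft_graph_graft_graph pre acat_cancel by (simp only: Un_assoc)
  qed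
  show ?case
    using T unfolding 1 N.replace_nested 2 eq(2)[symmetric] .
qed

end

lemma graft_graph_corolla:
  "graft_graph l s (corolla_graph \<psi>) u x =
    {(l \<odot> sing q, s \<odot> q) | q. q \<in> nodes \<psi>} \<union> {(l', readdr u s e) | l' e. (l', e) \<in> x \<and> l' \<noteq> l}"
  by auto

lemma readdr_leaves_graft_graph:
  "readdr_leaves v r (graft_graph l s (corolla_graph \<chi>) u x) =
    {(readdr v r (l \<odot> sing q), s \<odot> q) | q. q \<in> nodes \<chi>} \<union>
    {(readdr v r l', readdr u s d) | l' d. (l', d) \<in> x \<and> l' \<noteq> l}"
proof -
  have "readdr_leaves v r {(l \<odot> sing q, s \<odot> q) | q. q \<in> nodes \<chi>} =
      {(readdr v r (l \<odot> sing q), s \<odot> q) | q. q \<in> nodes \<chi>}" by force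
  moreover have "readdr_leaves v r {(l', readdr u s d) | l' d. (l', d) \<in> x \<and> l' \<noteq> l} =
      {(readdr v r l', readdr u s d) | l' d. (l', d) \<in> x \<and> l' \<noteq> l}" by force
  ultimately show ?thesis unfolding graft_graph_corolla image_Un by simp
qed

text \<open>The first hypothesis is the rigid motion of \<open>new_position\<close>. It brings the
  double graft into a form that is symmetric up to the order of the two readdressings.\<close>

lemma graft_graph_twice:
  assumes "\<And>q. q \<in> nodes \<psi>' \<Longrightarrow> readdr v r (s' \<odot> q) = r' \<odot> q" "\<And>z. l \<noteq> l' \<odot> z"
  shows "graft_graph l r (corolla_graph \<psi>) v (graft_graph l' s' (corolla_graph \<psi>') v' x) =
    {(l \<odot> sing q, r \<odot> q) | q. q \<in> nodes \<psi>} \<union> {(l' \<odot> sing q, r' \<odot> q) | q. q \<in> nodes \<psi>'} \<union>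
    {(m, readdr v r (readdr v' s' d)) | m d. (m, d) \<in> x \<and> m \<noteq> l' \<and> m \<noteq> l}"
proof -
  have "{(l' \<odot> k, readdr v r (s' \<odot> e)) | k e. (k, e) \<in> corolla_graph \<psi>' \<and> l' \<odot> k \<noteq> l} =
      {(l' \<odot> sing q, r' \<odot> q) | q. q \<in> nodes \<psi>'}"
    by (rule set_eqI) (auto simp: assms(1) assms(2)[symmetric])
  moreover have "{(l \<odot> k, r \<odot> e) | k e. (k, e) \<in> corolla_graph \<psi>} = {(l \<odot> sing q, r \<odot> q) | q. q \<in> nodes \<psi>}"
    by auto
  ultimately show ?thesis unfolding graft_graph_graft_graph by simp
qed

lemma node_in_leaf_or_tree:
  assumes "leaf_label \<nu> l = Some \<phi>'" "inner_label \<nu> a = Some \<chi> \<or> leaf_label \<nu> a = Some \<chi>" "a \<noteq> l"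
  shows "a \<noteq> l \<odot> c"
  using leaf_no_extension[OF assms(1), of c] assms(2,3)
  by (auto simp: inner_label_eq_Some leaf_label_eq_Some split: if_splits)

lemma unprune:
  assumes "leaf_label \<nu> l = Some \<phi>"
  shows "put (graft \<nu> l \<omega>) l (OEdge \<phi>) = \<nu>"
  unfolding graft_def put_put by (rule put_subtree[OF leaf_in_tree[OF assms]])

lemma graft_corolla_top:
  assumes "leaf_label \<nu> l = Some \<phi>" "z \<noteq> \<epsilon>"
  shows "inner_label (graft \<nu> l (corolla \<psi>)) (l \<odot> z) = None"
proof (cases "inner_label (graft \<nu> l (corolla \<psi>)) (l \<odot> z)")
  case (Some \<chi>)
  then have "inner_label \<nu> (l \<odot> z) = Some \<chi>"
    using assms(2) by (auto simp: graft_labels(1)[OF assms(1)] split: if_splits)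
  then show ?thesis using leaf_not_below[OF assms(1)] by blast
qed

lemma graft_corolla_inner:
  assumes "leaf_label \<nu> l = Some \<phi>"
  shows "inner_label \<nu> p = Some \<chi> \<longleftrightarrow> inner_label (graft \<nu> l (corolla \<psi>)) p = Some \<chi> \<and> p \<noteq> l"
    and "inner_label (graft \<nu> l (corolla \<psi>)) l = Some \<psi>"
proof -
  have "inner_label \<nu> l = None"
    using leaf_in_tree[OF assms] by (simp add: inner_label_def)
  then show "inner_label \<nu> p = Some \<chi> \<longleftrightarrow> inner_label (graft \<nu> l (corolla \<psi>)) p = Some \<chi> \<and> p \<noteq> l"
    by (auto simp: graft_labels(1)[OF assms] split: if_splits)
  show "inner_label (graft \<nu> l (corolla \<psi>)) l = Some \<psi>"
    by (auto simp: graft_labels(1)[OF assms])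
qed

context dim_step
begin

text \<open>Induction on the construction of \<tau>. If the replaced node is the one grafted last,
  the whole tree \<psi> is grafted in its place and \<open>target_graft_tree\<close> applies;
  otherwise the replacement takes place in \<nu>, and the graft is redone on the readdressed
  leaf.\<close>

lemma replace_target_step:
  assumes "has_target dim \<tau> \<sigma> x" "inner_label \<tau> r = Some \<phi>"
    "has_target dim \<psi> \<phi> v"
  shows "has_target dim (replace_node \<tau> r \<psi> v) \<sigma> (readdr_leaves v r x)"
  using assms(1,2)
proof (induction rule: target_induct)
  case edge
  then show ?case by simp
next
  case (graft \<nu> \<sigma> x \<chi> \<phi>' u l s)
  let ?\<tau> = "graft \<nu> l (corolla \<chi>)"
  note ok\<nu> = target_ok_step[OF graft.hyps(2)]
  note T = has_target_graft[OF graft.hyps]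
  have op: "opetope dim ?\<tau>" by (rule target_okD(1)[OF target_ok_step[OF T]])
  note ok\<psi> = target_ok_step[OF assms(3)]
  interpret R: node_subst "Suc n" ?\<tau> r \<phi> \<psi> v
    by standard (fact op graft.prems ok\<psi>)+
  note lab = graft_labels[OF graft.hyps(5)]
  have sub: "subtree \<nu> l \<noteq> None" using leaf_in_tree[OF graft.hyps(5)] by simp
  show ?case
  proof (cases "r = l")
    case True
    have "\<phi> = \<chi>"
      using graft.prems lab(1)[of "corolla \<chi>" l \<phi>] leaf_not_below[OF graft.hyps(5), of l _ \<epsilon>] True by auto
    then have \<psi>: "has_target dim \<psi> \<chi> v" using assms(3) by simp
    have ok\<psi>': "target_ok (Suc (Suc n)) \<psi> \<chi> v" by (rule target_ok_step[OF \<psi>])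
    have c: "node_subst (Suc n) (corolla \<chi>) \<epsilon> \<chi> \<psi> v"
      by standard (use opetope_corolla[OF graft.hyps(3)] ok\<psi>' in auto)
    have 1: "replace_node ?\<tau> r \<psi> v = graft \<nu> l \<psi>"
      unfolding True graft_def replace_node_put[OF sub] replace_corolla[OF c] ..
    have bij: "bij_graph v (leaves \<psi>) (nodes \<chi>)" by (rule target_okD(3)[OF ok\<psi>'])
    have hit: "readdr v l (l \<odot> sing q) = l \<odot> k" if "(k, q) \<in> v" for k q
      using R.hit[OF that, of \<epsilon>] True by simp
    have miss: "readdr v l l' = l'" if "(l', d) \<in> x" "l' \<noteq> l" for l' d
    proof (rule readdr_miss)
      show "l' \<noteq> l \<odot> sing e \<odot> z" for k e z
        using node_in_leaf_or_tree[OF graft.hyps(5) disjI2[OF target_okD(4)[OF ok\<nu> that(1)]] that(2)]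
        by simp
    qed
    have 2: "readdr_leaves v r (graft_graph l s (corolla_graph \<chi>) u x) = graft_graph l s v u x"
    proof -
      have "{(readdr v l (l \<odot> sing q), s \<odot> q) | q. q \<in> nodes \<chi>} = {(l \<odot> k, s \<odot> q) | k q. (k, q) \<in> v}"
        using hit bij_graphD(2,6)[OF bij] by fastforce
      moreover have "z = (readdr v l l', readdr u s d) \<and> (l', d) \<in> x \<and> l' \<noteq> l \<longleftrightarrow>
          z = (l', readdr u s d) \<and> (l', d) \<in> x \<and> l' \<noteq> l" for z l' d
        using miss[of l' d] by auto
      ultimately show ?thesis unfolding True readdr_leaves_graft_graph by simp
    qed
    show ?thesis
      unfolding 1 2 by (rule target_graft_tree[OF \<psi> graft.hyps(2,6,5,4)])
  next
    case False
    have r: "inner_label \<nu> r = Some \<phi>"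
      using graft.prems lab(1)[of "corolla \<chi>" r \<phi>] False by (auto split: if_splits)
    interpret A: node_subst "Suc n" \<nu> r \<phi> \<psi> v
      by standard (fact graft.hyps(1) r ok\<psi>)+
    let ?l = "readdr v r l"
    have l': "leaf_label (replace_node \<nu> r \<psi> v) ?l = Some \<phi>'"
      using graft.hyps(5) by (auto simp: A.leaf_label_replace)
    have mem: "(?l, s) \<in> readdr_leaves v r x" using graft.hyps(6) by force
    note T' = has_target_graft[OF A.opetope_replace graft.IH[OF r] graft.hyps(3,4) l' mem]
    \<comment> \<open>Everything beyond the leaf \<open>l\<close> of \<nu> moves along with it,
      since the node \<open>r\<close> cannot lie beyond a leaf.\<close>
    have ext: "readdr v r (l \<odot> z) = ?l \<odot> z" for z
      by (rule A.readdr_acat[OF sub]) (use A.leaf_not_prefix[of l] graft.hyps(5) in simp)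
    have in\<nu>: "subtree \<nu> a \<noteq> None" if "leaf_label \<nu> a = Some \<alpha>" for a \<alpha>
      using leaf_in_tree[OF that] by simp
    have neq: "a \<noteq> r" if "leaf_label \<nu> a = Some \<alpha>" for a \<alpha>
      using A.leaf_not_prefix[of a \<epsilon>] that by auto
    have inj: "readdr v r a = ?l \<longleftrightarrow> a = l" if "leaf_label \<nu> a = Some \<alpha>" for a \<alpha>
      using A.readdr_inj[OF in\<nu>[OF that] sub neq[OF that] neq[OF graft.hyps(5)]] by blast
    have 1: "graft (replace_node \<nu> r \<psi> v) ?l (corolla \<chi>) = replace_node ?\<tau> r \<psi> v"
    proof (rule tree_extI[OF _ R.opetope_replace])
      show "opetope dim (graft (replace_node \<nu> r \<psi> v) ?l (corolla \<chi>))"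
        by (rule target_okD(1)[OF target_ok_step[OF T']])
      fix p \<alpha>
      show "inner_label (graft (replace_node \<nu> r \<psi> v) ?l (corolla \<chi>)) p = Some \<alpha> \<longleftrightarrow>
          inner_label (replace_node ?\<tau> r \<psi> v) p = Some \<alpha>"
        unfolding graft_labels[OF l'] A.inner_label_replace R.inner_label_replace lab
        using False by (auto split: if_splits)
      have "leaf_label (replace_node ?\<tau> r \<psi> v) p = Some \<alpha> \<longleftrightarrow>
          (\<exists>a. a \<noteq> l \<and> leaf_label \<nu> a = Some \<alpha> \<and> p = readdr v r a) \<or>
          (\<exists>z. leaf_label (corolla \<chi>) z = Some \<alpha> \<and> p = readdr v r (l \<odot> z))"
        unfolding R.leaf_label_replace lab by blast
      also have "\<dots> \<longleftrightarrow>
          (\<exists>a. readdr v r a \<noteq> ?l \<and> leaf_label \<nu> a = Some \<alpha> \<and> p = readdr v r a) \<or>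
          (\<exists>z. leaf_label (corolla \<chi>) z = Some \<alpha> \<and> p = ?l \<odot> z)"
        unfolding ext using inj by blast
      also have "\<dots> \<longleftrightarrow> leaf_label (graft (replace_node \<nu> r \<psi> v) ?l (corolla \<chi>)) p = Some \<alpha>"
        unfolding graft_labels[OF l'] A.leaf_label_replace by (auto simp del: corolla_labels)
      finally show "leaf_label (graft (replace_node \<nu> r \<psi> v) ?l (corolla \<chi>)) p = Some \<alpha> \<longleftrightarrow>
          leaf_label (replace_node ?\<tau> r \<psi> v) p = Some \<alpha>" by blast
    qed
    have inj': "readdr v r a \<noteq> ?l" if "(a, d) \<in> x" "a \<noteq> l" for a d
      using inj[OF target_okD(4)[OF ok\<nu> that(1)]] that(2) by blast
    have 2: "graft_graph ?l s (corolla_graph \<chi>) u (readdr_leaves v r x) =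
      readdr_leaves v r (graft_graph l s (corolla_graph \<chi>) u x)"
    proof -
      have "{(m, readdr u s d) | m d. (m, d) \<in> readdr_leaves v r x \<and> m \<noteq> ?l} =
          {(readdr v r l', readdr u s d) | l' d. (l', d) \<in> x \<and> readdr v r l' \<noteq> ?l}" by force
      moreover have "(l', d) \<in> x \<and> readdr v r l' \<noteq> ?l \<longleftrightarrow> (l', d) \<in> x \<and> l' \<noteq> l" for l' d
        using inj' by blast
      ultimately show ?thesis unfolding readdr_leaves_graft_graph unfolding graft_graph_corolla ext by simp
    qed
    show ?thesis using T' unfolding 1 2 .
  qed
qed

lemma target_exists_step:
  assumes "opetope dim \<omega>"
  shows "\<exists>\<tau> w. has_target dim \<omega> \<tau> w"
  using target_laws_n assms
proof (induction rule: tree_graft_induct)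
  case (edge \<phi>)
  then show ?case using target_edge[of n \<phi>] by (auto simp: numeral_3_eq_3)
next
  case (graft \<nu> l \<psi> \<phi> v)
  then obtain \<tau> w where T: "has_target dim \<nu> \<tau> w" by blast
  have "l \<in> leaves \<nu>" using graft.hyps by (auto simp: leaves_eq)
  then obtain r where "(l, r) \<in> w"
    using bij_graphD(5)[OF target_okD(3)[OF target_ok_step[OF T]]] by blast
  from has_target_graft[OF graft.hyps(1) T graft.hyps(2,3,4) this] show ?case by blast
qed

lemma target_cases [consumes 1, case_names edge graft]:
  assumes "has_target dim \<omega> \<tau> w"
  obtains \<phi> where "\<omega> = OEdge \<phi>" "\<tau> = corolla \<phi>" "w = {(\<epsilon>, \<epsilon>)}"
  | \<nu> \<tau>' w' \<psi> \<phi> v l r where "opetope dim \<nu>" "has_target dim \<nu> \<tau>' w'"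
    "opetope (Suc (Suc n)) \<psi>" "has_target (Suc (Suc n)) \<psi> \<phi> v" "leaf_label \<nu> l = Some \<phi>" "(l, r) \<in> w'"
    "\<omega> = graft \<nu> l (corolla \<psi>)" "\<tau> = replace_node \<tau>' r \<psi> v"
    "w = graft_graph l r (corolla_graph \<psi>) v w'"
proof -
  have "(\<exists>\<phi>. \<omega> = OEdge \<phi> \<and> \<tau> = corolla \<phi> \<and> w = {(\<epsilon>, \<epsilon>)}) \<or>
    (\<exists>\<nu> \<tau>' w' \<psi> \<phi> v l r. opetope dim \<nu> \<and> has_target dim \<nu> \<tau>' w' \<and>
    opetope (Suc (Suc n)) \<psi> \<and> has_target (Suc (Suc n)) \<psi> \<phi> v \<and> leaf_label \<nu> l = Some \<phi> \<and> (l, r) \<in> w' \<and>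
    \<omega> = graft \<nu> l (corolla \<psi>) \<and> \<tau> = replace_node \<tau>' r \<psi> v \<and>
    w = graft_graph l r (corolla_graph \<psi>) v w')"
    using assms
  proof (induction rule: target_induct)
    case (graft \<nu> \<tau> w \<psi> \<phi> v l r)
    show ?case
      by (rule disjI2) (intro exI conjI; (fact graft.hyps | rule refl))
  qed simp
  then show ?thesis using that by (elim disjE exE conjE) 
qed

text \<open>Two top nodes \<open>l \<noteq> l'\<close> of \<open>\<omega>\<close> can be removed in either order, and the two ways of computing
  the target of \<open>\<omega>\<close> from that of the common remainder agree because replacements at distinct nodes
  commute.\<close>

lemma target_unique_step:
  assumes "has_target dim \<omega> \<tau>1 w1" "has_target dim \<omega> \<tau>2 w2"
  shows "\<tau>1 = \<tau>2 \<and> w1 = w2"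
  using assms
proof (induction "card (nodes \<omega>)" arbitrary: \<omega> \<tau>1 w1 \<tau>2 w2 rule: less_induct)
  case less
  have tree: "opetope dim \<omega>" by (rule target_okD(1)[OF target_ok_step[OF less.prems(1)]])
  from less.prems(1) show ?case
  proof (cases rule: target_cases)
    case (edge \<phi>)
    from less.prems(2) show ?thesis
    proof (cases rule: target_cases)
      case edge': (edge \<phi>')
      then show ?thesis using edge by simp
    next
      case (graft \<nu> \<tau>' w' \<psi> \<phi>' v l r)
      have "inner_label (OEdge \<phi>) l = Some \<psi>"
        using graft_corolla_inner(2)[OF graft(5)] graft(7) edge(1) by metis
      then show ?thesis by simp
    qed
  next
    case (graft \<nu>1 \<sigma>1 x1 \<psi> \<phi> v l r)
    note G1 = graft
    from less.prems(2) show ?thesis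
    proof (cases rule: target_cases)
      case (edge \<phi>')
      have "inner_label (OEdge \<phi>') l = Some \<psi>"
        using graft_corolla_inner(2)[OF G1(5)] G1(7) edge(1) by metis
      then show ?thesis by simp
    next
      case (graft \<nu>2 \<sigma>2 x2 \<psi>' \<phi>' v' l' r')
      note G2 = graft
      have in1: "inner_label \<nu>1 p = Some \<chi> \<longleftrightarrow> inner_label \<omega> p = Some \<chi> \<and> p \<noteq> l" for p \<chi>
        unfolding G1(7) by (rule graft_corolla_inner(1)[OF G1(5)])
      have in2: "inner_label \<nu>2 p = Some \<chi> \<longleftrightarrow> inner_label \<omega> p = Some \<chi> \<and> p \<noteq> l'" for p \<chi>
        unfolding G2(7) by (rule graft_corolla_inner(1)[OF G2(5)])
      have at1: "inner_label \<omega> l = Some \<psi>" and at2: "inner_label \<omega> l' = Some \<psi>'"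
        using graft_corolla_inner(2)[OF G1(5), of \<psi>] graft_corolla_inner(2)[OF G2(5), of \<psi>']
        unfolding G1(7)[symmetric] G2(7)[symmetric] by simp_all
      have top1: "inner_label \<omega> (l \<odot> z) = None" and top2: "inner_label \<omega> (l' \<odot> z) = None" if "z \<noteq> \<epsilon>" for z
        using graft_corolla_top[OF G1(5) that, of \<psi>] graft_corolla_top[OF G2(5) that, of \<psi>']
        unfolding G1(7)[symmetric] G2(7)[symmetric] by simp_all
      have mem: "l \<in> nodes \<omega>" "l' \<in> nodes \<omega>" using nodes_tree[OF tree] at1 at2 by auto
      have "nodes \<nu>1 = nodes \<omega> - {l}"
        unfolding nodes_tree[OF tree] nodes_tree[OF G1(1)] using in1 by (auto simp: dom_def)
      then have card1: "card (nodes \<nu>1) < card (nodes \<omega>)"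
        using card_Diff1_less[OF finite_nodes[OF tree] mem(1)] by simp
      have "nodes \<nu>2 = nodes \<omega> - {l'}"
        unfolding nodes_tree[OF tree] nodes_tree[OF G2(1)] using in2 by (auto simp: dom_def)
      then have card2: "card (nodes \<nu>2) < card (nodes \<omega>)"
        using card_Diff1_less[OF finite_nodes[OF tree] mem(2)] by simp
      show ?thesis
      proof (cases "l = l'")
        case True
        then have \<psi>: "\<psi> = \<psi>'" using at1 at2 by simp
        have v: "\<phi> = \<phi>' \<and> v = v'" using un[OF G1(4)] G2(4) \<psi> by blast
        have "\<nu>1 = \<nu>2" using unprune[OF G1(5), of "corolla \<psi>"] unprune[OF G2(5), of "corolla \<psi>'"] True v G1(7) G2(7) by simp
        then have \<sigma>: "\<sigma>1 = \<sigma>2 \<and> x1 = x2" using less.hyps[OF card1 G1(2)] G2(2) by blast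
        have "r = r'"
          using bij_graphD(3)[OF target_okD(3)[OF target_ok_step[OF G1(2)]] G1(6)] G2(6) \<sigma> True by blast
        then show ?thesis using G1(8,9) G2(8,9) True \<psi> v \<sigma> by simp
      next
        case False
        have l'1: "inner_label \<nu>1 l' = Some \<psi>'" using in1 at2 False by simp
        have top1': "inner_label \<nu>1 (l' \<odot> z) = None" if "z \<noteq> \<epsilon>" for z
          using in1[of "l' \<odot> z"] top2[OF that] by (cases "inner_label \<nu>1 (l' \<odot> z)") auto
        \<comment> \<open>The common remainder, with both top nodes removed. One graft on it gives a
          target of \<nu>1, another a target of \<nu>2; as both trees have fewer nodes than
          \<omega>, the induction hypothesis identifies these with the given ones.\<close>
        define \<nu> where "\<nu> = put \<nu>1 l' (OEdge \<phi>')"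
        note P = prune[OF target_laws_n G1(1) l'1 top1' G2(4), folded \<nu>_def]
        have notbelow: "l \<noteq> l' \<odot> z" "l' \<noteq> l \<odot> z" for z
          using top1[of z] top2[of z] at1 at2 False by (cases "z = \<epsilon>"; auto)+
        have leaf: "leaf_label \<nu> l = Some \<phi>"
          unfolding \<nu>_def using leaf_label_put(2)[of \<nu>1 l' l] l'1 notbelow(1) G1(5)
          by (auto simp: inner_label_eq_Some)
        obtain \<sigma> x where \<sigma>: "has_target dim \<nu> \<sigma> x" using target_exists_step[OF P(1)] by blast
        note ok\<nu> = target_ok_step[OF \<sigma>]
        note bij = target_okD(3)[OF ok\<nu>]
        obtain s where s: "(l, s) \<in> x"
          using bij_graphD(5)[OF bij, of l] leaf by (auto simp: leaves_eq)
        obtain s' where s': "(l', s') \<in> x"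
          using bij_graphD(5)[OF bij, of l'] P(2) by (auto simp: leaves_eq)
        have ss': "s \<noteq> s'" using bij_graphD(4)[OF bij s] s' False by blast
        have \<nu>1: "\<nu>1 = graft \<nu> l' (corolla \<psi>')" using P(3) by simp
        note T1 = has_target_graft[OF P(1) \<sigma> G2(3,4) P(2) s', folded \<nu>1]
        \<comment> \<open>Comparing node labels suffices: \<nu>2 contains the node \<open>l\<close>,
          hence is no bare edge.\<close>
        have \<nu>2: "\<nu>2 = graft \<nu> l (corolla \<psi>)"
        proof (rule tree_ext[OF G2(1)])
          show "opetope dim (graft \<nu> l (corolla \<psi>))"
            by (rule target_okD(1)[OF target_ok_step[OF has_target_graft[OF P(1) \<sigma> G1(3,4) leaf s]]])
          show "inner_label \<nu>2 = inner_label (graft \<nu> l (corolla \<psi>))"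
          proof
            fix p
            have "inner_label \<nu>2 p = Some \<chi> \<longleftrightarrow> inner_label (graft \<nu> l (corolla \<psi>)) p = Some \<chi>" for \<chi>
              using in1[of p \<chi>] in2[of p \<chi>] P(4)[of p \<chi>] at1 False
                graft_labels(1)[OF leaf, of "corolla \<psi>" p \<chi>] by (auto split: if_splits)
            then show "inner_label \<nu>2 p = inner_label (graft \<nu> l (corolla \<psi>)) p"
              by (metis not_None_eq)
          qed
          show "\<alpha> = \<beta>" if "\<nu>2 = OEdge \<alpha>" for \<alpha> \<beta>
            using in2[of l \<psi>] at1 False that by simp
        qed
        note T2 = has_target_graft[OF P(1) \<sigma> G1(3,4) leaf s, folded \<nu>2]
        interpret A: node_pair n \<sigma> s \<phi> \<psi> v s' \<phi>' \<psi>' v'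
          using graft_subst_ok[OF ok\<nu> leaf s G1(4)] graft_subst_ok[OF ok\<nu> P(2) s' G2(4)] ss'
          by (simp add: node_pair_def node_pair_axioms_def)
        interpret B: node_pair n \<sigma> s' \<phi>' \<psi>' v' s \<phi> \<psi> v
          using A.node_pair_axioms by (rule node_pair_swap)
        have \<sigma>1: "\<sigma>1 = replace_node \<sigma> s' \<psi>' v'" "x1 = graft_graph l' s' (corolla_graph \<psi>') v' x"
          using less.hyps[OF card1 G1(2) T1] by blast+
        have \<sigma>2: "\<sigma>2 = replace_node \<sigma> s \<psi> v" "x2 = graft_graph l s (corolla_graph \<psi>) v x"
          using less.hyps[OF card2 G2(2) T2] by blast+
        \<comment> \<open>In the target of \<nu>1, the node matched with \<open>l\<close> is
          \<open>s\<close> as moved by the replacement at \<open>s'\<close>. This brings both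
          targets of \<omega> into the form of \<open>replace_commute\<close>.\<close>
        have "(l, readdr v' s' s) \<in> x1" unfolding \<sigma>1 using s False by blast
        then have r: "r = readdr v' s' s"
          using bij_graphD(3)[OF target_okD(3)[OF target_ok_step[OF G1(2)]] G1(6)] by blast
        have "(l', readdr v s s') \<in> x2" unfolding \<sigma>2 using s' False by blast
        then have r': "r' = readdr v s s'"
          using bij_graphD(3)[OF target_okD(3)[OF target_ok_step[OF G2(2)]] G2(6)] by blast
        have "\<tau>1 = \<tau>2" unfolding G1(8) G2(8) \<sigma>1 \<sigma>2 r r' by (rule B.replace_commute)
        moreover have "w1 = w2"
        proof -
          have ne: "d \<noteq> s \<and> d \<noteq> s'" if "(m, d) \<in> x" "m \<noteq> l" "m \<noteq> l'" for m d
            using bij_graphD(4)[OF bij that(1)] s s' that by blast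
          have com: "readdr v r (readdr v' s' d) = readdr v' r' (readdr v s d)"
            if "(m, d) \<in> x" "m \<noteq> l" "m \<noteq> l'" for m d
            unfolding r r' using B.commute[OF node_of(1)[OF ok\<nu> that(1)]] ne[OF that] by blast
          have innerE: "inner_label \<psi> q \<noteq> None" if "q \<in> nodes \<psi>" for q
            using that nodes_tree[OF G1(3)] by auto
          have innerE': "inner_label \<psi>' q \<noteq> None" if "q \<in> nodes \<psi>'" for q
            using that nodes_tree[OF G2(3)] by auto
          have new: "readdr v' r' (s \<odot> q) = r \<odot> q" if "q \<in> nodes \<psi>" for q
            unfolding r r' by (rule A.new_position[OF innerE[OF that]])
          have new': "readdr v r (s' \<odot> q) = r' \<odot> q" if "q \<in> nodes \<psi>'" for q
            unfolding r r' by (rule B.new_position[OF innerE'[OF that]])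
          have w1: "w1 = {(l \<odot> sing q, r \<odot> q) | q. q \<in> nodes \<psi>} \<union> {(l' \<odot> sing q, r' \<odot> q) | q. q \<in> nodes \<psi>'} \<union>
            {(m, readdr v r (readdr v' s' d)) | m d. (m, d) \<in> x \<and> m \<noteq> l' \<and> m \<noteq> l}"
            unfolding G1(9) \<sigma>1(2) by (rule graft_graph_twice[OF new' notbelow(1)])
          have w2: "w2 = {(l' \<odot> sing q, r' \<odot> q) | q. q \<in> nodes \<psi>'} \<union> {(l \<odot> sing q, r \<odot> q) | q. q \<in> nodes \<psi>} \<union>
            {(m, readdr v' r' (readdr v s d)) | m d. (m, d) \<in> x \<and> m \<noteq> l \<and> m \<noteq> l'}"
            unfolding G2(9) \<sigma>2(2) by (rule graft_graph_twice[OF new notbelow(2)])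
          have "z = (m, readdr v r (readdr v' s' d)) \<and> (m, d) \<in> x \<and> m \<noteq> l' \<and> m \<noteq> l \<longleftrightarrow>
            z = (m, readdr v' r' (readdr v s d)) \<and> (m, d) \<in> x \<and> m \<noteq> l \<and> m \<noteq> l'" for z m d
            using com[of m d] by auto
          then show ?thesis unfolding w1 w2 by (simp only: Un_commute)
        qed
        ultimately show ?thesis by blast
      qed
    qed
  qed
qed

lemma target_laws_step: "target_laws_at (Suc (Suc n))"
  unfolding target_laws_at_def using target_exists_step target_unique_step target_ok_step replace_target_step by blast

end

section \<open>The laws in dimensions 2 and 1, and then in all dimensions\<close>

lemma target_laws_one: "target_laws_at (Suc 0)"
  unfolding target_laws_at_def
proof (intro conjI allI impI)
  show "\<exists>\<tau> w. has_target (Suc (Suc 0)) \<omega> \<tau> w" if "opetope (Suc (Suc 0)) \<omega>" for \<omega>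
    using two_opetope_leaf[OF that] that by (auto simp: has_target_low)
  have ok: "target_ok (Suc 0) \<omega> \<tau> w" if h: "has_target (Suc (Suc 0)) \<omega> \<tau> w" for \<omega> \<tau> w
  proof -
    obtain l where l: "opetope (Suc (Suc 0)) \<omega>" "\<tau> = OArr" "leaves \<omega> = {l}" "w = {(l, \<epsilon>)}"
      using h by (auto simp: has_target_low)
    have "leaf_label \<omega> l \<noteq> None" using l(3) by (auto simp: leaves_eq)
    then obtain \<phi> where \<phi>: "leaf_label \<omega> l = Some \<phi>" by blast
    \<comment> \<open>The only 0-opetope is \<open>OPt\<close>, so all edges of a 2-opetope carry it
      and both globular identities are immediate.\<close>
    have "\<phi> = OPt" using opetope_label(2)[OF l(1) \<phi>] by (simp add: opetope_low)
    moreover have "root_label (Suc (Suc 0)) \<omega> OPt" using l(1)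
    proof (cases rule: opetope_tree_cases)
      case (node \<psi> ts)
      then show ?thesis using l(1) by (auto simp: opetope_ONode_iff opetope_low root_label_ONode_iff has_target_low)
    qed (use l(1) in \<open>simp add: opetope_low\<close>)
    ultimately show ?thesis
      using l \<phi> by (auto simp: target_ok_def has_target_low intro!: bij_graphI)
  qed
  show "target_ok (Suc 0) \<omega> \<tau> w" if "has_target (Suc (Suc 0)) \<omega> \<tau> w" for \<omega> \<tau> w
    by (rule ok[OF that])
  show "has_target (Suc (Suc 0)) (replace_node \<tau> r \<psi> v) \<sigma> (readdr_leaves v r x)"
    if h: "has_target (Suc (Suc 0)) \<tau> \<sigma> x" "inner_label \<tau> r = Some \<phi>" "has_target (Suc (Suc 0)) \<psi> \<phi> v"
    for \<tau> \<sigma> x r \<phi> \<psi> v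
  proof -
    interpret node_subst 0 \<tau> r \<phi> \<psi> v
      by standard (use h ok in \<open>auto simp: has_target_low\<close>)
    obtain l where l: "\<sigma> = OArr" "leaves \<tau> = {l}" "x = {(l, \<epsilon>)}"
      using h(1) by (auto simp: has_target_low)
    have "leaves (replace_node \<tau> r \<psi> v) = readdr v r ` leaves \<tau>"
      unfolding leaves_eq dom_def by (auto simp: leaf_label_replace)
    then show ?thesis using l opetope_replace by (auto simp: has_target_low)
  qed
qed (auto simp: has_target_low)

lemma target_laws_zero: "target_laws_at 0"
  unfolding target_laws_at_def
proof (intro conjI allI impI)
  show "target_ok 0 \<omega> \<tau> w" if "has_target (Suc 0) \<omega> \<tau> w" for \<omega> \<tau> w
    using that by (auto simp: has_target_low target_ok_def leaves_eq intro!: bij_graphI)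
  show "\<exists>\<tau> w. has_target (Suc 0) \<omega> \<tau> w" if "opetope (Suc 0) \<omega>" for \<omega>
    using that by (simp add: has_target_low opetope_low)
qed (auto simp: has_target_low)

lemma target_laws: "target_laws_at k"
proof (cases k)
  case (Suc m)
  have "target_laws_at (Suc m)"
  proof (induction m)
    case (Suc m)
    then interpret dim_step m by unfold_locales
    show ?case by (rule target_laws_step)
  qed (rule target_laws_one)
  then show ?thesis using Suc by simp
qed (simp add: target_laws_zero)

subsection \<open>Opetopes as preopetopes\<close>

text \<open>Recursion on the tree avoids choosing a decomposition into grafts. The set under
  \<open>Abs_fset\<close> is finite for opetopes but not for arbitrary terms, so the equation for
  nodes becomes usable only through \<open>assignments_tree\<close>.\<close>

primrec pre :: "opt \<Rightarrow> preopt"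
  where
    "pre OPt = PPt"
  | "pre OArr = PSet {|(\<epsilon>, PPt)|}"
  | "pre (OEdge \<phi>) = PDegen (pre \<phi>)"
  | "pre (ONode \<psi> ts) = PSet (Abs_fset (insert (\<epsilon>, pre \<psi>)
       (\<Union>q. case map_option pre (ts q) of None \<Rightarrow> {}
         | Some p \<Rightarrow> (\<lambda>(a, x). (sing q \<odot> a, x)) ` assignments p)))"

lemma assignments_tree:
  assumes "opetope (Suc (Suc n)) \<omega>"
  shows "assignments (pre \<omega>) = {(a, pre \<chi>) | a \<chi>. inner_label \<omega> a = Some \<chi>}"
  using assms
proof (induction \<omega> rule: opt.induct)
  case (ONode \<psi> ts)
  let ?R = "{(a, pre \<chi>) | a \<chi>. inner_label (ONode \<psi> ts) a = Some \<chi>}"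
  define S where "S = insert (\<epsilon>, pre \<psi>) (\<Union>q. case map_option pre (ts q) of None \<Rightarrow> {}
         | Some p \<Rightarrow> (\<lambda>(a, x). (sing q \<odot> a, x)) ` assignments p)"
  have IH: "assignments (pre \<sigma>) = {(a, pre \<chi>) | a \<chi>. inner_label \<sigma> a = Some \<chi>}"
    if "ts q = Some \<sigma>" for q \<sigma>
  proof (rule ONode.IH(2))
    show "ts q \<in> range ts" by (rule rangeI)
    show "\<sigma> \<in> set_option (ts q)" "opetope (Suc (Suc n)) \<sigma>"
      using that ONode.prems by (auto simp: opetope_ONode_iff)
  qed
  have "S = ?R"
  proof
    show "S \<subseteq> ?R"
    proof
      fix z assume "z \<in> S"
      then consider "z = (\<epsilon>, pre \<psi>)"
        | q \<sigma> a x where "ts q = Some \<sigma>" "(a, x) \<in> assignments (pre \<sigma>)" "z = (sing q \<odot> a, x)"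
        unfolding S_def by (auto split: option.splits)
      then show "z \<in> ?R"
      proof cases
        case (2 q \<sigma> a x)
        then obtain \<chi> where "inner_label \<sigma> a = Some \<chi>" "x = pre \<chi>" using IH by auto
        then show ?thesis using 2 by auto
      qed auto
    qed
    show "?R \<subseteq> S"
    proof
      fix z assume "z \<in> ?R"
      then obtain a \<chi> where z: "z = (a, pre \<chi>)" "inner_label (ONode \<psi> ts) a = Some \<chi>" by blast
      show "z \<in> S"
      proof (cases a rule: addr_cases)
        case eps
        then show ?thesis using z unfolding S_def by simp
      next
        case (cons q p)
        then obtain \<sigma> where \<sigma>: "ts q = Some \<sigma>" "inner_label \<sigma> p = Some \<chi>"
          using z(2) by (auto simp: bind_eq_Some_conv)
        then have "(p, pre \<chi>) \<in> assignments (pre \<sigma>)" using IH by blast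
        then have "(sing q \<odot> p, pre \<chi>) \<in> (case map_option pre (ts q) of None \<Rightarrow> {}
         | Some p \<Rightarrow> (\<lambda>(a, x). (sing q \<odot> a, x)) ` assignments p)"
          using \<sigma> by force
        then show ?thesis unfolding S_def z cons by blast
      qed
    qed
  qed
  \<comment> \<open>Finiteness is what allows \<open>Abs_fset\<close> to be inverted.\<close>
  moreover have "finite ?R"
  proof -
    have "?R = (\<lambda>a. (a, pre (src (ONode \<psi> ts) a))) ` nodes (ONode \<psi> ts)"
      unfolding nodes_tree[OF ONode.prems] src_tree[OF ONode.prems] by force
    then show ?thesis using finite_nodes[OF ONode.prems] by simp
  qed
  ultimately show ?case
    unfolding pre.simps S_def[symmetric] assignments.simps by (simp add: Abs_fset_inverse)
qed auto

lemma dim_cases: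
  obtains "m = 0" | "m = Suc 0" | n where "m = Suc (Suc n)"
  by (metis not0_implies_Suc)

lemma assignments_pre:
  assumes "opetope m \<omega>"
  shows "assignments (pre \<omega>) = {(a, pre (src \<omega> a)) | a. a \<in> nodes \<omega>}"
proof -
  show ?thesis
  proof (cases m rule: dim_cases)
    case (3 n)
    then have op: "opetope (Suc (Suc n)) \<omega>" using assms by simp
    show ?thesis
      unfolding assignments_tree[OF op] nodes_tree[OF op] src_tree[OF op] by force
  qed (use assms in \<open>auto simp: opetope_low\<close>)
qed

lemma pnodes_pre: "opetope m \<omega> \<Longrightarrow> pnodes (pre \<omega>) = nodes \<omega>"
  unfolding pnodes_def using assignments_pre[of m \<omega>] by force

lemma psrc_pre: "opetope m \<omega> \<Longrightarrow> a \<in> nodes \<omega> \<Longrightarrow> psrc (pre \<omega>) a = pre (src \<omega> a)"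
  unfolding psrc_def by (subst assignments_pre) auto

lemma pre_tree:
  assumes "opetope (Suc (Suc n)) \<omega>" "inner_label \<omega> p = Some \<chi>"
  obtains A where "pre \<omega> = PSet A" "fset A = {(a, pre \<chi>) | a \<chi>. inner_label \<omega> a = Some \<chi>}"
proof -
  from assms(1) obtain A where A: "pre \<omega> = PSet A"
    by (cases rule: opetope_tree_cases) (use assms(2) in auto)
  then show ?thesis using that assignments_tree[OF assms(1)] by simp
qed

lemma pre_eqI:
  assumes "opetope (Suc (Suc n)) \<omega>" "inner_label \<omega> p = Some \<chi>"
    "fset A = {(a, pre \<chi>) | a \<chi>. inner_label \<omega> a = Some \<chi>}"
  shows "pre \<omega> = PSet A"
  using pre_tree[OF assms(1,2)] assms(3) by (metis fset_inject)

lemma Adr_Suc: "Addr xs \<in> Adr (Suc n) \<longleftrightarrow> set xs \<subseteq> Adr n"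
  by auto

text \<open>The first index of a node address is a node of the root label, which is one dimension
  lower; the dimension therefore varies in the induction on terms.\<close>

lemma nodes_Adr: "opetope (Suc m) \<omega> \<Longrightarrow> nodes \<omega> \<subseteq> Adr m"
proof (induction \<omega> arbitrary: m rule: opt.induct)
  case (ONode \<psi> ts)
  then obtain n where m: "m = Suc n" by (cases m) (auto simp: opetope_low)
  note op = ONode.prems[unfolded m]
  have \<psi>: "nodes \<psi> \<subseteq> Adr n" using ONode.IH(1)[of n] op by (simp add: opetope_ONode_iff)
  show ?case
  proof
    fix a assume "a \<in> nodes (ONode \<psi> ts)"
    then have a: "inner_label (ONode \<psi> ts) a \<noteq> None" using nodes_tree[OF op] by blast
    show "a \<in> Adr m"
    proof (cases a rule: addr_cases)
      case eps
      then show ?thesis unfolding m by simp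
    next
      case (cons q p)
      then obtain \<sigma> where \<sigma>: "ts q = Some \<sigma>" "inner_label \<sigma> p \<noteq> None"
        using a by (auto simp: bind_eq_Some_conv)
      have op\<sigma>: "opetope (Suc (Suc n)) \<sigma>" using op \<sigma> by (simp add: opetope_ONode_iff)
      have "nodes \<sigma> \<subseteq> Adr (Suc n)"
      proof (rule ONode.IH(2))
        show "ts q \<in> range ts" by (rule rangeI)
      qed (use \<sigma> op\<sigma> in auto)
      then have "Addr (entries p) \<in> Adr (Suc n)" using \<sigma>(2) nodes_tree[OF op\<sigma>] by auto
      moreover have "q \<in> Adr n" using \<psi> \<sigma>(1) op by (auto simp: opetope_ONode_iff)
      moreover have "a = Addr (q # entries p)" unfolding cons by (simp add: acat_def sing_def)
      ultimately show ?thesis unfolding m Adr_Suc by simp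
    qed
  qed
qed (auto simp: opetope_low elim: opetope_OEdgeE)

lemma preopetope_pre: "opetope m \<omega> \<Longrightarrow> preopetope m (pre \<omega>)"
proof (induction m arbitrary: \<omega> rule: less_induct)
  case (less m)
  show ?case
  proof (cases m rule: dim_cases)
    case 1
    then show ?thesis using less.prems pre_pt by (simp add: opetope_low)
  next
    case 2
    then show ?thesis using less.prems pre_set[of "{|(\<epsilon>, PPt)|}" 0] pre_pt by (simp add: opetope_low)
  next
    case (3 n)
    note op = less.prems[unfolded 3]
    from op show ?thesis
    proof (cases rule: opetope_tree_cases)
      case (edge \<phi>)
      then show ?thesis using 3 op less.IH[of n \<phi>] pre_degen[of n "pre \<phi>"] by simp
    next
      case (node \<psi> ts)
      then have "inner_label \<omega> \<epsilon> = Some \<psi>" by simp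
      from pre_tree[OF op this] obtain A where A: "pre \<omega> = PSet A"
        "fset A = {(a, pre \<chi>) | a \<chi>. inner_label \<omega> a = Some \<chi>}" .
      have "preopetope (Suc n + 1) (PSet A)"
      proof (rule pre_set)
        have "(\<epsilon>, pre \<psi>) |\<in>| A" using A(2) node by simp
        then show "A \<noteq> {||}" by auto
        show "inj_on fst (fset A)" unfolding A(2) by (auto intro: inj_onI)
        fix a q assume "(a, q) |\<in>| A"
        then obtain \<chi> where \<chi>: "inner_label \<omega> a = Some \<chi>" "q = pre \<chi>" using A(2) by auto
        then have "a \<in> nodes \<omega>" using nodes_tree[OF op] by auto
        then show "a \<in> Adr (Suc n)" using nodes_Adr[OF op] by blast
        show "preopetope (Suc n) q"
          unfolding \<chi>(2) by (rule less.IH) (use 3 opetope_label(1)[OF op \<chi>(1)] in auto)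
      qed
      then show ?thesis using A(1) 3 by simp
    qed
  qed
qed

text \<open>Sets of assignments are nonempty, so the dimension can be read off from a
  member.\<close>

lemma preopetope_dim: "preopetope n p \<Longrightarrow> preopetope m p \<Longrightarrow> n = m"
proof (induction arbitrary: m rule: preopetope.induct)
  case pre_pt
  then show ?case by (auto elim: preopetope.cases)
next
  case (pre_set A n)
  then obtain a q where aq: "(a, q) |\<in>| A" by (metis all_not_fin_conv surj_pair)
  from pre_set.prems obtain k where "m = k + 1" "preopetope k q"
    by (cases rule: preopetope.cases) (use aq in auto)
  then show ?case using pre_set.IH[OF aq] by auto
next
  case (pre_degen n q)
  from pre_degen.prems obtain k where "m = k + 2" "preopetope k q"
    by (cases rule: preopetope.cases) auto
  then show ?case using pre_degen.IH by auto
qed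

lemma inner_labelI:
  assumes "opetope (Suc (Suc n)) \<omega>" "(a, x) \<in> assignments (pre \<omega>)"
  obtains \<chi> where "inner_label \<omega> a = Some \<chi>" "x = pre \<chi>"
  using assms(2) unfolding assignments_tree[OF assms(1)] by blast

text \<open>Node labels have lower dimension, so equal assignments give equal labels by induction.
  The leaf labels of a tree with nodes, which \<open>pre\<close> forgets, are restored by
  \<open>tree_ext\<close>.\<close>

lemma pre_inject: "opetope m \<omega> \<Longrightarrow> opetope m \<omega>' \<Longrightarrow> pre \<omega> = pre \<omega>' \<Longrightarrow> \<omega> = \<omega>'"
proof (induction m arbitrary: \<omega> \<omega>' rule: less_induct)
  case (less m)
  show ?case
  proof (cases m rule: dim_cases)
    case (3 n)
    note op = less.prems(1)[unfolded 3] and op' = less.prems(2)[unfolded 3]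
    have sub: "inner_label \<omega>2 a = Some \<chi>"
      if \<omega>: "opetope (Suc (Suc n)) \<omega>1" "opetope (Suc (Suc n)) \<omega>2" "pre \<omega>1 = pre \<omega>2"
        and \<chi>: "inner_label \<omega>1 a = Some \<chi>" for \<omega>1 \<omega>2 a \<chi>
    proof -
      have "(a, pre \<chi>) \<in> assignments (pre \<omega>2)"
        using assignments_tree[OF \<omega>(1)] \<chi> \<omega>(3) by auto
      with \<omega>(2) obtain \<chi>' where \<chi>': "inner_label \<omega>2 a = Some \<chi>'" "pre \<chi> = pre \<chi>'" by (rule inner_labelI)
      have "\<chi> = \<chi>'"
        by (rule less.IH[OF _ opetope_label(1)[OF \<omega>(1) \<chi>] opetope_label(1)[OF \<omega>(2) \<chi>'(1)] \<chi>'(2)])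
          (simp add: 3)
      with \<chi>' show ?thesis by simp
    qed
    show ?thesis
    proof (rule tree_ext[OF op op'])
      show "inner_label \<omega> = inner_label \<omega>'"
      proof
        fix a
        show "inner_label \<omega> a = inner_label \<omega>' a"
          using sub[OF op op' less.prems(3), of a] sub[OF op' op less.prems(3)[symmetric], of a]
          by (metis not_None_eq)
      qed
      show "\<phi> = \<phi>'" if "\<omega> = OEdge \<phi>" "\<omega>' = OEdge \<phi>'" for \<phi> \<phi>'
        by (rule less.IH[of n]) (use that op op' less.prems(3) 3 in auto)
    qed
  qed (use less.prems in \<open>simp_all add: opetope_low\<close>)
qed

lemma pre_eq_iff: "opetope n \<omega> \<Longrightarrow> opetope m \<omega>' \<Longrightarrow> pre \<omega> = pre \<omega>' \<longleftrightarrow> \<omega> = \<omega>'"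
  using pre_inject preopetope_dim preopetope_pre by metis

text \<open>In a tree with a node, a leaf is an input of some node at which no further node sits,
  and this is how leaves of a set of assignments are defined. For a bare edge both sides are
  \<open>{\<epsilon>}\<close>.\<close>

lemma pleaves_pre:
  assumes "opetope (Suc (Suc n)) \<omega>"
  shows "pleaves (pre \<omega>) = leaves \<omega>"
  using assms
proof (cases rule: opetope_tree_cases)
  case (node \<psi> ts)
  then have "inner_label \<omega> \<epsilon> = Some \<psi>" by simp
  with assms obtain A where A: "pre \<omega> = PSet A" by (rule pre_tree)
  have 1: "pnodes (PSet A) = nodes \<omega>" using pnodes_pre[OF assms] A by simp
  have 2: "pnodes (psrc (PSet A) a) = nodes (src \<omega> a)" if "a \<in> nodes \<omega>" for a
    using psrc_pre[OF assms that] pnodes_pre[OF opetope_nodes_src[OF assms that]] A by simp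
  have "l \<in> leaves \<omega> \<longleftrightarrow> (\<exists>a b. l = a \<odot> sing b \<and> a \<in> nodes \<omega> \<and> b \<in> nodes (src \<omega> a) \<and> a \<odot> sing b \<notin> nodes \<omega>)" for l
  proof
    assume l: "l \<in> leaves \<omega>"
    then have sub: "subtree \<omega> l \<noteq> None" "inner_label \<omega> l = None"
      by (auto simp: leaves_def inner_label_def)
    show "\<exists>a b. l = a \<odot> sing b \<and> a \<in> nodes \<omega> \<and> b \<in> nodes (src \<omega> a) \<and> a \<odot> sing b \<notin> nodes \<omega>"
    proof (cases l rule: addr_rev_cases)
      case eps
      then show ?thesis using sub node by simp
    next
      case (snoc b a)
      then obtain \<chi> where \<chi>: "inner_label \<omega> a = Some \<chi>" using opetope_parent sub(1) by blast
      then have "b \<in> nodes \<chi>" using opetope_children(1)[OF assms \<chi>, of b] sub(1) snoc by simp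
      then show ?thesis using snoc \<chi> sub(2) nodes_tree[OF assms] src_tree[OF assms] by auto
    qed
  next
    assume "\<exists>a b. l = a \<odot> sing b \<and> a \<in> nodes \<omega> \<and> b \<in> nodes (src \<omega> a) \<and> a \<odot> sing b \<notin> nodes \<omega>"
    then obtain a b where ab: "l = a \<odot> sing b" "a \<in> nodes \<omega>" "b \<in> nodes (src \<omega> a)" "a \<odot> sing b \<notin> nodes \<omega>" by blast
    then obtain \<chi> where \<chi>: "inner_label \<omega> a = Some \<chi>" using nodes_tree[OF assms] by blast
    then have "subtree \<omega> l \<noteq> None"
      using opetope_children(1)[OF assms \<chi>, of b] ab src_tree[OF assms] by simp
    then show "l \<in> leaves \<omega>"
      using opetope_total[OF assms, of l] ab nodes_tree[OF assms] by (auto simp: leaves_eq)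
  qed
  then show ?thesis unfolding A pleaves.simps 1 using 2 by blast
qed simp

lemma nondegenerate_node:
  assumes "opetope (Suc (Suc n)) \<omega>" "\<And>\<phi>. \<omega> \<noteq> OEdge \<phi>"
  obtains \<psi> where "inner_label \<omega> \<epsilon> = Some \<psi>"
  using assms by (cases rule: opetope_tree_cases) auto

lemma pre_corolla:
  assumes "opetope (Suc m) \<psi>"
  shows "pre (corolla \<psi>) = PSet {|(\<epsilon>, pre \<psi>)|}"
  by (rule pre_eqI[OF opetope_corolla[OF assms], of \<epsilon> \<psi>]) auto

lemma graft_edge: "leaf_label (OEdge \<phi>) l = Some \<phi>' \<Longrightarrow> graft (OEdge \<phi>) l \<omega> = \<omega>"
  by (simp add: graft_def split: if_splits)

lemma graft_corolla_opetope:
  assumes "opetope (Suc (Suc n)) \<nu>" "opetope (Suc n) \<psi>" "has_target (Suc n) \<psi> \<phi> v" "leaf_label \<nu> l = Some \<phi>"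
  shows "opetope (Suc (Suc n)) (graft \<nu> l (corolla \<psi>))"
  by (rule opetope_graft[OF assms(1,4) opetope_corolla[OF assms(2)]])
    (use assms(3) in \<open>auto simp: corolla_def root_label_ONode_iff\<close>)

lemma pre_graft:
  assumes "opetope (Suc (Suc n)) \<nu>" "leaf_label \<nu> l = Some \<phi>" "pre \<nu> = PSet A"
    "opetope (Suc (Suc n)) (graft \<nu> l (corolla \<psi>))"
  shows "pre (graft \<nu> l (corolla \<psi>)) = pgraft A l (pre \<psi>)"
  unfolding pgraft_def
proof (rule pre_eqI[OF assms(4) graft_corolla_inner(2)[OF assms(2)]])
  have "fset A = {(a, pre \<chi>) | a \<chi>. inner_label \<nu> a = Some \<chi>}"
    using assignments_tree[OF assms(1)] assms(3) by simp
  then show "fset (finsert (l, pre \<psi>) A) = {(a, pre \<chi>) | a \<chi>. inner_label (graft \<nu> l (corolla \<psi>)) a = Some \<chi>}"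
    by (auto simp: graft_labels[OF assms(2)] split: if_splits)
qed

section \<open>The map to preopetopes\<close>

lemma to_pre_rel_sound: "to_pre_rel \<omega> p \<Longrightarrow> (\<exists>m. opetope m \<omega>) \<and> p = pre \<omega>"
proof (induction rule: to_pre_rel.induct)
  case (3 n \<phi> q)
  then show ?case using opetope_edge[of n \<phi>] by (metis pre.simps(3))
next
  case (4 n \<psi> q)
  then have "opetope (Suc n) \<psi>" by simp
  then show ?case using opetope_corolla[of n \<psi>] pre_corolla[of n \<psi>] 4 by auto
next
  case (5 n \<nu> \<psi> \<phi> w l A q)
  have h: "opetope (Suc (Suc n)) \<nu>" "opetope (Suc n) \<psi>" "has_target (Suc n) \<psi> \<phi> w" "leaf_label \<nu> l = Some \<phi>"
    using 5 by (simp_all add: leaf_label_eq_Some)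
  note op = graft_corolla_opetope[OF h]
  have "pre \<nu> = PSet A" using 5 by simp
  from pre_graft[OF h(1,4) this op] op show ?case using 5 by auto
qed (use opetope_pt opetope_arr in auto)

lemma to_pre_rel_pre: "opetope m \<omega> \<Longrightarrow> to_pre_rel \<omega> (pre \<omega>)"
proof (induction m arbitrary: \<omega> rule: less_induct)
  case (less m)
  show ?case
  proof (cases m rule: dim_cases)
    case (3 n)
    show ?thesis using target_laws[of n] less.prems[unfolded 3]
    proof (induction rule: tree_graft_induct)
      case (edge \<phi>)
      then show ?case using less.IH[of n] 3 by (auto intro: to_pre_rel.intros(3))
    next
      case (graft \<nu> l \<psi> \<phi> v)
      have \<psi>: "to_pre_rel \<psi> (pre \<psi>)" by (rule less.IH[OF _ graft.hyps(2)]) (simp add: 3)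
      from graft.hyps(1) show ?case
      proof (cases rule: opetope_tree_cases)
        case (edge \<phi>')
        \<comment> \<open>The graft clause of \<open>to_pre_rel\<close> demands a node in \<nu>;
          over a bare edge the graft is a corolla, which has a clause of its own.\<close>
        then have "graft \<nu> l (corolla \<psi>) = corolla \<psi>" using graft_edge graft.hyps(4) by blast
        then show ?thesis
          using to_pre_rel.intros(4)[OF _ \<psi>, of n] graft.hyps(2) pre_corolla[OF graft.hyps(2)] by simp
      next
        case (node \<alpha> ts)
        then have \<epsilon>: "inner_label \<nu> \<epsilon> = Some \<alpha>" by simp
        with graft.hyps(1) obtain A where A: "pre \<nu> = PSet A" by (rule pre_tree)
        have "nodes \<nu> \<noteq> {}" using \<epsilon> nodes_tree[OF graft.hyps(1)] by auto
        then have "to_pre_rel (graft \<nu> l (corolla \<psi>)) (pgraft A l (pre \<psi>))"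
          using to_pre_rel.intros(5)[of n \<nu> \<psi> \<phi> v l A "pre \<psi>"] graft.hyps graft.IH \<psi> A
          by (simp add: leaf_label_eq_Some)
        then show ?thesis
          using pre_graft[OF graft.hyps(1,4) A graft_corolla_opetope[OF graft.hyps]] by simp
      qed
    qed
  qed (use less.prems in \<open>auto simp: opetope_low intro: to_pre_rel.intros\<close>)
qed

lemma to_pre_eq: "opetope m \<omega> \<Longrightarrow> to_pre \<omega> = pre \<omega>"
  unfolding to_pre_def by (rule the_equality) (auto dest: to_pre_rel_pre to_pre_rel_sound)

subsection \<open>Derivable sequents\<close>

lemma target_ok: "has_target (Suc k) \<omega> \<tau> w \<Longrightarrow> target_ok k \<omega> \<tau> w"
  by (rule target_lawsD(3)[OF target_laws])

lemma target_unique: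
  "has_target (Suc k) \<omega> \<tau> w \<Longrightarrow> has_target (Suc k) \<omega> \<tau>' w' \<Longrightarrow> \<tau> = \<tau>' \<and> w = w'"
  by (rule target_lawsD(2)[OF target_laws])

text \<open>For \<open>n = 0\<close> the target is \<open>OArr\<close>, from the clause for
  2-opetopes, and not a corolla. After \<open>pre\<close> both cases have the same form, as the rule
  \<open>degen\<close> requires.\<close>

lemma has_target_edge:
  assumes "opetope n \<phi>"
  obtains \<tau> where "has_target (Suc (Suc n)) (OEdge \<phi>) \<tau> {(\<epsilon>, \<epsilon>)}" "pre \<tau> = PSet {|(\<epsilon>, pre \<phi>)|}"
proof (cases n)
  case 0
  then have "has_target (Suc (Suc n)) (OEdge \<phi>) OArr {(\<epsilon>, \<epsilon>)}" "pre OArr = PSet {|(\<epsilon>, pre \<phi>)|}"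
    using assms by (simp_all add: has_target_low opetope_low)
  then show ?thesis by (rule that)
next
  case (Suc m)
  then have "has_target (Suc (Suc n)) (OEdge \<phi>) (corolla \<phi>) {(\<epsilon>, \<epsilon>)}"
    using target_edge[of m \<phi>] assms by (simp add: numeral_3_eq_3)
  then show ?thesis using that pre_corolla assms Suc by blast
qed

lemma leaves_subst_low:
  assumes "opetope (Suc (Suc 0)) \<nu>" "leaves \<nu> = {l}"
  shows "leaves (graft \<nu> l (corolla OArr)) = {l \<odot> sing \<epsilon>}"
proof -
  obtain \<phi> where "leaf_label \<nu> l = Some \<phi>" using assms(2) leaves_eq by blast
  from leaves_graft[OF this] show ?thesis by (simp add: assms(2) leaves_corolla)
qed

text \<open>The graft formula persists in dimension 2, where targets are prescribed: replacing the
  node of \<open>OArr\<close> by \<open>OArr\<close> gives \<open>OArr\<close>, and the single leaf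
  becomes \<open>l \<odot> sing \<epsilon>\<close>.\<close>

lemma has_target_graft':
  assumes "opetope (Suc (Suc n)) \<nu>" "has_target (Suc (Suc n)) \<nu> \<tau> w"
    "opetope (Suc n) \<psi>" "has_target (Suc n) \<psi> \<phi> v" "leaf_label \<nu> l = Some \<phi>" "(l, r) \<in> w"
  shows "has_target (Suc (Suc n)) (graft \<nu> l (corolla \<psi>)) (replace_node \<tau> r \<psi> v)
    (graft_graph l r (corolla_graph \<psi>) v w)"
proof (cases n)
  case 0
  then have \<psi>: "\<psi> = OArr" "\<phi> = OPt" "v = {}" using assms(4) by (simp_all add: has_target_low)
  have w: "\<tau> = OArr" "leaves \<nu> = {l}" "w = {(l, \<epsilon>)}" "r = \<epsilon>"
    using assms(2,6) 0 by (auto simp: has_target_low)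
  have "opetope (Suc (Suc 0)) (graft \<nu> l (corolla OArr))"
    using graft_corolla_opetope[OF assms(1,3,4,5)] 0 \<psi> by simp
  moreover have "leaves (graft \<nu> l (corolla OArr)) = {l \<odot> sing \<epsilon>}"
    by (rule leaves_subst_low) (use assms(1) 0 w in auto)
  ultimately show ?thesis
    using 0 \<psi> w by (auto simp: has_target_low replace_node_def)
next
  case (Suc m)
  then show ?thesis using has_target_graft assms by blast
qed

lemma graft_node_subst:
  assumes "has_target (Suc (Suc (Suc n))) \<nu> \<tau> w" "leaf_label \<nu> l = Some \<phi>" "(l, r) \<in> w"
    "has_target (Suc (Suc n)) \<psi> \<phi> v"
  shows "node_subst n \<tau> r \<phi> \<psi> v"
proof -
  interpret dim_step n by unfold_locales (rule target_laws)
  show ?thesis by (rule graft_subst_ok[OF target_ok_step[OF assms(1)] assms(2,3,4)])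
qed

section \<open>Replacement of a node as substitution of preopetopes\<close>

lemma fset_psubst:
  "fset ((\<lambda>(b, v). (r \<odot> b, v)) |`| Q |\<union>| (\<lambda>(a, w). (readdr U r a, w)) |`| ffilter (\<lambda>(a, w). a \<noteq> r) T) =
    {(r \<odot> b, v) | b v. (b, v) \<in> fset Q} \<union> {(readdr U r a, w) | a w. (a, w) \<in> fset T \<and> a \<noteq> r}"
  "fset ((\<lambda>(a, w). (readdr U r a, w)) |`| ffilter (\<lambda>(a, w). a \<noteq> r) T) =
    {(readdr U r a, w) | a w. (a, w) \<in> fset T \<and> a \<noteq> r}"
  by (auto simp: image_iff split: prod.splits)

text \<open>If \<psi> has a node, this is the label lemma read as a set of assignments. A bare edge
  brings in the two degenerate cases of \<open>psubst\<close>, according to whether any node of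
  \<tau> remains.\<close>

lemma pre_replace_node:
  assumes "node_subst n \<tau> r \<phi> \<psi> v" "has_target (Suc (Suc n)) \<psi> \<phi> v" "pre \<tau> = PSet T"
  shows "pre (replace_node \<tau> r \<psi> v) = psubst v T r (pre \<psi>)"
proof -
  interpret node_subst n \<tau> r \<phi> \<psi> v by fact
  let ?\<tau> = "replace_node \<tau> r \<psi> v"
  have T: "fset T = {(a, pre \<chi>) | a \<chi>. inner_label \<tau> a = Some \<chi>}"
    using assignments_tree[OF tree] assms(3) by simp
  from tree' show ?thesis
  proof (cases rule: opetope_tree_cases)
    case (node \<alpha> ts)
    then have \<epsilon>: "inner_label \<psi> \<epsilon> = Some \<alpha>" by simp
    from pre_tree[OF tree' this] obtain Q where Q: "pre \<psi> = PSet Q"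
      "fset Q = {(a, pre \<chi>) | a \<chi>. inner_label \<psi> a = Some \<chi>}" .
    have at: "inner_label ?\<tau> (r \<odot> \<epsilon>) = Some \<alpha>" using \<epsilon> inner_label_replace by blast
    show ?thesis
      unfolding Q psubst.simps
      by (rule pre_eqI[OF opetope_replace at], unfold fset_psubst T Q inner_label_replace) blast
  next
    case (edge \<chi>)
    have \<chi>: "opetope n \<chi>" using tree' edge by simp
    obtain \<tau>1 where "has_target (Suc (Suc n)) (OEdge \<chi>) \<tau>1 {(\<epsilon>, \<epsilon>)}" using has_target_edge[OF \<chi>] .
    \<comment> \<open>This is the context that \<open>psubst\<close> has fixed in its degenerate
      clause.\<close>
    then have v: "v = {(\<epsilon>, \<epsilon>)}" using target_unique assms(2) edge by blast
    have in': "inner_label ?\<tau> p = Some \<alpha> \<longleftrightarrow> (\<exists>a. a \<noteq> r \<and> inner_label \<tau> a = Some \<alpha> \<and> p = readdr v r a)" for p \<alpha>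
      unfolding inner_label_replace by (simp add: edge)
    have rT: "(r, pre \<phi>) \<in> fset T" using T node by blast
    show ?thesis
    proof (cases "fcard T = 1")
      case True
      then obtain t where "fset T = {t}" by (metis card_1_singletonE fcard.rep_eq)
      then have T1: "fset T = {(r, pre \<phi>)}" using rT by auto
      have only: "a = r" if "inner_label \<tau> a = Some \<alpha>" for a \<alpha>
      proof -
        have "(a, pre \<alpha>) \<in> fset T" using T that by blast
        then show ?thesis using T1 by simp
      qed
      \<comment> \<open>No node survives, so the result is a bare edge, and its label \<beta> has to
        be identified with the label \<chi> of \<psi>. Both turn out to be the source of \<phi> at
        \<epsilon>: \<beta> is the label of a leaf of \<tau>, located at
        \<open>sing \<epsilon>\<close>, and \<chi> is given by the matching
        \<open>v\<close>.\<close>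
      obtain \<beta> where \<beta>: "?\<tau> = OEdge \<beta>"
        using opetope_replace
      proof (cases rule: opetope_tree_cases)
        case (node \<gamma> us)
        then have "inner_label ?\<tau> \<epsilon> = Some \<gamma>" by simp
        then show ?thesis using in' only by blast
      qed (use that in blast)
      have "inner_label \<tau> \<epsilon> \<noteq> None"
        using tree by (cases rule: opetope_tree_cases) (use node in auto)
      then have r: "r = \<epsilon>" using only by blast
      have "leaf_label ?\<tau> \<epsilon> = Some \<beta>" using \<beta> by simp
      then obtain a where a: "leaf_label \<tau> a = Some \<beta>" "\<epsilon> = readdr v r a"
        unfolding leaf_label_replace by blast
      have "subtree \<tau> a \<noteq> None" using leaf_in_tree[OF a(1)] by simp
      then have "a = sing \<epsilon>"
      proof (cases rule: position)
        case self
        then show ?thesis using leaf_not_prefix[of a \<epsilon>] a(1) by simp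
      next
        case (away)
        then show ?thesis using r away(1)[of a] by simp
      next
        case (above k e z)
        have "r \<odot> k \<odot> z = \<epsilon>" unfolding above(3)[symmetric] by (rule a(2)[symmetric])
        then show ?thesis using above(1,2) r v by simp
      qed
      then have sub: "subtree \<tau> (\<epsilon> \<odot> sing \<epsilon>) = Some (OEdge \<beta>)" using leaf_in_tree[OF a(1)] by simp
      have "inner_label \<tau> \<epsilon> = Some \<phi>" using node r by simp
      from opetope_children(2)[OF tree this sub] have "\<beta> = src \<phi> \<epsilon>" by simp
      moreover have "\<chi> = src \<phi> \<epsilon>" using leaf_src[of \<epsilon> \<epsilon>] v edge by simp
      ultimately show ?thesis using True \<beta> edge by simp
    next
      case False
      have "\<exists>a \<alpha>. a \<noteq> r \<and> inner_label \<tau> a = Some \<alpha>"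
      proof (rule ccontr)
        assume "\<nexists>a \<alpha>. a \<noteq> r \<and> inner_label \<tau> a = Some \<alpha>"
        then have "a = r \<and> \<alpha> = \<phi>" if "inner_label \<tau> a = Some \<alpha>" for a \<alpha>
          using that node by (metis option.inject)
        then have "fset T = {(r, pre \<phi>)}" unfolding T using node by blast
        then show False using False by (simp add: fcard.rep_eq)
      qed
      then obtain a \<alpha> where "a \<noteq> r" "inner_label \<tau> a = Some \<alpha>" by blast
      then have at: "inner_label ?\<tau> (readdr v r a) = Some \<alpha>" using in' by blast
      have "pre ?\<tau> = PSet ((\<lambda>(a, w). (readdr v r a, w)) |`| ffilter (\<lambda>(a, w). a \<noteq> r) T)"
        by (rule pre_eqI[OF opetope_replace at], unfold fset_psubst T in') blast
      then show ?thesis using False edge v by simp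
    qed
  qed
qed

lemma pre_target_graft:
  assumes "has_target (Suc (Suc n)) \<nu> \<tau> w" "leaf_label \<nu> l = Some \<phi>" "(l, r) \<in> w"
    "has_target (Suc n) \<psi> \<phi> v" "pre \<tau> = PSet T"
  shows "pre (replace_node \<tau> r \<psi> v) = psubst v T r (pre \<psi>)"
proof (cases n)
  case 0
  then have "\<psi> = OArr" "v = {}" "\<tau> = OArr" "r = \<epsilon>" using assms by (auto simp: has_target_low)
  moreover have "ffilter (\<lambda>(a, w). a \<noteq> \<epsilon>) {|(\<epsilon>, PPt)|} = {||}" by auto
  ultimately show ?thesis using assms(5) by (auto simp: replace_node_def)
next
  case (Suc m)
  then show ?thesis
    using pre_replace_node graft_node_subst assms by blast
qed

lemma sequent_pre:
  assumes "has_target (Suc (Suc n)) \<omega> \<tau> w"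
  shows "sequent (Suc (Suc n)) w (pre \<omega>) (pre \<tau>)"
proof -
  note ok = target_okD[OF target_ok[OF assms]]
  have "finite w"
  proof (rule finite_imageD)
    show "finite (snd ` w)"
      by (rule finite_subset[OF _ finite_nodes[OF ok(2)]]) (use bij_graphD(2)[OF ok(3)] in auto)
    show "inj_on snd w" by (rule inj_onI) (use bij_graphD(4)[OF ok(3)] in auto)
  qed
  moreover have "w \<subseteq> leaves \<omega> \<times> nodes \<tau>" using bij_graphD(1,2)[OF ok(3)] by auto
  ultimately show ?thesis
    using preopetope_pre[OF ok(1)] preopetope_pre[OF ok(2)]
    by (simp add: sequent_def Preopetopes_def pleaves_pre[OF ok(1)] pnodes_pre[OF ok(2)])
qed

lemma sequent_low: "sequent 0 {} PPt PEmpty" "sequent (Suc 0) {} (PSet {|(\<epsilon>, PPt)|}) PPt"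
  using preopetope_pre[of 0 OPt] preopetope_pre[of "Suc 0" OArr]
  by (simp_all add: sequent_def Preopetopes_def)

lemma sequent_pre': "has_target (Suc n) \<omega> \<tau> w \<Longrightarrow> sequent (Suc n) w (pre \<omega>) (pre \<tau>)"
  by (cases n) (auto simp: has_target_low sequent_low sequent_pre)

lemma target_set:
  assumes "has_target (Suc (Suc n)) \<nu> \<tau> w" "(l, r) \<in> w"
  obtains T where "pre \<tau> = PSet T"
proof -
  note ok = target_okD[OF target_ok[OF assms(1)]]
  have r: "r \<in> nodes \<tau>" using bij_graphD(2)[OF ok(3) assms(2)] .
  show ?thesis
  proof (cases n)
    case 0
    then show ?thesis using that ok(2) by (simp add: opetope_low)
  next
    case (Suc m)
    with ok(2) r have "opetope (Suc (Suc m)) \<tau>" "inner_label \<tau> r \<noteq> None" by (auto simp: nodes_tree)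
    then show ?thesis using pre_tree that by blast
  qed
qed

text \<open>Puts a leaf into the form in which the rule \<open>graft\<close> names it, with its
  label as a source of a source, ready for the side condition of that rule.\<close>

lemma leaf_of_node:
  assumes "opetope (Suc (Suc n)) \<nu>" "\<And>\<chi>. \<nu> \<noteq> OEdge \<chi>" "leaf_label \<nu> l = Some \<phi>"
  obtains a b where "l = a \<odot> sing b" "a \<in> nodes \<nu>" "b \<in> nodes (src \<nu> a)" "src (src \<nu> a) b = \<phi>"
proof (cases l rule: addr_rev_cases)
  case eps
  obtain \<psi> where "inner_label \<nu> \<epsilon> = Some \<psi>" using nondegenerate_node[OF assms(1,2)] by blast
  then show ?thesis using leaf_not_below[OF assms(3), of \<epsilon> \<psi> \<epsilon>] eps by simp
next
  case (snoc b a)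
  note sub = leaf_in_tree[OF assms(3), unfolded snoc]
  then obtain \<psi> where \<psi>: "inner_label \<nu> a = Some \<psi>" using opetope_parent[of \<nu> a b] by auto
  have "b \<in> nodes \<psi>" using opetope_children(1)[OF assms(1) \<psi>, of b] sub by simp
  moreover have "\<phi> = src \<psi> b" using opetope_children(2)[OF assms(1) \<psi> sub] by simp
  ultimately show ?thesis using that[OF snoc] \<psi> nodes_tree[OF assms(1)] src_tree[OF assms(1)] by auto
qed

text \<open>Three ways of building a tree correspond to three rules: a bare edge to
  \<open>degen\<close>, a corolla to \<open>shift\<close>, and a corolla on a tree with nodes to
  \<open>graft\<close>. The label of the corolla has lower dimension, so its derivation comes from
  the outer induction.\<close>

lemma derivable_pre:
  "opetope m \<omega> \<Longrightarrow> \<exists>w t. derivable w (pre \<omega>) t \<and>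
    (case m of 0 \<Rightarrow> w = {} \<and> t = PEmpty | Suc k \<Rightarrow> \<exists>\<tau>. t = pre \<tau> \<and> has_target m \<omega> \<tau> w)"
proof (induction m arbitrary: \<omega> rule: less_induct)
  case (less m)
  show ?case
  proof (cases m rule: dim_cases)
    case 1
    then show ?thesis using less.prems derivable.point by (auto simp: opetope_low)
  next
    case 2
    then show ?thesis using less.prems derivable.shift[OF derivable.point]
      by (auto simp: opetope_low has_target_low pnodes_def)
  next
    case (3 n)
    have "\<exists>w \<tau>. derivable w (pre \<omega>) (pre \<tau>) \<and> has_target (Suc (Suc n)) \<omega> \<tau> w"
      using target_laws[of n] less.prems[unfolded 3]
    proof (induction rule: tree_graft_induct)
      case (edge \<phi>)
      obtain \<tau> where \<tau>: "has_target (Suc (Suc n)) (OEdge \<phi>) \<tau> {(\<epsilon>, \<epsilon>)}" "pre \<tau> = PSet {|(\<epsilon>, pre \<phi>)|}"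
        by (rule has_target_edge[OF edge])
      obtain w t where "derivable w (pre \<phi>) t" using less.IH[of n \<phi>] edge 3 by auto
      from derivable.degen[OF this] have "derivable {(\<epsilon>, \<epsilon>)} (pre (OEdge \<phi>)) (pre \<tau>)" by (simp add: \<tau>(2))
      then show ?case using \<tau>(1) by blast
    next
      case (graft \<nu> l \<psi> \<phi> v)
      obtain v' u where u: "derivable v' (pre \<psi>) (pre u)" "has_target (Suc n) \<psi> u v'"
        using less.IH[OF _ graft.hyps(2)] 3 by auto
      have v: "v' = v" "u = \<phi>" using target_unique[OF u(2) graft.hyps(3)] by auto
      from graft.hyps(1) show ?case
      proof (cases rule: opetope_tree_cases)
        case (edge \<phi>')
        then have eq: "graft \<nu> l (corolla \<psi>) = corolla \<psi>" using graft_edge graft.hyps(4) by blast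
        have "derivable (corolla_graph \<psi>) (pre (corolla \<psi>)) (pre \<psi>)"
          using derivable.shift[OF u(1)] pnodes_pre[OF graft.hyps(2)] pre_corolla[OF graft.hyps(2)] by simp
        then show ?thesis using has_target_corolla[OF graft.hyps(2)] unfolding eq by blast
      next
        case (node \<alpha> ts)
        obtain A where A: "pre \<nu> = PSet A" using pre_tree[OF graft.hyps(1), of \<epsilon> \<alpha>] node by auto
        obtain w \<tau> where w: "derivable w (pre \<nu>) (pre \<tau>)" "has_target (Suc (Suc n)) \<nu> \<tau> w"
          using graft.IH by blast
        note bij = target_okD(3)[OF target_ok[OF w(2)]]
        have "l \<in> leaves \<nu>" using graft.hyps(4) by (auto simp: leaves_eq)
        then obtain r where r: "(l, r) \<in> w" using bij_graphD(5)[OF bij] by blast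
        obtain T where T: "pre \<tau> = PSet T" by (rule target_set[OF w(2) r])
        obtain a b where ab: "l = a \<odot> sing b" "a \<in> nodes \<nu>" "b \<in> nodes (src \<nu> a)" "src (src \<nu> a) b = \<phi>"
          by (rule leaf_of_node[OF graft.hyps(1) _ graft.hyps(4)]) (use node in auto)
        \<comment> \<open>The rule wants the active pair separated from the remaining
          context.\<close>
        define \<Gamma> where "\<Gamma> = w - {(l, r)}"
        have ins: "insert (l, r) \<Gamma> = w" using r by (auto simp: \<Gamma>_def)
        have s: "psrc (PSet A) a = pre (src \<nu> a)" using psrc_pre[OF graft.hyps(1) ab(2)] A by simp
        have opa: "opetope (Suc n) (src \<nu> a)" by (rule opetope_nodes_src[OF graft.hyps(1) ab(2)])
        have D: "derivable ((\<lambda>(l, e). (l, readdr v r e)) ` \<Gamma> \<union> {(a \<odot> sing b \<odot> sing s, r \<odot> s) | s. s \<in> pnodes (pre \<psi>)})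
            (pgraft A (a \<odot> sing b) (pre \<psi>)) (psubst v T r (pre \<psi>))"
        proof (rule derivable.graft)
          show "derivable (insert (a \<odot> sing b, r) \<Gamma>) (PSet A) (PSet T)"
            using w(1) ins ab(1) A T by simp
          show "(a \<odot> sing b, r) \<notin> \<Gamma>" using ab(1) by (simp add: \<Gamma>_def)
          show "derivable v (pre \<psi>) (pre \<phi>)" using u(1) v by simp
          show "sequent (n + 2) (insert (a \<odot> sing b, r) \<Gamma>) (PSet A) (PSet T)"
            using sequent_pre[OF w(2)] ins ab(1) A T by simp
          show "sequent (n + 1) v (pre \<psi>) (pre \<phi>)"
            using sequent_pre'[OF graft.hyps(3)] by simp
          show "a \<in> pnodes (PSet A)" using pnodes_pre[OF graft.hyps(1)] A ab(2) by simp
          show "b \<in> pnodes (psrc (PSet A) a)" using s pnodes_pre[OF opa] ab(3) by simp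
          show "psrc (psrc (PSet A) a) b = pre \<phi>" using s psrc_pre[OF opa ab(3)] ab(4) by simp
        qed
        have ctx: "(\<lambda>(l, e). (l, readdr v r e)) ` \<Gamma> \<union> {(l \<odot> sing s, r \<odot> s) | s. s \<in> pnodes (pre \<psi>)} =
          graft_graph l r (corolla_graph \<psi>) v w"
        proof -
          have "\<Gamma> = {(l', e). (l', e) \<in> w \<and> l' \<noteq> l}"
            unfolding \<Gamma>_def using bij_graphD(3)[OF bij r] by auto
          then have "(\<lambda>(l, e). (l, readdr v r e)) ` \<Gamma> = {(l', readdr v r e) | l' e. (l', e) \<in> w \<and> l' \<noteq> l}"
            by force
          then show ?thesis
            unfolding graft_graph_corolla pnodes_pre[OF graft.hyps(2)] by (simp only: Un_commute)
        qed
        note op = graft_corolla_opetope[OF graft.hyps]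
        have "derivable (graft_graph l r (corolla_graph \<psi>) v w) (pre (graft \<nu> l (corolla \<psi>)))
            (pre (replace_node \<tau> r \<psi> v))"
          using D unfolding ctx pre_graft[OF graft.hyps(1,4) A op] ab(1)[symmetric]
            pre_target_graft[OF w(2) graft.hyps(4) r graft.hyps(3) T] .
        then show ?thesis using has_target_graft'[OF graft.hyps(1) w(2) graft.hyps(2,3,4) r] by blast
      qed
    qed
    then show ?thesis using 3 by auto
  qed
qed

lemma derivable_has_target:
  assumes "has_target (Suc k) \<omega> \<tau> w"
  shows "derivable w (pre \<omega>) (pre \<tau>)"
proof -
  have "opetope (Suc k) \<omega>" by (rule target_okD(1)[OF target_ok[OF assms]])
  then obtain w' \<tau>' where "derivable w' (pre \<omega>) (pre \<tau>')" "has_target (Suc k) \<omega> \<tau>' w'"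
    using derivable_pre[of "Suc k" \<omega>] by auto
  then show ?thesis using target_unique[OF assms] by blast
qed

text \<open>Induction on derivations. The point of the case \<open>graft\<close> is that the
  opetopes behind the two premises fit together: the label of the leaf must be the target of
  \<psi>.\<close>

lemma derivableD:
  "derivable \<Gamma> p t \<Longrightarrow> \<exists>m \<omega>. opetope m \<omega> \<and> p = pre \<omega> \<and>
    (case m of 0 \<Rightarrow> \<Gamma> = {} \<and> t = PEmpty | Suc k \<Rightarrow> \<exists>\<tau>. t = pre \<tau> \<and> has_target m \<omega> \<tau> \<Gamma>)"
proof (induction rule: derivable.induct)
  case point
  show ?case by (intro exI[of _ 0] exI[of _ OPt]) simp
next
  case (degen \<Gamma> p t)
  then obtain m \<phi> where \<phi>: "opetope m \<phi>" "p = pre \<phi>" by blast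
  obtain \<tau> where \<tau>: "has_target (Suc (Suc m)) (OEdge \<phi>) \<tau> {(\<epsilon>, \<epsilon>)}" "pre \<tau> = PSet {|(\<epsilon>, pre \<phi>)|}"
    by (rule has_target_edge[OF \<phi>(1)])
  have "PSet {|(\<epsilon>, p)|} = pre \<tau>" using \<tau>(2) \<phi>(2) by simp
  then show ?case using \<phi> \<tau>(1) by (intro exI[of _ "Suc (Suc m)"] exI[of _ "OEdge \<phi>"]) fastforce
next
  case (shift \<Gamma> p t)
  then obtain m \<phi> where \<phi>: "opetope m \<phi>" "p = pre \<phi>" by blast
  show ?case
  proof (cases m)
    case 0
    then show ?thesis using \<phi>
      by (intro exI[of _ "Suc 0"] exI[of _ OArr]) (auto simp: opetope_low has_target_low pnodes_def)
  next
    case (Suc k)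
    have "has_target (Suc m) (corolla \<phi>) \<phi> {(sing a, a) | a. a \<in> pnodes p}"
      using has_target_corolla[of k \<phi>] \<phi> pnodes_pre[OF \<phi>(1)] Suc by simp
    then show ?thesis
      using \<phi> Suc opetope_corolla[of k \<phi>] pre_corolla[of k \<phi>]
      by (intro exI[of _ "Suc m"] exI[of _ "corolla \<phi>"]) auto
  qed
next
  case (graft a b r \<Gamma> A T \<Upsilon> q u n)
  let ?l = "a \<odot> sing b"
  obtain m \<nu> where \<nu>0: "opetope m \<nu>" "PSet A = pre \<nu>"
    "case m of 0 \<Rightarrow> insert (?l, r) \<Gamma> = {} \<and> PSet T = PEmpty
      | Suc k \<Rightarrow> \<exists>\<tau>. PSet T = pre \<tau> \<and> has_target m \<nu> \<tau> (insert (?l, r) \<Gamma>)"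
    using graft.IH(1) by blast
  \<comment> \<open>The induction hypotheses give opetopes of some dimension; the side conditions on
    sequents fix it.\<close>
  have "preopetope (n + 2) (PSet A)" using graft.hyps by (simp add: sequent_def Preopetopes_def)
  then have m: "m = Suc (Suc n)" using preopetope_dim preopetope_pre[OF \<nu>0(1)] \<nu>0(2) by fastforce
  obtain \<tau> where \<nu>: "opetope (Suc (Suc n)) \<nu>" "PSet A = pre \<nu>" "PSet T = pre \<tau>"
    "has_target (Suc (Suc n)) \<nu> \<tau> (insert (?l, r) \<Gamma>)"
    using \<nu>0 m by auto
  obtain m' \<psi> where \<psi>0: "opetope m' \<psi>" "q = pre \<psi>"
    "case m' of 0 \<Rightarrow> \<Upsilon> = {} \<and> u = PEmpty | Suc k \<Rightarrow> \<exists>\<tau>. u = pre \<tau> \<and> has_target m' \<psi> \<tau> \<Upsilon>"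
    using graft.IH(2) by blast
  have "preopetope (n + 1) q" using graft.hyps by (simp add: sequent_def Preopetopes_def)
  then have m': "m' = Suc n" using preopetope_dim preopetope_pre[OF \<psi>0(1)] \<psi>0(2) by fastforce
  obtain \<phi> where \<psi>: "opetope (Suc n) \<psi>" "q = pre \<psi>" "u = pre \<phi>" "has_target (Suc n) \<psi> \<phi> \<Upsilon>"
    using \<psi>0 m' by auto
  have a: "a \<in> nodes \<nu>" using graft.hyps \<nu>(2) pnodes_pre[OF \<nu>(1)] by simp
  have s: "psrc (PSet A) a = pre (src \<nu> a)" unfolding \<nu>(2) by (rule psrc_pre[OF \<nu>(1) a])
  have opa: "opetope (Suc n) (src \<nu> a)" by (rule opetope_nodes_src[OF \<nu>(1) a])
  have b: "b \<in> nodes (src \<nu> a)" using graft.hyps s pnodes_pre[OF opa] by simp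
  have opb: "opetope n (src (src \<nu> a) b)" by (rule opetope_nodes_src[OF opa b])
  have op\<phi>: "opetope n \<phi>" by (rule target_okD(2)[OF target_ok[OF \<psi>(4)]])
  \<comment> \<open>The side condition of the rule equates preopetopes only; injectivity of
    \<open>pre\<close> turns this into an equality of opetopes.\<close>
  have "pre (src (src \<nu> a) b) = pre \<phi>" using graft.hyps s psrc_pre[OF opa b] \<psi>(3) by simp
  then have eq: "src (src \<nu> a) b = \<phi>" using pre_inject[OF opb op\<phi>] by blast
  note ok = target_okD[OF target_ok[OF \<nu>(4)]]
  have mem: "(?l, r) \<in> insert (?l, r) \<Gamma>" by simp
  have "leaf_label \<nu> ?l \<noteq> None" using ok(4)[OF mem] by simp
  then obtain \<phi>' where \<phi>': "leaf_label \<nu> ?l = Some \<phi>'" by blast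
  obtain \<alpha> where \<alpha>: "inner_label \<nu> a = Some \<alpha>" using a nodes_tree[OF \<nu>(1)] by auto
  have "\<phi>' = src \<alpha> b" using opetope_children(2)[OF \<nu>(1) \<alpha> leaf_in_tree[OF \<phi>']] by simp
  then have lab: "leaf_label \<nu> ?l = Some \<phi>" using \<phi>' eq \<alpha> src_tree[OF \<nu>(1)] by simp
  note G = has_target_graft'[OF \<nu>(1,4) \<psi>(1,4) lab mem]
  note op = graft_corolla_opetope[OF \<nu>(1) \<psi>(1,4) lab]
  have ctx: "graft_graph ?l r (corolla_graph \<psi>) \<Upsilon> (insert (?l, r) \<Gamma>) =
    (\<lambda>(l, e). (l, readdr \<Upsilon> r e)) ` \<Gamma> \<union> {(?l \<odot> sing s, r \<odot> s) | s. s \<in> pnodes q}"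
  proof -
    \<comment> \<open>The context is the graph of a bijection, so the active pair is the only one
      with numerator \<open>?l\<close>.\<close>
    have "l' \<noteq> ?l" if "(l', e) \<in> \<Gamma>" for l' e
    proof
      assume "l' = ?l"
      then have "e = r" using bij_graphD(3)[OF ok(3) mem] that by blast
      then show False using that \<open>l' = ?l\<close> graft.hyps by blast
    qed
    then have "{(l', readdr \<Upsilon> r e) | l' e. (l', e) \<in> insert (?l, r) \<Gamma> \<and> l' \<noteq> ?l} =
      (\<lambda>(l, e). (l, readdr \<Upsilon> r e)) ` \<Gamma>" by force
    then show ?thesis
      unfolding graft_graph_corolla \<psi>(2) pnodes_pre[OF \<psi>(1)] by (simp only: Un_commute)
  qed
  have "pgraft A ?l q = pre (graft \<nu> ?l (corolla \<psi>))"
    unfolding \<psi>(2) by (rule pre_graft[OF \<nu>(1) lab \<nu>(2)[symmetric] op, symmetric])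
  moreover have "psubst \<Upsilon> T r q = pre (replace_node \<tau> r \<psi> \<Upsilon>)"
    unfolding \<psi>(2) by (rule pre_target_graft[OF \<nu>(4) lab mem \<psi>(4) \<nu>(3)[symmetric], symmetric])
  ultimately show ?case
    using op G unfolding ctx by (intro exI[of _ "Suc (Suc n)"] exI[of _ "graft \<nu> ?l (corolla \<psi>)"]) auto
qed

text \<open>By injectivity of \<open>pre\<close> across dimensions, a derivation with subject
  \<open>pre \<omega>\<close> can only come from \<omega> itself.\<close>

lemma derivable_pre_iff:
  assumes "opetope (Suc k) \<omega>"
  shows "derivable \<Gamma> (pre \<omega>) t \<longleftrightarrow> (\<exists>\<tau>. t = pre \<tau> \<and> has_target (Suc k) \<omega> \<tau> \<Gamma>)"
proof
  assume "derivable \<Gamma> (pre \<omega>) t"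
  from derivableD[OF this] obtain m \<omega>' where *: "opetope m \<omega>'" "pre \<omega> = pre \<omega>'"
    "case m of 0 \<Rightarrow> \<Gamma> = {} \<and> t = PEmpty | Suc k \<Rightarrow> \<exists>\<tau>. t = pre \<tau> \<and> has_target m \<omega>' \<tau> \<Gamma>"
    by blast
  then have "\<omega>' = \<omega>" using pre_eq_iff[OF assms *(1)] by simp
  moreover have "m = Suc k" using preopetope_dim preopetope_pre assms * by metis
  ultimately show "\<exists>\<tau>. t = pre \<tau> \<and> has_target (Suc k) \<omega> \<tau> \<Gamma>" using * by simp
qed (use derivable_has_target in blast)

section \<open>Valid preopetopes, the inverse map and the theorem\<close>

lemma ValidPreopetopes_eq: "ValidPreopetopes n = pre ` Opetopes n"
proof
  show "ValidPreopetopes n \<subseteq> pre ` Opetopes n"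
  proof
    fix p assume "p \<in> ValidPreopetopes n"
    then obtain \<Gamma> t where p: "preopetope n p" "derivable \<Gamma> p t"
      by (auto simp: ValidPreopetopes_def Preopetopes_def)
    obtain m \<omega> where \<omega>: "opetope m \<omega>" "p = pre \<omega>" using derivableD[OF p(2)] by blast
    then have "m = n" using preopetope_dim[OF preopetope_pre[OF \<omega>(1)]] p(1) by blast
    then show "p \<in> pre ` Opetopes n" using \<omega> by (simp add: Opetopes_def)
  qed
  show "pre ` Opetopes n \<subseteq> ValidPreopetopes n"
  proof
    fix p assume "p \<in> pre ` Opetopes n"
    then obtain \<omega> where \<omega>: "opetope n \<omega>" "p = pre \<omega>" by (auto simp: Opetopes_def)
    have "\<exists>\<Gamma> t. sequent n \<Gamma> p t \<and> derivable \<Gamma> p t"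
    proof (cases n)
      case 0
      then show ?thesis using \<omega> sequent_low(1) derivable.point by (auto simp: opetope_low)
    next
      case (Suc k)
      obtain \<tau> w where "has_target (Suc k) \<omega> \<tau> w" using target_lawsD(1)[OF target_laws] \<omega>(1) Suc by blast
      then show ?thesis using sequent_pre' derivable_has_target \<omega>(2) Suc by blast
    qed
    then show "p \<in> ValidPreopetopes n"
      using \<omega> preopetope_pre by (simp add: ValidPreopetopes_def Preopetopes_def)
  qed
qed

lemma valid_pre: "opetope n \<omega> \<Longrightarrow> pre \<omega> \<in> ValidPreopetopes n"
  by (simp add: ValidPreopetopes_eq Opetopes_def)

lemma validE:
  assumes "p \<in> ValidPreopetopes n"
  obtains \<omega> where "opetope n \<omega>" "p = pre \<omega>"
  using assms unfolding ValidPreopetopes_eq Opetopes_def by blast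

text \<open>The graft clause does not say directly that \<psi> fits on the leaf \<open>l\<close> of
  \<nu>. This is extracted from the validity of the grafted preopetope: it is
  \<open>pre \<omega>\<close> for a tree \<omega> in which \<psi> sits at \<open>l\<close>, on the
  input \<open>b\<close> of the node \<open>a\<close>. So the label of that input is a target of
  \<psi>, and it is also the label of \<open>l\<close> in \<nu>.\<close>

lemma to_poly_rel_sound: "to_poly_rel p \<omega> \<Longrightarrow> (\<exists>m. opetope m \<omega>) \<and> p = pre \<omega>"
proof (induction rule: to_poly_rel.induct)
  case (3 q n \<phi>)
  then obtain m where "opetope m \<phi>" by blast
  then have "opetope (Suc (Suc m)) (OEdge \<phi>)" by simp
  then show ?case using 3 by (metis pre.simps(3))
next
  case (4 q n \<psi>)
  from 4(1) obtain \<psi>' where \<psi>': "opetope (Suc n) \<psi>'" "q = pre \<psi>'" by (rule validE[where n = "n + 1"]) simp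
  obtain m where m: "opetope m \<psi>" "q = pre \<psi>" using 4 by blast
  have "\<psi> = \<psi>'" using pre_eq_iff[OF m(1) \<psi>'(1)] m \<psi>' by simp
  then show ?case using \<psi>' opetope_corolla[OF \<psi>'(1)] pre_corolla[OF \<psi>'(1)] by auto
next
  case (5 A n q l \<nu> \<psi>)
  from 5(1) obtain \<nu>' where \<nu>': "opetope (Suc (Suc n)) \<nu>'" "PSet A = pre \<nu>'" by (rule validE[where n = "n + 2"]) simp
  have "\<nu>' = \<nu>" using pre_eq_iff[OF \<nu>'(1)] 5 \<nu>' by auto
  then have \<nu>: "opetope (Suc (Suc n)) \<nu>" "PSet A = pre \<nu>" using \<nu>' by simp_all
  from 5(2) obtain \<psi>' where \<psi>': "opetope (Suc n) \<psi>'" "q = pre \<psi>'" by (rule validE[where n = "n + 1"]) simp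
  have "\<psi>' = \<psi>" using pre_eq_iff[OF \<psi>'(1)] 5 \<psi>' by auto
  then have \<psi>: "opetope (Suc n) \<psi>" "q = pre \<psi>" using \<psi>' by simp_all
  from 5(4) obtain \<omega> where \<omega>: "opetope (Suc (Suc n)) \<omega>" "pgraft A l q = pre \<omega>" by (rule validE[where n = "n + 2"]) simp
  have as: "assignments (pre \<omega>) = insert (l, pre \<psi>) (assignments (pre \<nu>))"
    unfolding \<omega>(2)[symmetric] \<nu>(2)[symmetric] \<psi>(2)[symmetric] pgraft_def by simp
  have lab: "inner_label \<omega> a = Some \<chi>" if h: "(a, pre \<chi>) \<in> assignments (pre \<omega>)" "opetope (Suc n) \<chi>" for a \<chi>
  proof -
    obtain \<chi>' where \<chi>': "inner_label \<omega> a = Some \<chi>'" "pre \<chi> = pre \<chi>'" using inner_labelI[OF \<omega>(1) h(1)] .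
    have "\<chi> = \<chi>'" by (rule pre_inject[OF h(2) opetope_label(1)[OF \<omega>(1) \<chi>'(1)] \<chi>'(2)])
    then show ?thesis using \<chi>' by simp
  qed
  have "l \<in> leaves \<nu>" using 5(3) unfolding \<nu>(2) pleaves_pre[OF \<nu>(1)] .
  then obtain \<phi> where \<phi>: "leaf_label \<nu> l = Some \<phi>" unfolding leaves_eq by blast
  have "\<nu> \<noteq> OEdge \<chi>" for \<chi> using \<nu>(2) by auto
  then obtain a b where ab: "l = a \<odot> sing b" "a \<in> nodes \<nu>" "b \<in> nodes (src \<nu> a)" "src (src \<nu> a) b = \<phi>"
    using leaf_of_node[OF \<nu>(1) _ \<phi>] by blast
  obtain \<alpha> where \<alpha>: "inner_label \<nu> a = Some \<alpha>" using ab(2) nodes_tree[OF \<nu>(1)] by blast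
  have "(a, pre \<alpha>) \<in> assignments (pre \<nu>)" using assignments_tree[OF \<nu>(1)] \<alpha> by blast
  then have \<alpha>': "inner_label \<omega> a = Some \<alpha>"
    using lab[of a \<alpha>] as opetope_label(1)[OF \<nu>(1) \<alpha>] by blast
  have "inner_label \<omega> l = Some \<psi>" by (rule lab[OF _ \<psi>(1)]) (simp add: as)
  then obtain ts where ts: "subtree \<omega> (a \<odot> sing b) = Some (ONode \<psi> ts)"
    by (auto simp: inner_label_eq_Some ab(1))
  have "src \<alpha> b = \<phi>" using ab(4) \<alpha> src_tree[OF \<nu>(1)] by simp
  then obtain v where v: "has_target (Suc n) \<psi> \<phi> v"
    using opetope_children(2)[OF \<omega>(1) \<alpha>' ts] by (auto simp: root_label_ONode_iff)
  note op = graft_corolla_opetope[OF \<nu>(1) \<psi>(1) v \<phi>]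
  from pre_graft[OF \<nu>(1) \<phi> \<nu>(2)[symmetric] op] op show ?case using \<psi>(2) by auto
qed (use opetope_pt opetope_arr in auto)

lemma to_poly_rel_pre: "opetope m \<omega> \<Longrightarrow> to_poly_rel (pre \<omega>) \<omega>"
proof (induction m arbitrary: \<omega> rule: less_induct)
  case (less m)
  show ?case
  proof (cases m rule: dim_cases)
    case (3 n)
    show ?thesis using target_laws[of n] less.prems[unfolded 3]
    proof (induction rule: tree_graft_induct)
      case (edge \<phi>)
      then show ?case using less.IH[of n] 3 valid_pre[OF edge] by (auto intro: to_poly_rel.intros(3))
    next
      case (graft \<nu> l \<psi> \<phi> v)
      have \<psi>: "to_poly_rel (pre \<psi>) \<psi>" by (rule less.IH[OF _ graft.hyps(2)]) (simp add: 3)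
      from graft.hyps(1) show ?case
      proof (cases rule: opetope_tree_cases)
        case (edge \<phi>')
        then have "graft \<nu> l (corolla \<psi>) = corolla \<psi>" using graft_edge graft.hyps(4) by blast
        then show ?thesis
          using to_poly_rel.intros(4)[OF _ \<psi>, of n] valid_pre[OF graft.hyps(2)] pre_corolla[OF graft.hyps(2)] by simp
      next
        case (node \<alpha> ts)
        then have \<epsilon>: "inner_label \<nu> \<epsilon> = Some \<alpha>" by simp
        with graft.hyps(1) obtain A where A: "pre \<nu> = PSet A" by (rule pre_tree)
        note op = graft_corolla_opetope[OF graft.hyps]
        note P = pre_graft[OF graft.hyps(1,4) A op]
        have "to_poly_rel (pgraft A l (pre \<psi>)) (graft \<nu> l (corolla \<psi>))"
        proof (rule to_poly_rel.intros(5))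
          show "PSet A \<in> ValidPreopetopes (n + 2)" using valid_pre[OF graft.hyps(1)] A by simp
          show "pre \<psi> \<in> ValidPreopetopes (n + 1)" using valid_pre[OF graft.hyps(2)] by simp
          show "l \<in> pleaves (PSet A)"
            using pleaves_pre[OF graft.hyps(1)] A graft.hyps(4) by (auto simp: leaves_eq simp del: pleaves.simps)
          show "pgraft A l (pre \<psi>) \<in> ValidPreopetopes (n + 2)" using valid_pre[OF op] P by simp
          show "to_poly_rel (PSet A) \<nu>" using graft.IH A by simp
        qed (fact \<psi>)
        then show ?thesis using P by simp
      qed
    qed
  qed (use less.prems in \<open>auto simp: opetope_low intro: to_poly_rel.intros\<close>)
qed

lemma to_poly_pre:
  assumes "opetope m \<omega>"
  shows "to_poly (pre \<omega>) = \<omega>"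
  unfolding to_poly_def
proof (rule the_equality)
  show "to_poly_rel (pre \<omega>) \<omega>" by (rule to_poly_rel_pre[OF assms])
  show "\<omega>' = \<omega>" if "to_poly_rel (pre \<omega>) \<omega>'" for \<omega>'
    using to_poly_rel_sound[OF that] pre_eq_iff assms by blast
qed

text \<open>The descriptions \<open>tgt\<close> and \<open>readdressing\<close> range over all
  dimensions, so their uniqueness also requires that \<omega> determines its dimension, which is
  read off from \<open>pre \<omega>\<close>. The last claim allows \<open>to_pre\<close> to be
  computed on the target.\<close>

lemma targets_pre:
  assumes "opetope (Suc k) \<omega>"
  shows "pre (tgt \<omega>) = ptgt (pre \<omega>)" "readdressing \<omega> = preaddressing (pre \<omega>)" "\<exists>n. opetope n (tgt \<omega>)"
proof -
  obtain \<tau> w where T: "has_target (Suc k) \<omega> \<tau> w" using target_lawsD(1)[OF target_laws assms] by blast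
  have un: "\<tau>' = \<tau> \<and> w' = w" if "has_target n \<omega> \<tau>' w'" for n \<tau>' w'
  proof (cases n)
    case 0
    then show ?thesis using that has_target_low(1) by blast
  next
    case (Suc m)
    then have "opetope (Suc m) \<omega>" using target_okD(1)[OF target_ok] that by blast
    then have "n = Suc k" using preopetope_dim[OF preopetope_pre preopetope_pre[OF assms]] Suc by blast
    then show ?thesis using target_unique[OF T] that by blast
  qed
  have tgt: "tgt \<omega> = \<tau>" unfolding tgt_def by (rule the_equality) (use T un in blast)+
  have re: "readdressing \<omega> = w" unfolding readdressing_def by (rule the_equality) (use T un in blast)+
  have "ptgt (pre \<omega>) = pre \<tau>"
    unfolding ptgt_def derivable_pre_iff[OF assms] by (rule the_equality) (use T un in blast)+
  then show "pre (tgt \<omega>) = ptgt (pre \<omega>)" using tgt by simp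
  have "preaddressing (pre \<omega>) = w"
    unfolding preaddressing_def derivable_pre_iff[OF assms] by (rule the_equality) (use T un in blast)+
  then show "readdressing \<omega> = preaddressing (pre \<omega>)" using re by simp
  show "\<exists>n. opetope n (tgt \<omega>)" using tgt target_okD(2)[OF target_ok[OF T]] by blast
qed

theorem theorem4p2p4:
  fixes n :: nat
  shows "(\<forall>\<omega> \<in> Opetopes n. to_pre \<omega> \<in> ValidPreopetopes n \<and> to_poly (to_pre \<omega>) = \<omega>) \<and>
    (\<forall>p \<in> ValidPreopetopes n. to_poly p \<in> Opetopes n \<and> to_pre (to_poly p) = p) \<and>
    (n \<ge> 2 \<longrightarrow> (\<forall>\<omega> \<in> Opetopes n.
       nodes \<omega> = pnodes (to_pre \<omega>) \<and>
       (\<not> degenerate \<omega> \<longrightarrow> leaves \<omega> = pleaves (to_pre \<omega>)) \<and>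
       (\<forall>p \<in> nodes \<omega>. to_pre (src \<omega> p) = psrc (to_pre \<omega>) p) \<and>
       to_pre (tgt \<omega>) = ptgt (to_pre \<omega>) \<and>
       readdressing \<omega> = preaddressing (to_pre \<omega>)))"
proof (intro conjI impI ballI)
  fix \<omega> assume "\<omega> \<in> Opetopes n"
  then have \<omega>: "opetope n \<omega>" by (simp add: Opetopes_def)
  note pre = to_pre_eq[OF \<omega>]
  show "to_pre \<omega> \<in> ValidPreopetopes n" "to_poly (to_pre \<omega>) = \<omega>"
    unfolding pre using valid_pre[OF \<omega>] to_poly_pre[OF \<omega>] by blast+
  show "nodes \<omega> = pnodes (to_pre \<omega>)" unfolding pre pnodes_pre[OF \<omega>] ..
  assume "n \<ge> 2"
  then obtain k where n: "n = Suc (Suc k)" by (metis add_2_eq_Suc le_Suc_ex)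
  note op = \<omega>[unfolded n]
  show "leaves \<omega> = pleaves (to_pre \<omega>)" unfolding pre pleaves_pre[OF op] ..
  show "to_pre (src \<omega> p) = psrc (to_pre \<omega>) p" if "p \<in> nodes \<omega>" for p
    unfolding pre psrc_pre[OF \<omega> that] by (rule to_pre_eq[OF opetope_nodes_src[OF op that]])
  obtain m where "opetope m (tgt \<omega>)" using targets_pre(3)[OF op] by blast
  then show "to_pre (tgt \<omega>) = ptgt (to_pre \<omega>)"
    unfolding pre using targets_pre(1)[OF op] to_pre_eq by simp
  show "readdressing \<omega> = preaddressing (to_pre \<omega>)"
    unfolding pre by (rule targets_pre(2)[OF op])
next
  fix p assume "p \<in> ValidPreopetopes n"
  then obtain \<omega> where \<omega>: "opetope n \<omega>" "p = pre \<omega>" by (rule validE)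
  show "to_poly p \<in> Opetopes n" "to_pre (to_poly p) = p"
    unfolding \<omega>(2) to_poly_pre[OF \<omega>(1)] using \<omega> to_pre_eq[OF \<omega>(1)] by (simp_all add: Opetopes_def)
qed

end
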